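(* Let $\mathcal X\subseteq\mathbb R^d$ be a manifold of intrinsic dimension $m<4$, and let $\mathcal X$, the design distribution $P$ with density $p$, and the kernel $K$ satisfy the conditions listed in the context. There exist constants $C_0,c_0,N,C,c>0$, depending only on $d,m,\mathcal X,p,K$ (in particular not on $f_0,M,n,r,\delta$), such that the following holds. Let $n\ge N$, $n^{-1/2}\le M\le n^{1/m}$, $f_0\in H^1(\mathcal X,M)$, $\delta\in(0,1)$, let $$C_0\Bigl(\frac{\log n}{n}\Bigr)^{1/m}\le r\le\min\Bigl\{c_0,\;M^{(m-4)/(4+2m)}\,n^{-3/(4+2m)}\Bigr\},$$ and let $(X_1,Y_1),\dots,(X_n,Y_n)$ be i.i.d. from the regression model with regression function $f_0$. Then the Laplacian smoothing estimator $\hat f$ computed on the neighborhood graph $G_{n,r}$ with $\rho=M^{-4/(2+m)}(nr^{m+2})^{-1}n^{-2/(2+m)}$ satisfies $$\|\hat f-f_0\|_n^2\le\frac C\delta\,M^{2m/(2+m)}\,n^{-2/(2+m)}$$ with probability at least $1-\delta-Cn\exp(-cnr^m)-\exp\bigl(-c(M^2n)^{m/(2+m)}\bigr)$.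
   Context: Design: $P$ is supported on a compact, connected, smooth manifold $\mathcal X$ embedded in $\mathbb R^d$, of dimension $m\le d$, without boundary and with positive reach; $P$ has a density $p$ with respect to the volume form of $\mathcal X$ with $0<p_{\min}\le p(x)\le p_{\max}<\infty$ for all $x\in\mathcal X$, and $p$ is Lipschitz on $\mathcal X$ with constant $L_p$. Model: $X_i\sim P$ and $Y_i=f_0(X_i)+\varepsilon_i$, with $\varepsilon_i\sim N(0,1)$ independent of $X_i$, the pairs being i.i.d. Kernel: $K:[0,\infty)\to[0,\infty)$ is nonincreasing, supported on $[0,1]$, Lipschitz on $[0,1]$, $K(1)>0$, $\int_{\mathbb R^d}K(\|z\|_2)\,dz=1$, and $\sigma_K=\frac1d\int_{\mathbb R^d}\|x\|_2^2K(\|x\|_2)\,dx<\infty$. Neighborhood graph $G_{n,r}$: vertices $\{1,\dots,n\}$, weights $W_{ij}=K(\|X_i-X_j\|_2/r)$ (Euclidean distance in $\mathbb R^d$), degree matrix $D$ diagonal with $D_{ii}=\sum_jW_{ij}$, Laplacian $L=D-W$. Laplacian smoothing estimator: $\hat f=\operatorname{argmin}_{f\in\mathbb R^n}\sum_{i=1}^n(Y_i-f_i)^2+\rho f^\top Lf$. In-sample error: $\|\hat f-f_0\|_n^2=\frac1n\sum_{i=1}^n(\hat f_i-f_0(X_i))^2$. Sobolev ball on the manifold (integrals with respect to the volume form, $\nabla$ the Riemannian weak gradient): $|f|_{H^1(\mathcal X)}^2=\int_{\mathcal X}\|\nabla f\|^2$, $\|f\|_{H^1(\mathcal X)}=\|f\|_{L^2(\mathcal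 X)}+|f|_{H^1(\mathcal X)}$, $H^1(\mathcal X,M)=\{f\in H^1(\mathcal X):\|f\|_{H^1(\mathcal X)}^2\le M^2\}$. Point evaluations $f_0(X_i)$ refer to a fixed representative of $f_0$; the choice does not matter almost surely. *)

theory Defs
  imports "HOL-Probability.Probability"
begin

section \<open>Smooth maps and embedded submanifolds\<close>

text \<open>\<open>C_k_on k S f\<close> is meant for open \<open>S\<close>: all iterated directional derivatives of \<open>f\<close> up to
  order \<open>k\<close> exist (in the Frechet sense) and are continuous on \<open>S\<close>.\<close>

primrec C_k_on ::
  "nat \<Rightarrow> 'a::euclidean_space set \<Rightarrow> ('a \<Rightarrow> 'b::euclidean_space) \<Rightarrow> bool" where
  "C_k_on 0 S f \<longleftrightarrow> continuous_on S f"
| "C_k_on (Suc k) S f \<longleftrightarrow>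
     (\<forall>x\<in>S. f differentiable (at x)) \<and>
     (\<forall>v. C_k_on k S (\<lambda>x. frechet_derivative f (at x) v))"

definition smooth_on ::
  "'a::euclidean_space set \<Rightarrow> ('a \<Rightarrow> 'b::euclidean_space) \<Rightarrow> bool" where
  "smooth_on S f \<longleftrightarrow> (\<forall>k. C_k_on k S f)"

text \<open>A local parametrization of \<open>X\<close> is a smooth immersion of an open \<open>U\<close> that is a homeomorphism
  onto a relatively open subset of \<open>X\<close>. The values of \<open>\<phi>\<close> outside \<open>U\<close> are irrelevant.\<close>

definition local_param ::
  "(real^'d) set \<Rightarrow> (real^'m) set \<Rightarrow> (real^'m \<Rightarrow> real^'d) \<Rightarrow> bool" where
  "local_param X U \<phi> \<longleftrightarrow>
     open U \<and> smooth_on U \<phi> \<and>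
     (\<forall>u\<in>U. inj (frechet_derivative \<phi> (at u))) \<and>
     openin (top_of_set X) (\<phi> ` U) \<and>
     (\<exists>\<psi>. homeomorphism U (\<phi> ` U) \<phi> \<psi>)"

text \<open>The intrinsic dimension is \<open>CARD('m)\<close>. Parameter domains are open in \<open>\<real>\<^sup>m\<close>, so the manifold
  has no boundary.\<close>

definition smooth_submanifold :: "'m::finite itself \<Rightarrow> (real^'d) set \<Rightarrow> bool" where
  "smooth_submanifold TYPE('m) X \<longleftrightarrow>
     (\<forall>x\<in>X. \<exists>(U :: (real^'m) set) \<phi>. local_param X U \<phi> \<and> x \<in> \<phi> ` U)"

definition reach :: "'a::metric_space set \<Rightarrow> ereal" where
  "reach X = (SUP \<epsilon> \<in> {\<epsilon>. 0 \<le> \<epsilon> \<and>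
      (\<forall>y. infdist y X < \<epsilon> \<longrightarrow> (\<exists>!x. x \<in> X \<and> dist y x = infdist y X))}. ereal \<epsilon>)"

text \<open>Riemannian metric induced by the embedding, in the coordinates \<open>\<phi>\<close>.\<close>

definition metric_tensor :: "(real^'m \<Rightarrow> real^'d) \<Rightarrow> real^'m \<Rightarrow> real^'m^'m" where
  "metric_tensor \<phi> u =
     (\<chi> i j. frechet_derivative \<phi> (at u) (axis i 1) \<bullet> frechet_derivative \<phi> (at u) (axis j 1))"

text \<open>The measure of the Riemannian volume form, as a Borel measure with underlying space \<open>X\<close>. On a
  smooth submanifold exactly one measure has this property: it is prescribed on every
  parametrized patch, and countably many patches cover \<open>X\<close>.\<close>

definition riemannian_volume ::
  "'m::finite itself \<Rightarrow> (real^'d) set \<Rightarrow> (real^'d) measure \<Rightarrow> bool" where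
  "riemannian_volume TYPE('m) X vol \<longleftrightarrow>
     sets vol = sets (restrict_space borel X) \<and>
     (\<forall>(U :: (real^'m) set) \<phi> A. local_param X U \<phi> \<and> A \<in> sets borel \<and> A \<subseteq> U \<longrightarrow>
        emeasure vol (\<phi> ` A) =
          (\<integral>\<^sup>+u\<in>A. ennreal (sqrt (det (metric_tensor \<phi> u))) \<partial>lborel))"


section \<open>The Sobolev ball\<close>

definition test_functions :: "(real^'m) set \<Rightarrow> (real^'m \<Rightarrow> real) set" where
  "test_functions U =
     {\<psi>. smooth_on UNIV \<psi> \<and> compact (closure {u. \<psi> u \<noteq> 0}) \<and> closure {u. \<psi> u \<noteq> 0} \<subseteq> U}"

definition has_weak_partial ::
  "(real^'m) set \<Rightarrow> 'm \<Rightarrow> (real^'m \<Rightarrow> real) \<Rightarrow> (real^'m \<Rightarrow> real) \<Rightarrow> bool" where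
  "has_weak_partial U i g h \<longleftrightarrow>
     (\<forall>C. compact C \<and> C \<subseteq> U \<longrightarrow> set_integrable lborel C g \<and> set_integrable lborel C h) \<and>
     (\<forall>\<psi>\<in>test_functions U.
        (LINT u:U|lborel. g u * frechet_derivative \<psi> (at u) (axis i 1)) =
        - (LINT u:U|lborel. h u * \<psi> u))"

text \<open>\<open>G\<close> is a tangent vector field whose inner products with the coordinate vector fields
  \<open>\<partial>\<^sub>i\<phi>\<close> are the weak partial derivatives of \<open>f \<circ> \<phi>\<close>, that is,
  \<open>G = \<Sum>\<^sub>i\<^sub>j g\<^sup>i\<^sup>j \<partial>\<^sub>i(f \<circ> \<phi>) \<partial>\<^sub>j\<phi>\<close> with \<open>g\<close> the metric tensor.\<close>

definition has_weak_gradient ::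
  "'m::finite itself \<Rightarrow> (real^'d) set \<Rightarrow> (real^'d) measure \<Rightarrow>
     (real^'d \<Rightarrow> real) \<Rightarrow> (real^'d \<Rightarrow> real^'d) \<Rightarrow> bool" where
  "has_weak_gradient TYPE('m) X vol f G \<longleftrightarrow>
     G \<in> borel_measurable vol \<and>
     (\<forall>(U :: (real^'m) set) \<phi>. local_param X U \<phi> \<longrightarrow>
        (\<forall>u\<in>U. G (\<phi> u) \<in> range (frechet_derivative \<phi> (at u))) \<and>
        (\<forall>i. has_weak_partial U i (\<lambda>u. f (\<phi> u))
               (\<lambda>u. G (\<phi> u) \<bullet> frechet_derivative \<phi> (at u) (axis i 1))))"

definition L2_fun :: "'a measure \<Rightarrow> ('a \<Rightarrow> 'b::euclidean_space) \<Rightarrow> bool" where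
  "L2_fun \<mu> f \<longleftrightarrow> f \<in> borel_measurable \<mu> \<and> integrable \<mu> (\<lambda>x. (norm (f x))\<^sup>2)"

definition L2_norm_on :: "'a measure \<Rightarrow> ('a \<Rightarrow> 'b::euclidean_space) \<Rightarrow> real" where
  "L2_norm_on \<mu> f = sqrt (LINT x|\<mu>. (norm (f x))\<^sup>2)"

definition H1_space ::
  "'m::finite itself \<Rightarrow> (real^'d) set \<Rightarrow> (real^'d) measure \<Rightarrow> (real^'d \<Rightarrow> real) set" where
  "H1_space m X vol =
     {f. L2_fun vol f \<and> (\<exists>G. has_weak_gradient m X vol f G \<and> L2_fun vol G)}"

text \<open>The weak gradient is unique up to null sets, so the choice does not affect the norms below.\<close>

definition weak_gradient ::
  "'m::finite itself \<Rightarrow> (real^'d) set \<Rightarrow> (real^'d) measure \<Rightarrow>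
     (real^'d \<Rightarrow> real) \<Rightarrow> real^'d \<Rightarrow> real^'d" where
  "weak_gradient m X vol f = (SOME G. has_weak_gradient m X vol f G \<and> L2_fun vol G)"

definition H1_seminorm ::
  "'m::finite itself \<Rightarrow> (real^'d) set \<Rightarrow> (real^'d) measure \<Rightarrow> (real^'d \<Rightarrow> real) \<Rightarrow> real" where
  "H1_seminorm m X vol f = L2_norm_on vol (weak_gradient m X vol f)"

definition H1_norm ::
  "'m::finite itself \<Rightarrow> (real^'d) set \<Rightarrow> (real^'d) measure \<Rightarrow> (real^'d \<Rightarrow> real) \<Rightarrow> real" where
  "H1_norm m X vol f = L2_norm_on vol f + H1_seminorm m X vol f"

text \<open>Elements are genuine Borel functions on \<open>X\<close> (not classes), so point evaluations make sense.\<close>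

definition H1_ball ::
  "'m::finite itself \<Rightarrow> (real^'d) set \<Rightarrow> (real^'d) measure \<Rightarrow> real \<Rightarrow> (real^'d \<Rightarrow> real) set" where
  "H1_ball m X vol M = {f \<in> H1_space m X vol. (H1_norm m X vol f)\<^sup>2 \<le> M\<^sup>2}"


section \<open>The kernel\<close>

definition sigma_kernel :: "'d::finite itself \<Rightarrow> (real \<Rightarrow> real) \<Rightarrow> ennreal" where
  "sigma_kernel TYPE('d) K =
     (\<integral>\<^sup>+x. ennreal ((norm (x :: real^'d))\<^sup>2 * K (norm x)) \<partial>lborel) / of_nat CARD('d)"

definition admissible_kernel :: "'d::finite itself \<Rightarrow> (real \<Rightarrow> real) \<Rightarrow> bool" where
  "admissible_kernel TYPE('d) K \<longleftrightarrow>
     (\<forall>t\<ge>0. 0 \<le> K t) \<and>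
     antimono_on {0..} K \<and>
     (\<forall>t>1. K t = 0) \<and>
     (\<exists>B. B-lipschitz_on {0..1} K) \<and>
     0 < K 1 \<and>
     has_bochner_integral lborel (\<lambda>z :: real^'d. K (norm z)) 1 \<and>
     sigma_kernel TYPE('d) K < \<infinity>"


section \<open>Laplacian smoothing on the neighborhood graph\<close>

text \<open>Vertices are \<open>{..<n}\<close>; vectors in \<open>\<real>\<^sup>n\<close> and \<open>n \<times> n\<close> matrices are functions on this index set.\<close>

definition graph_weight ::
  "(real \<Rightarrow> real) \<Rightarrow> real \<Rightarrow> (nat \<Rightarrow> real^'d) \<Rightarrow> nat \<Rightarrow> nat \<Rightarrow> real" where
  "graph_weight K r x i j = K (norm (x i - x j) / r)"

definition graph_degree ::
  "nat \<Rightarrow> (real \<Rightarrow> real) \<Rightarrow> real \<Rightarrow> (nat \<Rightarrow> real^'d) \<Rightarrow> nat \<Rightarrow> nat \<Rightarrow> real" where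
  "graph_degree n K r x i j = (if i = j then \<Sum>k<n. graph_weight K r x i k else 0)"

definition graph_laplacian ::
  "nat \<Rightarrow> (real \<Rightarrow> real) \<Rightarrow> real \<Rightarrow> (nat \<Rightarrow> real^'d) \<Rightarrow> nat \<Rightarrow> nat \<Rightarrow> real" where
  "graph_laplacian n K r x i j = graph_degree n K r x i j - graph_weight K r x i j"

definition smoothing_objective ::
  "nat \<Rightarrow> (real \<Rightarrow> real) \<Rightarrow> real \<Rightarrow> real \<Rightarrow> (nat \<Rightarrow> real^'d) \<Rightarrow> (nat \<Rightarrow> real) \<Rightarrow>
     (nat \<Rightarrow> real) \<Rightarrow> real" where
  "smoothing_objective n K r \<rho> x y f =
     (\<Sum>i<n. (y i - f i)\<^sup>2) +
     \<rho> * (\<Sum>i<n. \<Sum>j<n. f i * graph_laplacian n K r x i j * f j)"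

text \<open>The extensional function space \<open>{..<n} \<rightarrow>\<^sub>E UNIV\<close> represents \<open>\<real>\<^sup>n\<close> faithfully, so the minimizer
  is unique for \<open>\<rho> \<ge> 0\<close> (strictly convex objective).\<close>

definition laplacian_smoothing ::
  "nat \<Rightarrow> (real \<Rightarrow> real) \<Rightarrow> real \<Rightarrow> real \<Rightarrow> (nat \<Rightarrow> real^'d) \<Rightarrow> (nat \<Rightarrow> real) \<Rightarrow> nat \<Rightarrow> real" where
  "laplacian_smoothing n K r \<rho> x y =
     arg_min (smoothing_objective n K r \<rho> x y) (\<lambda>f. f \<in> {..<n} \<rightarrow>\<^sub>E UNIV)"

definition in_sample_error ::
  "nat \<Rightarrow> (real^'d \<Rightarrow> real) \<Rightarrow> (nat \<Rightarrow> real^'d) \<Rightarrow> (nat \<Rightarrow> real) \<Rightarrow> real" where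
  "in_sample_error n f0 x fh = (\<Sum>i<n. (fh i - f0 (x i))\<^sup>2) / real n"


section \<open>The regression model\<close>

text \<open>Joint law of \<open>(X, f0 X + \<epsilon>)\<close> with \<open>X \<sim> P\<close> and \<open>\<epsilon> \<sim> N(0,1)\<close> independent, and the law of \<open>n\<close>
  i.i.d. such pairs.\<close>

definition regression_law ::
  "(real^'d) measure \<Rightarrow> (real^'d \<Rightarrow> real) \<Rightarrow> ((real^'d) \<times> real) measure" where
  "regression_law P f0 =
     distr (P \<Otimes>\<^sub>M std_normal_distribution) (P \<Otimes>\<^sub>M borel)
       (\<lambda>(x, e). (x, f0 x + e))"

definition regression_sample ::
  "nat \<Rightarrow> (real^'d) measure \<Rightarrow> (real^'d \<Rightarrow> real) \<Rightarrow> (nat \<Rightarrow> (real^'d) \<times> real) measure" where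
  "regression_sample n P f0 = (\<Pi>\<^sub>M i\<in>{..<n}. regression_law P f0)"

end

theory Submission
  imports Defs
begin

text \<open>
  Write \<open>S = (I + \<rho>L)\<^sup>-\<^sup>1\<close>, so that the estimator is \<open>S Y\<close>. Given the design, the squared bias
  \<open>|S f\<^sub>0 - f\<^sub>0|\<^sup>2\<close> is at most a constant times \<open>\<rho> f\<^sub>0\<^sup>T L f\<^sub>0\<close>, and the expected squared noise
  \<open>|S \<epsilon>|\<^sup>2\<close> is the trace of \<open>S\<^sup>2\<close>. Markov's inequality is applied to the sum of both.

  The expectation of \<open>f\<^sub>0\<^sup>T L f\<^sub>0\<close> is a nonlocal energy, which difference quotients of the weakly
  differentiable function \<open>f\<^sub>0\<close> in charts bound by \<open>n\<^sup>2 r\<^sup>m\<^sup>+\<^sup>2 M\<^sup>2\<close>.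

  The trace is bounded without eigenvalue asymptotics. Divide each chart into cells of side
  comparable to \<open>r\<close>; by an exponential Markov inequality and a union bound all of them contain about
  \<open>n r\<^sup>m\<close> design points, outside an event of probability \<open>C n exp(-c n r\<^sup>m)\<close>. A vector whose averages
  over the blocks of scale \<open>2\<^sup>-\<^sup>l\<close> vanish satisfies, by a discrete Poincare inequality,
  \<open>f\<^sup>T L f \<ge> c n r\<^sup>m\<^sup>+\<^sup>2 4\<^sup>l |f|\<^sup>2\<close>. An orthonormal basis adapted to these nested conditions gives
  \<open>tr S\<^sup>2 \<le> C (1 + \<Sum>\<^sub>l 2\<^sup>m\<^sup>l / (1 + c \<rho> n r\<^sup>m\<^sup>+\<^sup>2 4\<^sup>l)\<^sup>2)\<close> up to the finest scale, and the sum is governed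
  by the scale at which \<open>\<rho> n r\<^sup>m\<^sup>+\<^sup>2 4\<^sup>l\<close> is about 1, because \<open>m < 4\<close>.
\<close>

section \<open>Ridge smoothing with a weighted graph Laplacian\<close>

text \<open>The level conditions are imposed on \<open>smoother v\<close> rather than on v: as S is
  self-adjoint, v is orthogonal to S b exactly when S v is orthogonal to b, so the gap applies to S
  v and L is never diagonalized. Each condition fixes a mean of cell averages, so unequal counts do
  no harm and a block becomes a deterministic grid. With
  \<open>\<theta> = (M\<^sup>2 n) powr (1 / (2 + m))\<close> the prescribed penalty satisfies
  \<open>\<rho> n r\<^sup>m\<^sup>+\<^sup>2 = 1 / \<theta>\<^sup>2\<close>, and the target rate is
  \<open>\<theta>\<^sup>m / n\<close>; the critical scale is \<open>2\<^sup>l\<close> about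
  \<open>\<theta>\<close>. The lower bound on r gives \<open>n r\<^sup>m \<ge> ln n \<ge> 1\<close>,
  so the number of cells is at most a constant times n. The upper bound is
  \<open>n \<theta>\<^sup>4 r\<^sup>4 \<le> \<theta>\<^sup>m\<close> in disguise: the directions
  left over at cell scale, up to n of them, add only order \<open>\<theta>\<^sup>m\<close> to the
  trace. The regression function is only Sobolev, so its differences are controlled in mean over the
  design, through a weak fundamental theorem of calculus. That argument lives in one chart, and
  points at distance at most r share a chart once r is below a Lebesgue number of the cover.\<close>

definition ip :: "nat \<Rightarrow> (nat \<Rightarrow> real) \<Rightarrow> (nat \<Rightarrow> real) \<Rightarrow> real" where
  "ip n f g = (\<Sum>i<n. f i * g i)"

lemma ip_commute: "ip n f g = ip n g f"
  by (simp add: ip_def mult.commute)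

lemma ip_add_left: "ip n (\<lambda>i. f i + g i) h = ip n f h + ip n g h"
  by (simp add: ip_def algebra_simps sum.distrib)

lemma ip_diff_left: "ip n (\<lambda>i. f i - g i) h = ip n f h - ip n g h"
  by (simp add: ip_def algebra_simps sum_subtractf)

lemma ip_scale_left: "ip n (\<lambda>i. c * f i) h = c * ip n f h"
  by (simp add: ip_def algebra_simps sum_distrib_left)

lemma ip_sum_left: "ip n (\<lambda>i. \<Sum>e\<in>E. c e * u e i) h = (\<Sum>e\<in>E. c e * ip n (u e) h)"
  unfolding ip_def by (simp add: sum_distrib_right sum_distrib_left mult.assoc)
    (rule sum.swap)

lemma ip_nonneg: "0 \<le> ip n f f"
  by (auto simp: ip_def intro!: sum_nonneg)

lemma ip_self_eq_0D: "ip n f f = 0 \<Longrightarrow> i < n \<Longrightarrow> f i = 0"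
  by (auto simp: ip_def sum_nonneg_eq_0_iff)

lemma ip_cong: "(\<And>i. i < n \<Longrightarrow> f i = f' i) \<Longrightarrow> (\<And>i. i < n \<Longrightarrow> g i = g' i) \<Longrightarrow> ip n f g = ip n f' g'"
  by (auto simp: ip_def)

lemma ip_zero_left: "(\<And>i. i < n \<Longrightarrow> f i = 0) \<Longrightarrow> ip n f g = 0"
  by (auto simp: ip_def)

lemma ip_Cauchy_Schwarz: "(ip n f g)\<^sup>2 \<le> ip n f f * ip n g g"
  using Cauchy_Schwarz_ineq_sum[of f g "{..<n}"] by (simp add: ip_def power2_eq_square)

lemma ip_self_add_le: "ip n (\<lambda>i. f i + g i) (\<lambda>i. f i + g i) \<le> 2 * ip n f f + 2 * ip n g g"
proof -
  have "(a + b) * (a + b) \<le> 2 * (a * a) + 2 * (b * b)" for a b :: real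
    using zero_le_square[of "a - b"] by (simp add: algebra_simps)
  then show ?thesis
    unfolding ip_def by (simp add: sum_distrib_left flip: sum.distrib) (rule sum_mono)
qed

section \<open>Orthonormal systems in n-space\<close>

definition unit_vec :: "nat \<Rightarrow> nat \<Rightarrow> real" where
  "unit_vec j i = (if i = j then 1 else 0)"

lemma ip_unit_vec: "j < n \<Longrightarrow> ip n (unit_vec j) f = f j"
  by (simp add: ip_def unit_vec_def if_distrib[of "\<lambda>x. x * _"] cong: if_cong)

definition orthonormal :: "nat \<Rightarrow> (nat \<Rightarrow> real) set \<Rightarrow> bool" where
  "orthonormal n E \<longleftrightarrow> finite E \<and> (\<forall>e\<in>E. \<forall>e'\<in>E. ip n e e' = (if e = e' then 1 else 0))"

lemma ip_orthonormal_expansion: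
  assumes "orthonormal n E" "e' \<in> E"
  shows "ip n (\<lambda>i. b i - (\<Sum>e\<in>E. ip n b e * e i)) e' = 0"
proof -
  have "(\<Sum>e\<in>E. ip n b e * ip n e e') = (\<Sum>e\<in>E. if e = e' then ip n b e else 0)"
    using assms by (intro sum.cong) (auto simp: orthonormal_def)
  also have "\<dots> = ip n b e'"
    using assms by (simp add: orthonormal_def)
  finally show ?thesis
    by (simp add: ip_diff_left ip_sum_left)
qed

text \<open>Gram-Schmidt, one vector of \<open>B\<close> at a time: a vector whose residual has norm
  0 adds nothing, any other adds its normalized residual. Spans are never formed; that
  \<open>B\<close> lies in the span of the larger system is expressed dually, by what orthogonality
  to the system implies.\<close>

lemma orthonormal_extension:
  assumes "orthonormal n E" "finite B"
  shows "\<exists>E'. orthonormal n (E \<union> E') \<and> E \<inter> E' = {} \<and> card E' \<le> card B \<and>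
    (\<forall>g. (\<forall>e\<in>E \<union> E'. ip n g e = 0) \<longrightarrow> (\<forall>b\<in>B. ip n g b = 0))"
  using assms(2)
proof (induction B rule: finite_induct)
  case empty
  show ?case using assms(1) by (intro exI[of _ "{}"]) auto
next
  case (insert b B)
  then obtain E' where E': "orthonormal n (E \<union> E')" "E \<inter> E' = {}" "card E' \<le> card B"
    and orth: "\<And>g b. (\<And>e. e \<in> E \<union> E' \<Longrightarrow> ip n g e = 0) \<Longrightarrow> b \<in> B \<Longrightarrow> ip n g b = 0"
    by blast
  let ?E = "E \<union> E'"
  have fin: "finite ?E" using E' by (simp add: orthonormal_def)
  define v where "v = (\<lambda>i. b i - (\<Sum>e\<in>?E. ip n b e * e i))"
  have v_orth: "ip n v e = 0" if "e \<in> ?E" for e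
    unfolding v_def using ip_orthonormal_expansion[OF E'(1) that] .
  have b_eq: "ip n g b = ip n g v" if "\<And>e. e \<in> ?E \<Longrightarrow> ip n g e = 0" for g
  proof -
    have "ip n v g = ip n b g - (\<Sum>e\<in>?E. ip n b e * ip n e g)"
      unfolding v_def by (simp add: ip_diff_left ip_sum_left)
    also have "(\<Sum>e\<in>?E. ip n b e * ip n e g) = 0"
      using that by (intro sum.neutral) (auto simp: ip_commute)
    finally show ?thesis by (simp add: ip_commute)
  qed
  show ?case
  proof (cases "ip n v v = 0")
    case True
    have "ip n g b = 0" if "\<And>e. e \<in> ?E \<Longrightarrow> ip n g e = 0" for g
      using b_eq[OF that] ip_zero_left[of n v g, OF ip_self_eq_0D[OF True]]
      by (simp add: ip_commute[of n g])
    with E' orth insert show ?thesis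
      by (intro exI[of _ E']) (auto simp: card_insert_if)
  next
    case False
    define u where "u = (\<lambda>i. (1 / sqrt (ip n v v)) * v i)"
    have pos: "ip n v v > 0" using False ip_nonneg[of n v] by linarith
    have uu: "ip n u u = 1"
      using pos unfolding u_def by (subst ip_scale_left, subst ip_commute, subst ip_scale_left) simp
    have ue: "ip n u e = 0" if "e \<in> ?E" for e
      unfolding u_def ip_scale_left by (simp add: v_orth[OF that])
    have eu: "ip n e u = 0" if "e \<in> ?E" for e
      using ue[OF that] by (simp add: ip_commute)
    have notin: "u \<notin> ?E" using ue uu by force
    have "orthonormal n (E \<union> insert u E')"
      using E' uu ue eu notin unfolding orthonormal_def by auto
    moreover have "card (insert u E') \<le> card (insert b B)"
      using E'(3) insert fin notin by simp
    moreover have "ip n g b' = 0" if g: "\<And>e. e \<in> E \<union> insert u E' \<Longrightarrow> ip n g e = 0"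
      and b': "b' \<in> insert b B" for g b'
    proof (cases "b' = b")
      case True
      have "ip n u g = 0" using g[of u] ip_commute[of n u g] by auto
      then have "ip n v g = 0"
        unfolding u_def ip_scale_left using pos by simp
      then show ?thesis using True b_eq[of g] g ip_commute[of n g v] by auto
    next
      case False
      then show ?thesis using orth g b' by auto
    qed
    ultimately show ?thesis using E'(2) notin
      by (intro exI[of _ "insert u E'"]) auto
  qed
qed

text \<open>Completeness is applied to a single vector, the residual of the expansion of
  \<open>x\<close>, which is orthogonal to \<open>E\<close> and therefore vanishes below
  \<open>n\<close>.\<close>

lemma Parseval_ip:
  assumes "orthonormal n E"
    and complete: "\<And>g. \<forall>e\<in>E. ip n g e = 0 \<Longrightarrow> \<forall>i<n. g i = 0"
  shows "ip n x x = (\<Sum>e\<in>E. (ip n x e)\<^sup>2)"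
proof -
  have "x i = (\<Sum>e\<in>E. ip n x e * e i)" if "i < n" for i
    using complete[of "\<lambda>i. x i - (\<Sum>e\<in>E. ip n x e * e i)"] that
      ip_orthonormal_expansion[OF assms(1)] by auto
  then have "ip n x x = ip n (\<lambda>i. \<Sum>e\<in>E. ip n x e * e i) x"
    by (intro ip_cong) auto
  also have "\<dots> = (\<Sum>e\<in>E. (ip n x e)\<^sup>2)"
    by (simp add: ip_sum_left ip_commute[of n _ x] power2_eq_square)
  finally show ?thesis .
qed

section \<open>The smoothing operator, its bias and its trace\<close>

definition dirichlet_energy :: "nat \<Rightarrow> (nat \<Rightarrow> nat \<Rightarrow> real) \<Rightarrow> (nat \<Rightarrow> real) \<Rightarrow> real" where
  "dirichlet_energy n w f = (\<Sum>i<n. \<Sum>j<n. w i j * (f i - f j)\<^sup>2)"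

locale smoothing_operator =
  fixes n :: nat and w :: "nat \<Rightarrow> nat \<Rightarrow> real" and \<rho> :: real
  assumes w_nonneg: "0 \<le> w i j" and w_sym: "w i j = w j i" and rho_nonneg: "0 \<le> \<rho>"
begin

definition lap :: "(nat \<Rightarrow> real) \<Rightarrow> nat \<Rightarrow> real" where
  "lap f i = (\<Sum>j<n. w i j * (f i - f j))"

definition penalized :: "(nat \<Rightarrow> real) \<Rightarrow> nat \<Rightarrow> real" where
  "penalized f i = f i + \<rho> * lap f i"

definition deg :: "nat \<Rightarrow> real" where
  "deg i = (\<Sum>j<n. w i j)"

text \<open>Jacobi iteration, which converges because \<open>I + \<rho>L\<close> is strictly diagonally dominant.\<close>

primrec jacobi :: "(nat \<Rightarrow> real) \<Rightarrow> nat \<Rightarrow> nat \<Rightarrow> real" where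
  "jacobi y 0 i = 0"
| "jacobi y (Suc t) i = (y i + \<rho> * (\<Sum>j<n. w i j * jacobi y t j)) / (1 + \<rho> * deg i)"

text \<open>A limit of explicit iterates instead of a matrix inverse: measurability in the weights
  and the data then passes from the iterates to the limit.\<close>

definition smoother :: "(nat \<Rightarrow> real) \<Rightarrow> nat \<Rightarrow> real" where
  "smoother y i = lim (\<lambda>t. jacobi y t i)"

lemma lap_eq: "lap f i = deg i * f i - (\<Sum>j<n. w i j * f j)"
  by (simp add: lap_def deg_def algebra_simps sum_subtractf sum_distrib_left)

lemma deg_nonneg: "0 \<le> deg i"
  by (simp add: deg_def sum_nonneg w_nonneg)

lemma deg_pos: "0 < 1 + \<rho> * deg i"
  using mult_nonneg_nonneg[OF rho_nonneg deg_nonneg[of i]] by linarith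

text \<open>In the maximum norm over the vertices the increments shrink by \<open>q\<close>, the
  largest of the ratios \<open>\<rho> * deg i / (1 + \<rho> * deg i)\<close>, so their series is
  dominated by a geometric one.\<close>

lemma jacobi_tendsto: assumes "i < n" shows "(\<lambda>t. jacobi y t i) \<longlonglongrightarrow> smoother y i"
proof -
  define q where "q = Max ((\<lambda>i. \<rho> * deg i / (1 + \<rho> * deg i)) ` {..<n})"
  have q_ge: "\<rho> * deg i / (1 + \<rho> * deg i) \<le> q" if "i < n" for i
    unfolding q_def using that by (intro Max_ge) auto
  have q1: "q < 1"
    unfolding q_def using assms deg_pos by (subst Max_less_iff) auto
  have q0: "0 \<le> q"
    using q_ge[OF assms] deg_pos[of i] rho_nonneg deg_nonneg[of i]
    by (meson divide_nonneg_nonneg less_imp_le mult_nonneg_nonneg order_trans)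
  obtain B where B: "\<And>i. i < n \<Longrightarrow> \<bar>jacobi y 1 i\<bar> \<le> B"
  proof
    show "\<bar>jacobi y 1 i\<bar> \<le> Max ((\<lambda>i. \<bar>jacobi y 1 i\<bar>) ` {..<n})" if "i < n" for i
      using that by (intro Max_ge) auto
  qed
  have step: "\<bar>jacobi y (Suc t) i - jacobi y t i\<bar> \<le> q ^ t * B" if "i < n" for t i
    using that
  proof (induction t arbitrary: i)
    case 0 then show ?case using B by simp
  next
    case (Suc t)
    have nn: "0 \<le> q ^ t * B"
      using Suc.IH[OF Suc.prems] by linarith
    have "jacobi y (Suc (Suc t)) i - jacobi y (Suc t) i =
        \<rho> * (\<Sum>j<n. w i j * (jacobi y (Suc t) j - jacobi y t j)) / (1 + \<rho> * deg i)"
      unfolding jacobi.simps(2)[of y "Suc t" i] jacobi.simps(2)[of y t i]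
      by (simp add: diff_divide_distrib[symmetric] right_diff_distrib sum_subtractf del: jacobi.simps)
    moreover have "\<bar>\<Sum>j<n. w i j * (jacobi y (Suc t) j - jacobi y t j)\<bar> \<le> (\<Sum>j<n. w i j * (q ^ t * B))"
      by (rule order_trans[OF sum_abs])
        (auto intro!: sum_mono mult_left_mono Suc.IH w_nonneg simp: abs_mult abs_of_nonneg[OF w_nonneg] simp del: jacobi.simps)
    moreover have "(\<Sum>j<n. w i j * (q ^ t * B)) = deg i * (q ^ t * B)"
      by (simp add: deg_def sum_distrib_right)
    ultimately have "\<bar>jacobi y (Suc (Suc t)) i - jacobi y (Suc t) i\<bar> \<le> \<rho> * (deg i * (q ^ t * B)) / (1 + \<rho> * deg i)"
      using deg_pos[of i] rho_nonneg
      by (auto simp: abs_mult intro!: divide_right_mono mult_left_mono simp del: jacobi.simps)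
    also have "\<dots> = (\<rho> * deg i / (1 + \<rho> * deg i)) * (q ^ t * B)" by simp
    also have "\<dots> \<le> q * (q ^ t * B)"
      by (rule mult_right_mono[OF q_ge[OF Suc.prems] nn])
    finally show ?case by (simp add: mult.assoc)
  qed
  have "summable (\<lambda>t. jacobi y (Suc t) i - jacobi y t i)"
  proof (rule summable_comparison_test')
    show "summable (\<lambda>t. q ^ t * B)" using q0 q1 by (intro summable_mult2 summable_geometric) auto
  qed (use step[OF assms] in auto)
  then have "convergent (\<lambda>t. \<Sum>s<t. jacobi y (Suc s) i - jacobi y s i)"
    by (simp add: summable_iff_convergent)
  then have "convergent (\<lambda>t. jacobi y t i)"
    using sum_lessThan_telescope[of "\<lambda>s. jacobi y s i"] by simp
  then show ?thesis unfolding smoother_def by (simp add: convergent_LIMSEQ_iff)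
qed

lemma penalized_smoother: assumes "i < n" shows "penalized (smoother y) i = y i"
proof -
  have "(\<lambda>t. jacobi y (Suc t) i) \<longlonglongrightarrow> smoother y i"
    using jacobi_tendsto[OF assms] by (rule LIMSEQ_Suc)
  moreover have "(\<lambda>t. jacobi y (Suc t) i) \<longlonglongrightarrow> (y i + \<rho> * (\<Sum>j<n. w i j * smoother y j)) / (1 + \<rho> * deg i)"
    unfolding jacobi.simps using deg_pos[of i]
    by (intro tendsto_intros jacobi_tendsto) auto
  ultimately have "smoother y i = (y i + \<rho> * (\<Sum>j<n. w i j * smoother y j)) / (1 + \<rho> * deg i)"
    by (rule LIMSEQ_unique)
  then show ?thesis
    using deg_pos[of i] by (simp add: penalized_def lap_eq field_simps)
qed

text \<open>By symmetry of \<open>w\<close>, exchanging the two indices turns the factor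
  \<open>g i\<close> into \<open>- g j\<close>; the average of both forms is the right-hand
  side.\<close>

lemma ip_lap: "ip n (lap f) g = (\<Sum>i<n. \<Sum>j<n. w i j * (f i - f j) * (g i - g j)) / 2"
proof -
  define T where "T = (\<Sum>i<n. \<Sum>j<n. w i j * (f i - f j) * g i)"
  have "T = (\<Sum>i<n. \<Sum>j<n. w j i * (f j - f i) * g j)"
    unfolding T_def by (rule sum.swap)
  also have "\<dots> = (\<Sum>i<n. \<Sum>j<n. - (w i j * (f i - f j) * g j))"
    by (intro sum.cong refl, subst w_sym) (simp add: algebra_simps)
  finally have "2 * T = (\<Sum>i<n. \<Sum>j<n. w i j * (f i - f j) * g i) + (\<Sum>i<n. \<Sum>j<n. - (w i j * (f i - f j) * g j))"
    by (simp add: T_def)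
  also have "\<dots> = (\<Sum>i<n. \<Sum>j<n. w i j * (f i - f j) * (g i - g j))"
    by (simp add: sum.distrib[symmetric] algebra_simps)
  finally have "T = (\<Sum>i<n. \<Sum>j<n. w i j * (f i - f j) * (g i - g j)) / 2"
    by simp
  then show ?thesis
    by (simp add: ip_def lap_def T_def sum_distrib_right)
qed

text \<open>The energy runs over ordered pairs and so is twice the quadratic form of L. This is the
  origin of the halves in the gap and bias bounds.\<close>

lemma ip_lap_self: "ip n (lap f) f = dirichlet_energy n w f / 2"
  by (simp add: ip_lap dirichlet_energy_def power2_eq_square mult.assoc)

lemma ip_lap_commute: "ip n (lap f) g = ip n f (lap g)"
  unfolding ip_commute[of n f] ip_lap by (simp add: mult_ac)

lemma energy_nonneg: "0 \<le> dirichlet_energy n w f"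
  by (auto simp: dirichlet_energy_def intro!: sum_nonneg mult_nonneg_nonneg w_nonneg)

lemma ip_penalized: "ip n (penalized f) g = ip n f g + \<rho> * ip n (lap f) g"
  by (simp add: penalized_def[abs_def] ip_add_left ip_scale_left)

lemma ip_penalized_commute: "ip n (penalized f) g = ip n f (penalized g)"
  unfolding ip_commute[of n f] ip_penalized
  by (simp add: ip_lap_commute[of f]) (simp add: ip_commute)

lemma ip_penalized_self: "ip n (penalized f) f = ip n f f + \<rho> * dirichlet_energy n w f / 2"
  by (simp add: ip_penalized ip_lap_self)

lemma penalized_diff: "penalized (\<lambda>i. f i - g i) i = penalized f i - penalized g i"
  by (simp add: penalized_def lap_eq sum_subtractf algebra_simps)

lemma penalized_inj: assumes "\<And>i. i < n \<Longrightarrow> penalized f i = penalized g i" "i < n" shows "f i = g i"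
proof -
  let ?d = "\<lambda>i. f i - g i"
  have "ip n (penalized ?d) ?d = 0"
    by (rule ip_zero_left) (simp add: penalized_diff assms)
  then have "ip n ?d ?d = 0"
    using ip_penalized_self[of ?d] ip_nonneg[of n ?d] mult_nonneg_nonneg[OF rho_nonneg energy_nonneg[of ?d]]
    by simp
  from ip_self_eq_0D[OF this assms(2)] show ?thesis by simp
qed

lemma ip_smoother_commute: "ip n (smoother f) g = ip n f (smoother g)"
proof -
  have "ip n (smoother f) g = ip n (smoother f) (penalized (smoother g))" by (rule ip_cong) (auto simp: penalized_smoother)
  also have "\<dots> = ip n (penalized (smoother f)) (smoother g)" by (simp add: ip_penalized_commute)
  also have "\<dots> = ip n f (smoother g)" by (rule ip_cong) (auto simp: penalized_smoother)
  finally show ?thesis .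
qed

lemma smoother_eqI: assumes "\<And>i. i < n \<Longrightarrow> penalized f i = y i" "i < n" shows "smoother y i = f i"
  using penalized_inj[of "smoother y" f i] penalized_smoother assms by auto

lemma smoother_add: assumes "i < n" shows "smoother (\<lambda>i. f i + g i) i = smoother f i + smoother g i"
proof -
  have "penalized (\<lambda>i. smoother f i + smoother g i) i = penalized (smoother f) i + penalized (smoother g) i" for i
    by (simp add: penalized_def lap_eq sum.distrib algebra_simps)
  then show ?thesis by (intro smoother_eqI[of "\<lambda>i. smoother f i + smoother g i"]) (auto simp: penalized_smoother assms)
qed

text \<open>Self-adjointness identifies rows of S with columns. What results is an explicit linear
  form in the data, whose second moment under Gaussian noise can be computed coordinatewise.\<close>

lemma smoother_expand: assumes "i < n" shows "smoother y i = (\<Sum>j<n. smoother (unit_vec j) i * y j)"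
proof -
  have "smoother y i = ip n (unit_vec i) (smoother y)" using assms by (simp add: ip_unit_vec)
  also have "\<dots> = ip n (smoother (unit_vec i)) y" by (simp add: ip_smoother_commute)
  also have "\<dots> = (\<Sum>j<n. smoother (unit_vec j) i * y j)"
    unfolding ip_def
  proof (intro sum.cong refl)
    fix j assume "j \<in> {..<n}"
    then have "smoother (unit_vec i) j = ip n (unit_vec j) (smoother (unit_vec i))" by (simp add: ip_unit_vec)
    also have "\<dots> = ip n (unit_vec i) (smoother (unit_vec j))" by (metis ip_smoother_commute ip_commute)
    finally show "smoother (unit_vec i) j * y j = smoother (unit_vec j) i * y j" using assms by (simp add: ip_unit_vec)
  qed
  finally show ?thesis .
qed

text \<open>A spectral gap \<open>g\<close> of \<open>L\<close> at \<open>smoother v\<close> already gives the squared factor: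
  \<open>(1 + \<rho>g) |f|\<^sup>2 \<le> ((I + \<rho>L) f, f) \<le> |(I + \<rho>L) f| |f|\<close> for \<open>f = smoother v\<close>.\<close>

lemma smoother_contraction:
  assumes "0 \<le> g" "g * ip n (smoother v) (smoother v) \<le> dirichlet_energy n w (smoother v) / 2"
  shows "ip n (smoother v) (smoother v) \<le> ip n v v / (1 + \<rho> * g)\<^sup>2"
proof -
  let ?f = "smoother v"
  have pos: "1 + \<rho> * g > 0" using mult_nonneg_nonneg[OF rho_nonneg assms(1)] by linarith
  have vf: "ip n v ?f = ip n (penalized ?f) ?f" by (rule ip_cong) (auto simp: penalized_smoother)
  have "(1 + \<rho> * g) * ip n ?f ?f \<le> ip n v ?f"
    unfolding vf ip_penalized_self using mult_left_mono[OF assms(2) rho_nonneg] by (simp add: algebra_simps)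
  then have "((1 + \<rho> * g) * ip n ?f ?f)\<^sup>2 \<le> (ip n v ?f)\<^sup>2"
    using pos by (intro power_mono) (auto intro!: mult_nonneg_nonneg ip_nonneg)
  also have "\<dots> \<le> ip n v v * ip n ?f ?f" by (rule ip_Cauchy_Schwarz)
  finally have *: "(1 + \<rho> * g)\<^sup>2 * ip n ?f ?f * ip n ?f ?f \<le> ip n v v * ip n ?f ?f"
    by (simp add: power2_eq_square algebra_simps)
  have "(1 + \<rho> * g)\<^sup>2 * ip n ?f ?f \<le> ip n v v"
  proof (cases "ip n ?f ?f = 0")
    case False
    then show ?thesis using * ip_nonneg[of n ?f] by (simp add: mult_le_cancel_right)
  qed (simp add: ip_nonneg)
  then show ?thesis using pos by (simp add: field_simps)
qed

text \<open>The error \<open>?u\<close> solves (I + \<rho>L) u = - \<rho> L f. Pairing this equation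
  with \<open>?u\<close> and splitting the mixed term leaves only the energy of
  \<open>f\<close>.\<close>

lemma smoother_bias: "ip n (\<lambda>i. smoother f i - f i) (\<lambda>i. smoother f i - f i) \<le> \<rho> * dirichlet_energy n w f / 2"
proof -
  let ?u = "\<lambda>i. smoother f i - f i"
  have "penalized ?u i = - \<rho> * lap f i" if "i < n" for i
    using penalized_smoother[OF that, of f] by (simp add: penalized_diff) (simp add: penalized_def)
  then have "ip n (penalized ?u) ?u = - \<rho> * ip n (lap f) ?u"
    by (subst ip_scale_left[symmetric]) (auto intro: ip_cong)
  then have 1: "ip n ?u ?u + \<rho> * dirichlet_energy n w ?u / 2 = - \<rho> * ip n (lap f) ?u"
    by (simp add: ip_penalized_self)
  have "- ip n (lap f) ?u \<le> dirichlet_energy n w f / 2 + dirichlet_energy n w ?u / 2"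
  proof -
    \<comment> \<open>Used with \<open>a = w i j\<close>. After the factor 1/2 of
      \<open>ip_lap\<close> the energy of \<open>?u\<close> appears with exactly the coefficient it
      has in fact \<open>1\<close>, and cancels.\<close>
    have t: "- (a * x * y) \<le> a * x\<^sup>2 + a * y\<^sup>2" if "0 \<le> a" for a x y :: real
    proof -
      have "0 \<le> x\<^sup>2 + y\<^sup>2 + x * y"
      proof -
        have "x\<^sup>2 + y\<^sup>2 + x * y = (x + y / 2)\<^sup>2 + 3 / 4 * y\<^sup>2"
          by (simp add: power2_eq_square algebra_simps)
        then show ?thesis by simp
      qed
      from mult_nonneg_nonneg[OF that this] show ?thesis by (simp add: algebra_simps)
    qed
    show ?thesis
      unfolding ip_lap dirichlet_energy_def
      by (simp add: sum_negf[symmetric] sum.distrib[symmetric] add_divide_distrib[symmetric] divide_right_mono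
          sum_mono t w_nonneg flip: minus_divide_left)
  qed
  from mult_left_mono[OF this rho_nonneg] 1 show ?thesis by (simp add: algebra_simps)
qed

text \<open>An orthonormal basis is built in layers. The first \<open>k 0\<close> vectors contribute
  at most 1 each. A vector added for level l + 1 is already orthogonal to the smoothed conditions of
  level l, so the gap \<open>g l\<close> shrinks its image under S. What remains after level J, at
  most \<open>n\<close> vectors, is shrunk by \<open>g J\<close>.\<close>

lemma trace_smoother_le:
  assumes fin: "\<And>l. l \<le> J \<Longrightarrow> finite (B l)" and card: "\<And>l. l \<le> J \<Longrightarrow> card (B l) \<le> k l"
    and gap_nonneg: "\<And>l. l \<le> J \<Longrightarrow> 0 \<le> g l"
    and gap: "\<And>l f. l \<le> J \<Longrightarrow> (\<And>b. b \<in> B l \<Longrightarrow> ip n f b = 0) \<Longrightarrow> g l * ip n f f \<le> dirichlet_energy n w f / 2"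
  shows "(\<Sum>j<n. ip n (smoother (unit_vec j)) (smoother (unit_vec j))) \<le>
    real (k 0) + (\<Sum>l<J. real (k (Suc l)) / (1 + \<rho> * g l)\<^sup>2) + real n / (1 + \<rho> * g J)\<^sup>2"
proof -
  let ?N = "\<lambda>E. \<Sum>e\<in>E. ip n (smoother e) (smoother e)"
  \<comment> \<open>Capturing \<open>B\<close> costs at most \<open>c\<close> further vectors, each
    of norm 1 and orthogonal to \<open>E\<close>, hence each worth at most \<open>b\<close>.\<close>
  have new: "\<exists>E'. orthonormal n (E \<union> E') \<and> ?N (E \<union> E') \<le> ?N E + real c * b \<and>
      (\<forall>v. (\<forall>e\<in>E \<union> E'. ip n v e = 0) \<longrightarrow> (\<forall>b\<in>B. ip n v b = 0))"
    if E: "orthonormal n E" and B: "finite B" "card B \<le> c" and b: "0 \<le> b"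
      and le: "\<And>v. (\<And>e. e \<in> E \<Longrightarrow> ip n v e = 0) \<Longrightarrow> ip n v v = 1 \<Longrightarrow> ip n (smoother v) (smoother v) \<le> b"
    for E B c b
  proof -
    from orthonormal_extension[OF E B(1)] obtain E' where E': "orthonormal n (E \<union> E')" "E \<inter> E' = {}"
      "card E' \<le> card B" and o: "\<And>v. \<forall>e\<in>E \<union> E'. ip n v e = 0 \<Longrightarrow> \<forall>b\<in>B. ip n v b = 0"
      by blast
    have f: "finite E" "finite E'" using E'(1) by (auto simp: orthonormal_def)
    have "?N (E \<union> E') = ?N E + ?N E'" using f E'(2) by (simp add: sum.union_disjoint)
    also have "?N E' \<le> (\<Sum>e\<in>E'. b)"
    proof (intro sum_mono le)
      fix e' e assume "e' \<in> E'" "e \<in> E"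
      then show "ip n e' e = 0" using E'(1,2) unfolding orthonormal_def
        by (metis IntI UnI1 UnI2 empty_iff)
    qed (use E'(1) in \<open>auto simp: orthonormal_def\<close>)
    also have "\<dots> \<le> real c * b" using E'(3) B(2) b by (auto intro!: mult_right_mono)
    finally show ?thesis using E'(1) o by (intro exI[of _ E']) auto
  qed
  have smoother_le: "ip n (smoother v) (smoother v) \<le> 1 / (1 + \<rho> * g l)\<^sup>2"
    if l: "l \<le> J" and v: "\<And>b. b \<in> B l \<Longrightarrow> ip n v (smoother b) = 0" "ip n v v = 1" for v l
  proof -
    \<comment> \<open>Self-adjointness moves S from the condition to the vector:
      \<open>smoother v\<close> is orthogonal to \<open>B l\<close>, as \<open>gap\<close>
      demands.\<close>
    have "g l * ip n (smoother v) (smoother v) \<le> dirichlet_energy n w (smoother v) / 2"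
      using v by (intro gap[OF l]) (simp add: ip_smoother_commute)
    from smoother_contraction[OF gap_nonneg[OF l] this] show ?thesis using v by simp
  qed
  have "\<exists>E. orthonormal n E \<and> ?N E \<le> real (k 0) + (\<Sum>l'<l. real (k (Suc l')) / (1 + \<rho> * g l')\<^sup>2) \<and>
      (\<forall>v. (\<forall>e\<in>E. ip n v e = 0) \<longrightarrow> (\<forall>b\<in>B l. ip n v (smoother b) = 0))" if "l \<le> J" for l
    using that
  proof (induction l)
    case 0
    have "orthonormal n {}" by (simp add: orthonormal_def)
    moreover have "ip n (smoother v) (smoother v) \<le> 1" if "ip n v v = 1" for v
      using smoother_contraction[of 0 v] that energy_nonneg by simp
    ultimately obtain E' where "orthonormal n ({} \<union> E')" "?N ({} \<union> E') \<le> ?N {} + real (k 0) * 1"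
      "\<forall>v. (\<forall>e\<in>{} \<union> E'. ip n v e = 0) \<longrightarrow> (\<forall>b\<in>smoother ` B 0. ip n v b = 0)"
      using new[of "{}" "smoother ` B 0" "k 0" 1] fin[of 0] card[of 0] card_image_le[of "B 0" smoother] by auto
    then show ?case by (intro exI[of _ E']) auto
  next
    case (Suc l)
    then obtain E where E: "orthonormal n E"
      "?N E \<le> real (k 0) + (\<Sum>l'<l. real (k (Suc l')) / (1 + \<rho> * g l')\<^sup>2)"
      "\<And>v. (\<forall>e\<in>E. ip n v e = 0) \<Longrightarrow> (\<forall>b\<in>B l. ip n v (smoother b) = 0)" by auto
    \<comment> \<open>The new vectors serve level l + 1, but the conditions they are already known
      to meet are those of level l; hence the shift between \<open>k\<close> and
      \<open>g\<close>.\<close>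
    have "\<exists>E'. orthonormal n (E \<union> E') \<and> ?N (E \<union> E') \<le> ?N E + real (k (Suc l)) * (1 / (1 + \<rho> * g l)\<^sup>2) \<and>
      (\<forall>v. (\<forall>e\<in>E \<union> E'. ip n v e = 0) \<longrightarrow> (\<forall>b\<in>smoother ` B (Suc l). ip n v b = 0))"
      using Suc.prems E fin[of "Suc l"] card[of "Suc l"] card_image_le[of "B (Suc l)" smoother]
      by (intro new smoother_le) auto
    then obtain E' where "orthonormal n (E \<union> E')"
      "?N (E \<union> E') \<le> ?N E + real (k (Suc l)) * (1 / (1 + \<rho> * g l)\<^sup>2)"
      "\<forall>v. (\<forall>e\<in>E \<union> E'. ip n v e = 0) \<longrightarrow> (\<forall>b\<in>smoother ` B (Suc l). ip n v b = 0)"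
      by blast
    then show ?case using E(2) by (intro exI[of _ "E \<union> E'"]) auto
  qed
  from this[of J] obtain E where E: "orthonormal n E"
      "?N E \<le> real (k 0) + (\<Sum>l'<J. real (k (Suc l')) / (1 + \<rho> * g l')\<^sup>2)"
      "\<And>v. (\<forall>e\<in>E. ip n v e = 0) \<Longrightarrow> (\<forall>b\<in>B J. ip n v (smoother b) = 0)" by auto
  \<comment> \<open>The coordinate vectors complete the system to a basis. Everything added here
    meets the conditions of level J.\<close>
  have "\<exists>E'. orthonormal n (E \<union> E') \<and> ?N (E \<union> E') \<le> ?N E + real n * (1 / (1 + \<rho> * g J)\<^sup>2) \<and>
      (\<forall>v. (\<forall>e\<in>E \<union> E'. ip n v e = 0) \<longrightarrow> (\<forall>b\<in>unit_vec ` {..<n}. ip n v b = 0))"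
    using E card_image_le[of "{..<n}" unit_vec] by (intro new smoother_le) auto
  then obtain E' where E': "orthonormal n (E \<union> E')"
      "?N (E \<union> E') \<le> ?N E + real n * (1 / (1 + \<rho> * g J)\<^sup>2)"
      "\<And>v. (\<forall>e\<in>E \<union> E'. ip n v e = 0) \<Longrightarrow> (\<forall>b\<in>unit_vec ` {..<n}. ip n v b = 0)"
    by blast
  have complete: "\<forall>i<n. v i = 0" if v: "\<forall>e\<in>E \<union> E'. ip n v e = 0" for v
    using E'(3)[OF v] by (auto simp: ip_commute[of n v] ip_unit_vec)
  \<comment> \<open>The trace of the square of S may be computed in any orthonormal basis: Parseval
    for each column, exchange of the sums, self-adjointness.\<close>
  have "(\<Sum>j<n. ip n (smoother (unit_vec j)) (smoother (unit_vec j))) = (\<Sum>j<n. \<Sum>e\<in>E \<union> E'. (ip n (smoother (unit_vec j)) e)\<^sup>2)"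
    using Parseval_ip[OF E'(1) complete] by simp
  also have "\<dots> = (\<Sum>e\<in>E \<union> E'. \<Sum>j<n. (smoother e j)\<^sup>2)"
    by (subst sum.swap) (simp add: ip_smoother_commute ip_unit_vec)
  also have "\<dots> = ?N (E \<union> E')"
    by (simp add: ip_def power2_eq_square)
  finally show ?thesis using E' E(2) by simp
qed


end

section \<open>The estimator as a smoother, and its measurability\<close>

lemma smoother_cong:
  assumes w: "smoothing_operator w \<rho>" and w': "smoothing_operator w' \<rho>"
    and eq: "\<And>i j. i < n \<Longrightarrow> j < n \<Longrightarrow> w i j = w' i j" "\<And>i. i < n \<Longrightarrow> y i = y' i" and i: "i < n"
  shows "smoothing_operator.smoother n w \<rho> y i = smoothing_operator.smoother n w' \<rho> y' i"
proof (rule smoothing_operator.smoother_eqI[OF w _ i])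
  fix j assume j: "j < n"
  have "smoothing_operator.penalized n w \<rho> (smoothing_operator.smoother n w' \<rho> y') j = smoothing_operator.penalized n w' \<rho> (smoothing_operator.smoother n w' \<rho> y') j"
    using j eq(1) by (simp add: smoothing_operator.penalized_def[OF w] smoothing_operator.penalized_def[OF w']
        smoothing_operator.lap_def[OF w] smoothing_operator.lap_def[OF w'])
  then show "smoothing_operator.penalized n w \<rho> (smoothing_operator.smoother n w' \<rho> y') j = y j"
    using smoothing_operator.penalized_smoother[OF w' j] eq(2)[OF j] by simp
qed

lemma smoother_measurable:
  assumes op: "\<And>z. smoothing_operator (w z) \<rho>"
    and w: "\<And>i j. i < n \<Longrightarrow> j < n \<Longrightarrow> (\<lambda>z. w z i j) \<in> borel_measurable M"
    and y: "\<And>i. i < n \<Longrightarrow> (\<lambda>z. y z i) \<in> borel_measurable M"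
    and i: "i < n"
  shows "(\<lambda>z. smoothing_operator.smoother n (w z) \<rho> (y z) i) \<in> borel_measurable M"
proof -
  have jacobi: "(\<lambda>z. smoothing_operator.jacobi n (w z) \<rho> (y z) t i) \<in> borel_measurable M" if "i < n" for t i
    using that
  proof (induction t arbitrary: i)
    case (Suc t)
    have "(\<lambda>z. (y z i + \<rho> * (\<Sum>j<n. w z i j * smoothing_operator.jacobi n (w z) \<rho> (y z) t j)) / (1 + \<rho> * (\<Sum>j<n. w z i j))) \<in> borel_measurable M"
      by (intro borel_measurable_divide borel_measurable_add borel_measurable_times borel_measurable_sum borel_measurable_const)
        (use w y Suc in auto)
    then show ?case
      unfolding smoothing_operator.jacobi.simps[OF op] smoothing_operator.deg_def[OF op] .
  qed (simp add: smoothing_operator.jacobi.simps[OF op])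
  show ?thesis
    unfolding smoothing_operator.smoother_def[OF op] by (intro borel_measurable_lim_metric jacobi i)
qed

lemma smoothing_operator_graph_weight:
  assumes "\<And>t. 0 \<le> t \<Longrightarrow> 0 \<le> K t" "0 \<le> r" "0 \<le> \<rho>"
  shows "smoothing_operator (graph_weight K r x) \<rho>"
  by unfold_locales (use assms in \<open>auto simp: graph_weight_def norm_minus_commute\<close>)

text \<open>Expanding the objective around the solution g of the stationarity equation, the linear
  terms cancel and at least |f - g|^2 remains. Hence g is the only minimizer and
  \<open>arg_min\<close> has to return it.\<close>

lemma laplacian_smoothing_eq_smoother:
  assumes "smoothing_operator (graph_weight K r x) \<rho>" "i < n"
  shows "laplacian_smoothing n K r \<rho> x y i = smoothing_operator.smoother n (graph_weight K r x) \<rho> y i"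
proof -
  let ?w = "graph_weight K r x"
  interpret smoothing_operator n ?w \<rho> by fact
  let ?obj = "smoothing_objective n K r \<rho> x y"
  have L: "(\<Sum>j<n. graph_laplacian n K r x i j * f j) = lap f i" if "i < n" for f i
  proof -
    have "(\<Sum>j<n. graph_laplacian n K r x i j * f j) =
        (\<Sum>j<n. (if i = j then deg i * f j else 0) - ?w i j * f j)"
      by (intro sum.cong) (auto simp: graph_laplacian_def graph_degree_def deg_def algebra_simps)
    also have "\<dots> = lap f i" using that by (simp add: sum_subtractf lap_eq)
    finally show ?thesis .
  qed
  have obj: "?obj f = ip n (\<lambda>i. y i - f i) (\<lambda>i. y i - f i) + \<rho> * ip n (lap f) f" for f
  proof -
    have "(\<Sum>i<n. \<Sum>j<n. f i * graph_laplacian n K r x i j * f j) = (\<Sum>i<n. f i * lap f i)"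
      by (intro sum.cong refl) (simp add: L[symmetric] sum_distrib_left mult.assoc)
    then show ?thesis
      by (simp add: smoothing_objective_def ip_def power2_eq_square mult.commute)
  qed
  \<comment> \<open>Restriction places the solution in the extensional space over which the minimum
    is taken.\<close>
  define g where "g = restrict (smoother y) {..<n}"
  have gS: "g i = smoother y i" if "i < n" for i using that by (simp add: g_def)
  have Ag: "y i - g i = \<rho> * lap g i" if "i < n" for i
  proof -
    have "lap g i = lap (smoother y) i" using that by (simp add: lap_def gS)
    then show ?thesis using penalized_smoother[OF that, of y] that by (simp add: penalized_def gS)
  qed
  have obj_ge: "?obj f \<ge> ?obj g + ip n (\<lambda>i. f i - g i) (\<lambda>i. f i - g i)" for f
  proof -
    let ?h = "\<lambda>i. f i - g i"
    let ?u = "\<lambda>i. y i - g i"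
    have "ip n (\<lambda>i. y i - f i) (\<lambda>i. y i - f i) = ip n ?u ?u - 2 * ip n ?u ?h + ip n ?h ?h"
      unfolding ip_def sum_subtractf[symmetric] sum.distrib[symmetric] sum_distrib_left
      by (intro sum.cong refl) (simp add: algebra_simps)
    moreover have "ip n (lap f) f = ip n (lap g) g + 2 * ip n (lap g) ?h + ip n (lap ?h) ?h"
      unfolding ip_lap add_divide_distrib[symmetric] times_divide_eq_right sum_distrib_left sum.distrib[symmetric]
      by (intro arg_cong2[where f="(/)"] sum.cong refl) (simp add: algebra_simps)
    moreover have "ip n ?u ?h = \<rho> * ip n (lap g) ?h"
      unfolding ip_scale_left[symmetric] by (rule ip_cong) (auto simp: Ag)
    moreover have "\<rho> * ip n (lap ?h) ?h \<ge> 0"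
      unfolding ip_lap_self using rho_nonneg energy_nonneg by simp
    ultimately show ?thesis unfolding obj by (simp add: algebra_simps)
  qed
  have "laplacian_smoothing n K r \<rho> x y = g"
    unfolding laplacian_smoothing_def
  proof (rule arg_minI[where x = g])
    show "g \<in> {..<n} \<rightarrow>\<^sub>E UNIV" by (simp add: g_def)
    show "\<not> ?obj f < ?obj g" for f using obj_ge[of f] ip_nonneg[of n "\<lambda>i. f i - g i"] by linarith
    fix f assume f: "f \<in> {..<n} \<rightarrow>\<^sub>E UNIV" and "\<forall>h. h \<in> {..<n} \<rightarrow>\<^sub>E UNIV \<longrightarrow> \<not> ?obj h < ?obj f"
    then have "\<not> ?obj g < ?obj f" by (simp add: g_def)
    then have "ip n (\<lambda>i. f i - g i) (\<lambda>i. f i - g i) = 0"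
      using obj_ge[of f] ip_nonneg[of n "\<lambda>i. f i - g i"] by linarith
    from ip_self_eq_0D[OF this] show "f = g"
      using f by (intro ext) (auto simp: g_def PiE_def extensional_def restrict_def)
  qed
  then show ?thesis using gS assms by simp
qed

section \<open>Poincare inequalities on grids and graphs\<close>

text \<open>An arbitrary index set of directions, so that inequalities can be proved by induction on
  the dimension; the case \<open>UNIV\<close> is used for cells.\<close>

definition grid :: "nat \<Rightarrow> 'm set \<Rightarrow> ('m \<Rightarrow> nat) set" where
  "grid b I = PiE I (\<lambda>_. {..<b})"

definition grid_energy :: "nat \<Rightarrow> 'm set \<Rightarrow> (('m \<Rightarrow> nat) \<Rightarrow> real) \<Rightarrow> real" where
  "grid_energy b I F =
     (\<Sum>q\<in>grid b I. \<Sum>i\<in>I. if Suc (q i) < b then (F (q(i := Suc (q i))) - F q)\<^sup>2 else 0)"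

lemma finite_grid: "finite I \<Longrightarrow> finite (grid b I)"
  by (simp add: grid_def finite_PiE)

lemma card_grid: "finite I \<Longrightarrow> card (grid b I) = b ^ card I"
  by (simp add: grid_def card_PiE)

lemma grid_UNIV: "q \<in> grid b UNIV \<longleftrightarrow> (\<forall>k. q k < b)"
  by (auto simp: grid_def PiE_def Pi_def)

lemma sum_grid_insert:
  assumes "i \<notin> I"
  shows "(\<Sum>q\<in>grid b (insert i I). H q) = (\<Sum>u<b. \<Sum>q\<in>grid b I. H (q(i := u)))"
proof -
  have "inj_on (\<lambda>(y, g). g(i := y)) ({..<b} \<times> grid b I)"
    unfolding grid_def using inj_combinator[OF assms, of "\<lambda>_. {..<b}"] by simp
  then show ?thesis
    unfolding grid_def[of b "insert i I"] PiE_insert_eq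
    by (simp add: grid_def[symmetric] sum.reindex sum.cartesian_product case_prod_unfold)
qed

lemma sum_square_le_card: "(\<Sum>i\<in>I. x i)\<^sup>2 \<le> real (card I) * (\<Sum>i\<in>I. (x i)\<^sup>2)"
  using Cauchy_Schwarz_ineq_sum[of "\<lambda>_. 1" x I] by simp

text \<open>Telescoping and Cauchy-Schwarz along a path of at most \<open>b\<close> edges bound each
  squared difference by \<open>b\<close> times the path energy; there are \<open>b\<close> squared
  pairs.\<close>

lemma path_poincare:
  "(\<Sum>x<b. \<Sum>y<b. (g x - g y)\<^sup>2) \<le> real b ^ 3 * (\<Sum>t<b. if Suc t < b then (g (Suc t) - g t)\<^sup>2 else 0)"
  for g :: "nat \<Rightarrow> real"
proof -
  let ?D = "\<Sum>t<b. if Suc t < b then (g (Suc t) - g t)\<^sup>2 else 0"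
  have le: "(g x - g y)\<^sup>2 \<le> real b * ?D" if "y \<le> x" "x < b" for x y
  proof -
    have "g x - g y = (\<Sum>t\<in>{y..<x}. g (Suc t) - g t)"
      using that by (simp add: sum_Suc_diff')
    then have "(g x - g y)\<^sup>2 \<le> real (card {y..<x}) * (\<Sum>t\<in>{y..<x}. (g (Suc t) - g t)\<^sup>2)"
      using sum_square_le_card[of "\<lambda>t. g (Suc t) - g t" "{y..<x}"] by simp
    also have "(\<Sum>t\<in>{y..<x}. (g (Suc t) - g t)\<^sup>2) = (\<Sum>t\<in>{y..<x}. if Suc t < b then (g (Suc t) - g t)\<^sup>2 else 0)"
      using that by (intro sum.cong) auto
    also have "\<dots> \<le> ?D" using that by (intro sum_mono2) auto
    also have "real (card {y..<x}) * ?D \<le> real b * ?D"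
      using that by (intro mult_right_mono sum_nonneg) auto
    finally show ?thesis by (simp add: mult_left_mono)
  qed
  have "(g x - g y)\<^sup>2 \<le> real b * ?D" if "x < b" "y < b" for x y
    using le[of x y] le[of y x] that by (cases "y \<le> x") (auto simp: power2_commute)
  then have "(\<Sum>x<b. \<Sum>y<b. (g x - g y)\<^sup>2) \<le> (\<Sum>x<b. \<Sum>y<b. real b * ?D)"
    by (intro sum_mono) auto
  also have "\<dots> = real b ^ 3 * ?D" by (simp add: power3_eq_cube)
  finally show ?thesis .
qed

text \<open>Tensorization: change one coordinate at a time.\<close>

lemma grid_poincare_pairs:
  assumes "finite I"
  shows "(\<Sum>q\<in>grid b I. \<Sum>q'\<in>grid b I. (F q - F q')\<^sup>2) \<le>
    2 ^ card I * real b ^ (card I + 2) * grid_energy b I F"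
  using assms
proof (induction I arbitrary: F rule: finite_induct)
  case empty
  then show ?case by (simp add: grid_def grid_energy_def)
next
  case (insert i I)
  let ?G = "grid b I" and ?c = "2 ^ card I * real b ^ (card I + 2)"
  let ?D = "\<lambda>x u. if Suc u < b then (F (x(i := Suc u)) - F (x(i := u)))\<^sup>2 else 0"
  have fin: "finite ?G" using insert by (simp add: finite_grid)
  have "(\<Sum>q\<in>grid b (insert i I). \<Sum>q'\<in>grid b (insert i I). (F q - F q')\<^sup>2)
      = (\<Sum>u<b. \<Sum>x\<in>?G. \<Sum>v<b. \<Sum>y\<in>?G. (F (x(i := u)) - F (y(i := v)))\<^sup>2)"
    using insert by (simp add: sum_grid_insert)
  \<comment> \<open>The intermediate point \<open>x(i := v)\<close> separates a move along direction
    \<open>i\<close>, treated by \<open>path_poincare\<close>, from a move inside the slice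
    \<open>i = v\<close>, treated by the induction hypothesis. The factor 2 paid here in each
    dimension becomes \<open>2 ^ card I\<close>.\<close>
  also have "\<dots> \<le> (\<Sum>u<b. \<Sum>x\<in>?G. \<Sum>v<b. \<Sum>y\<in>?G. 2 * (F (x(i := u)) - F (x(i := v)))\<^sup>2 + 2 * (F (x(i := v)) - F (y(i := v)))\<^sup>2)"
  proof (intro sum_mono)
    have "(a - c)\<^sup>2 \<le> 2 * (a - d)\<^sup>2 + 2 * (d - c)\<^sup>2" for a c d :: real
      using zero_le_power2[of "(a - d) - (d - c)"] by (simp add: power2_eq_square algebra_simps)
    then show "(F (x(i := u)) - F (y(i := v)))\<^sup>2 \<le> 2 * (F (x(i := u)) - F (x(i := v)))\<^sup>2 + 2 * (F (x(i := v)) - F (y(i := v)))\<^sup>2" for x y u v .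
  qed
  also have "\<dots> = (\<Sum>u<b. \<Sum>x\<in>?G. \<Sum>v<b. \<Sum>y\<in>?G. 2 * (F (x(i := u)) - F (x(i := v)))\<^sup>2)
      + (\<Sum>u<b. \<Sum>x\<in>?G. \<Sum>v<b. \<Sum>y\<in>?G. 2 * (F (x(i := v)) - F (y(i := v)))\<^sup>2)"
    by (simp add: sum.distrib)
  also have "(\<Sum>u<b. \<Sum>x\<in>?G. \<Sum>v<b. \<Sum>y\<in>?G. 2 * (F (x(i := u)) - F (x(i := v)))\<^sup>2)
      = 2 * real b ^ card I * (\<Sum>x\<in>?G. \<Sum>u<b. \<Sum>v<b. (F (x(i := u)) - F (x(i := v)))\<^sup>2)"
    by (subst sum.swap) (use insert in \<open>simp add: card_grid sum_distrib_left mult_ac\<close>)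
  also have "\<dots> \<le> 2 * real b ^ card I * (\<Sum>x\<in>?G. real b ^ 3 * (\<Sum>u<b. ?D x u))"
    by (intro mult_left_mono sum_mono path_poincare) auto
  also have "(\<Sum>u<b. \<Sum>x\<in>?G. \<Sum>v<b. \<Sum>y\<in>?G. 2 * (F (x(i := v)) - F (y(i := v)))\<^sup>2)
      = 2 * real b * (\<Sum>v<b. \<Sum>x\<in>?G. \<Sum>y\<in>?G. (F (x(i := v)) - F (y(i := v)))\<^sup>2)"
    by (subst sum.swap[of _ "{..<b}" ?G]) (simp add: sum_distrib_left mult_ac)
  also have "\<dots> \<le> 2 * real b * (\<Sum>v<b. ?c * grid_energy b I (\<lambda>x. F (x(i := v))))"
    by (intro mult_left_mono sum_mono insert.IH) auto
  finally have 1: "(\<Sum>q\<in>grid b (insert i I). \<Sum>q'\<in>grid b (insert i I). (F q - F q')\<^sup>2) \<le>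
    2 * real b ^ (card I + 3) * (\<Sum>x\<in>?G. \<Sum>u<b. ?D x u) +
    2 * (2 ^ card I) * real b ^ (card I + 3) * (\<Sum>v<b. grid_energy b I (\<lambda>x. F (x(i := v))))"
    by (simp add: sum_distrib_left power_add power3_eq_cube power2_eq_square mult_ac)
  have 2: "grid_energy b (insert i I) F = (\<Sum>x\<in>?G. \<Sum>u<b. ?D x u) + (\<Sum>v<b. grid_energy b I (\<lambda>x. F (x(i := v))))"
  proof -
    have "grid_energy b (insert i I) F = (\<Sum>u<b. \<Sum>x\<in>?G. ?D x u +
        (\<Sum>j\<in>I. if Suc (x j) < b then (F (x(j := Suc (x j), i := u)) - F (x(i := u)))\<^sup>2 else 0))"
      unfolding grid_energy_def sum_grid_insert[OF insert.hyps(2)]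
    proof (intro sum.cong refl)
      fix u x
      have *: "(\<Sum>j\<in>I. if Suc ((x(i := u)) j) < b then (F (x(i := u, j := Suc ((x(i := u)) j))) - F (x(i := u)))\<^sup>2 else 0)
        = (\<Sum>j\<in>I. if Suc (x j) < b then (F (x(j := Suc (x j), i := u)) - F (x(i := u)))\<^sup>2 else 0)"
      proof (intro sum.cong refl)
        fix j assume "j \<in> I"
        then have "j \<noteq> i" using insert by auto
        then show "(if Suc ((x(i := u)) j) < b then (F (x(i := u, j := Suc ((x(i := u)) j))) - F (x(i := u)))\<^sup>2 else 0)
          = (if Suc (x j) < b then (F (x(j := Suc (x j), i := u)) - F (x(i := u)))\<^sup>2 else 0)"
          by (simp add: fun_upd_twist)
      qed
      show "(\<Sum>j\<in>insert i I. if Suc ((x(i := u)) j) < b then (F (x(i := u, j := Suc ((x(i := u)) j))) - F (x(i := u)))\<^sup>2 else 0)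
        = ?D x u + (\<Sum>j\<in>I. if Suc (x j) < b then (F (x(j := Suc (x j), i := u)) - F (x(i := u)))\<^sup>2 else 0)"
        unfolding sum.insert[OF insert.hyps] * by simp
    qed
    also have "\<dots> = (\<Sum>x\<in>?G. \<Sum>u<b. ?D x u) + (\<Sum>v<b. grid_energy b I (\<lambda>x. F (x(i := v))))"
      unfolding sum.distrib grid_energy_def by (subst sum.swap) simp
    finally show ?thesis .
  qed
  have nn: "0 \<le> (\<Sum>x\<in>?G. \<Sum>u<b. ?D x u)" by (intro sum_nonneg) auto
  have "2 * real b ^ (card I + 3) * (\<Sum>x\<in>?G. \<Sum>u<b. ?D x u) \<le> 2 * (2 ^ card I) * real b ^ (card I + 3) * (\<Sum>x\<in>?G. \<Sum>u<b. ?D x u)"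
    by (intro mult_right_mono nn) auto
  with 1 have "(\<Sum>q\<in>grid b (insert i I). \<Sum>q'\<in>grid b (insert i I). (F q - F q')\<^sup>2) \<le>
    2 * (2 ^ card I) * real b ^ (card I + 3) * grid_energy b (insert i I) F"
    unfolding 2 by (simp add: distrib_left)
  then show ?case using insert by (simp add: numeral_3_eq_3 mult_ac)
qed

text \<open>When the sum of F vanishes, the squared differences over all pairs add up to twice the
  number of grid points times the sum of the squares.\<close>

lemma grid_poincare:
  assumes I: "finite I" and b: "0 < b" and zero: "(\<Sum>q\<in>grid b I. F q) = 0"
  shows "(\<Sum>q\<in>grid b I. (F q)\<^sup>2) \<le> 2 ^ card I * (real b)\<^sup>2 * grid_energy b I F"
proof -
  let ?G = "grid b I"
  have "(\<Sum>q\<in>?G. \<Sum>q'\<in>?G. (F q - F q')\<^sup>2) = (\<Sum>q\<in>?G. \<Sum>q'\<in>?G. (F q)\<^sup>2 + (F q')\<^sup>2 - 2 * F q * F q')"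
    by (simp add: power2_diff)
  also have "\<dots> = 2 * real (card ?G) * (\<Sum>q\<in>?G. (F q)\<^sup>2) - 2 * (\<Sum>q\<in>?G. F q) * (\<Sum>q\<in>?G. F q)"
    by (simp add: sum.distrib sum_subtractf sum_distrib_left[symmetric] sum_distrib_right[symmetric] mult.assoc)
  finally have "2 * real b ^ card I * (\<Sum>q\<in>?G. (F q)\<^sup>2) \<le> 2 ^ card I * real b ^ (card I + 2) * grid_energy b I F"
    using grid_poincare_pairs[OF I, where b = b and F = F] zero I by (simp add: card_grid)
  then have "real b ^ card I * (2 * (\<Sum>q\<in>?G. (F q)\<^sup>2)) \<le> real b ^ card I * (2 ^ card I * (real b)\<^sup>2 * grid_energy b I F)"
    by (simp add: power_add power2_eq_square mult_ac)
  then have "2 * (\<Sum>q\<in>?G. (F q)\<^sup>2) \<le> 2 ^ card I * (real b)\<^sup>2 * grid_energy b I F"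
    using b by simp
  moreover have "0 \<le> (\<Sum>q\<in>?G. (F q)\<^sup>2)" by (intro sum_nonneg) auto
  ultimately show ?thesis by linarith
qed

text \<open>Division with remainder in every coordinate: \<open>s\<close> is the block,
  \<open>t\<close> the position inside it.\<close>

lemma sum_grid_mult:
  fixes H :: "('m::finite \<Rightarrow> nat) \<Rightarrow> real"
  assumes b: "0 < b"
  shows "(\<Sum>q\<in>grid (b * c) UNIV. H q) = (\<Sum>s\<in>grid c UNIV. \<Sum>t\<in>grid b UNIV. H (\<lambda>k. b * s k + t k))"
proof -
  have "(\<Sum>s\<in>grid c UNIV. \<Sum>t\<in>grid b UNIV. H (\<lambda>k. b * s k + t k))
    = (\<Sum>(s, t)\<in>grid c UNIV \<times> grid b UNIV. H (\<lambda>k. b * s k + t k))"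
    by (simp add: sum.cartesian_product)
  also have "\<dots> = (\<Sum>q\<in>grid (b * c) UNIV. H q)"
  proof (rule sum.reindex_bij_witness[where i = "\<lambda>q. (\<lambda>k. q k div b, \<lambda>k. q k mod b)" and j = "\<lambda>(s, t) k. b * s k + t k"])
    fix p assume "p \<in> grid c (UNIV :: 'm set) \<times> grid b (UNIV :: 'm set)"
    then obtain s t where p: "p = (s, t)" and s: "\<And>k. s k < c" and t: "\<And>k. t k < b"
      by (auto simp: grid_UNIV)
    show "((\<lambda>k. (case p of (s, t) \<Rightarrow> \<lambda>k. b * s k + t k) k div b), (\<lambda>k. (case p of (s, t) \<Rightarrow> \<lambda>k. b * s k + t k) k mod b)) = p"
      using t b by (simp add: p)
    have "b * s k + t k < b * c" for k
    proof -
      have "b * s k + t k < b * Suc (s k)" using t[of k] by simp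
      also have "\<dots> \<le> b * c" using s[of k] by (intro mult_le_mono2) simp
      finally show ?thesis .
    qed
    then show "(case p of (s, t) \<Rightarrow> \<lambda>k. b * s k + t k) \<in> grid (b * c) UNIV"
      by (simp add: p grid_UNIV)
    show "H (case p of (s, t) \<Rightarrow> \<lambda>k. b * s k + t k) = (case p of (s, t) \<Rightarrow> H (\<lambda>k. b * s k + t k))"
      by (simp add: p)
  next
    fix q assume "q \<in> grid (b * c) (UNIV :: 'm set)"
    then have q: "\<And>k. q k < b * c" by (simp add: grid_UNIV)
    show "(case (\<lambda>k. q k div b, \<lambda>k. q k mod b) of (s, t) \<Rightarrow> \<lambda>k. b * s k + t k) = q" by simp
    have "q k div b < c" for k using q[of k] b by (simp add: less_mult_imp_div_less mult.commute)
    then show "(\<lambda>k. q k div b, \<lambda>k. q k mod b) \<in> grid c UNIV \<times> grid b UNIV"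
      using b by (simp add: grid_UNIV)
  qed
  finally show ?thesis by simp
qed

definition avg :: "(nat \<Rightarrow> real) \<Rightarrow> nat set \<Rightarrow> real" where
  "avg f P = (\<Sum>i\<in>P. f i) / real (card P)"

text \<open>The difference of the averages is itself the average of \<open>f i - f j\<close> over
  the pairs; Cauchy-Schwarz does the rest.\<close>

lemma avg_diff_square_le:
  assumes "finite P" "finite Q" "P \<noteq> {}" "Q \<noteq> {}"
  shows "(avg f P - avg f Q)\<^sup>2 \<le> (\<Sum>i\<in>P. \<Sum>j\<in>Q. (f i - f j)\<^sup>2) / (real (card P) * real (card Q))"
proof -
  let ?N = "real (card P) * real (card Q)"
  have pos: "0 < ?N" using assms by (simp add: card_gt_0_iff)
  have "?N * (avg f P - avg f Q) = real (card Q) * sum f P - real (card P) * sum f Q"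
    using assms by (simp add: avg_def right_diff_distrib)
  also have "\<dots> = (\<Sum>(i, j)\<in>P \<times> Q. f i - f j)"
    unfolding sum.cartesian_product[symmetric] by (simp add: sum_subtractf sum_distrib_left)
  finally have "?N * (avg f P - avg f Q) = (\<Sum>(i, j)\<in>P \<times> Q. f i - f j)" .
  then have "(?N * (avg f P - avg f Q))\<^sup>2 \<le> ?N * (\<Sum>(i, j)\<in>P \<times> Q. (f i - f j)\<^sup>2)"
    using sum_square_le_card[of "\<lambda>(i, j). f i - f j" "P \<times> Q"]
    by (simp add: case_prod_unfold card_cartesian_product)
  then have "?N * (?N * (avg f P - avg f Q)\<^sup>2) \<le> ?N * (\<Sum>i\<in>P. \<Sum>j\<in>Q. (f i - f j)\<^sup>2)"
    unfolding sum.cartesian_product[symmetric] by (simp add: power2_eq_square mult_ac)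
  then show ?thesis using pos by (simp add: pos_le_divide_eq mult.commute mult_le_cancel_left_pos)
qed

text \<open>Pairing with \<open>f\<close> gives the sum of the averages of \<open>f\<close> over the
  fine cells of block \<open>s\<close>, each cell counted equally whatever its number of points.
  Vanishing of it is exactly the mean-zero hypothesis of \<open>grid_poincare\<close> for the cell
  averages.\<close>

definition cell_functional :: "(('m::finite \<Rightarrow> nat) \<Rightarrow> nat set) \<Rightarrow> nat \<Rightarrow> ('m \<Rightarrow> nat) \<Rightarrow> nat \<Rightarrow> real" where
  "cell_functional Q b s i =
     (\<Sum>t\<in>grid b UNIV. if i \<in> Q (\<lambda>k. b * s k + t k) then 1 / real (card (Q (\<lambda>k. b * s k + t k))) else 0)"

lemma ip_cell_functional:
  assumes "\<And>t. t \<in> grid b UNIV \<Longrightarrow> Q (\<lambda>k. b * s k + t k) \<subseteq> {..<n}"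
  shows "ip n f (cell_functional Q b s) = (\<Sum>t\<in>grid b UNIV. avg f (Q (\<lambda>k. b * s k + t k)))"
proof -
  have "ip n f (cell_functional Q b s) = (\<Sum>t\<in>grid b UNIV. \<Sum>i<n. if i \<in> Q (\<lambda>k. b * s k + t k) then f i / real (card (Q (\<lambda>k. b * s k + t k))) else 0)"
    unfolding ip_def cell_functional_def sum_distrib_left
    by (subst sum.swap) (auto intro!: sum.cong)
  also have "\<dots> = (\<Sum>t\<in>grid b UNIV. avg f (Q (\<lambda>k. b * s k + t k)))"
  proof (intro sum.cong refl)
    fix t assume "t \<in> grid b (UNIV :: 'a set)"
    from assms[OF this] have "{..<n} \<inter> Q (\<lambda>k. b * s k + t k) = Q (\<lambda>k. b * s k + t k)" by auto
    then show "(\<Sum>i<n. if i \<in> Q (\<lambda>k. b * s k + t k) then f i / real (card (Q (\<lambda>k. b * s k + t k))) else 0) = avg f (Q (\<lambda>k. b * s k + t k))"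
      by (simp add: sum.If_cases avg_def sum_divide_distrib Int_def)
  qed
  finally show ?thesis .
qed

text \<open>Reflexive on purpose: one lower bound on the weights then covers pairs inside a cell as
  well as pairs in neighbouring cells.\<close>

definition adjacent :: "('m \<Rightarrow> nat) \<Rightarrow> ('m \<Rightarrow> nat) \<Rightarrow> bool" where
  "adjacent q q' \<longleftrightarrow> (\<forall>k. q k \<le> Suc (q' k) \<and> q' k \<le> Suc (q k))"

text \<open>Two scales are combined. The deviation of \<open>f\<close> from its cell average is
  controlled by the energy within the cell, which gives the first constant. The cell averages sum to
  zero over each block of side \<open>b\<close>, so the grid inequality controls them by differences
  of averages in neighbouring cells, hence by the energy between these cells; this gives the
  second.\<close>

lemma block_poincare:
  fixes Q :: "('m::finite \<Rightarrow> nat) \<Rightarrow> nat set"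
  assumes w_nonneg: "\<And>i j. 0 \<le> w i j"
    and b: "0 < b"
    and sub: "\<And>q. q \<in> grid (b * c) UNIV \<Longrightarrow> Q q \<subseteq> {..<n}"
    and disj: "\<And>q q'. q \<in> grid (b * c) UNIV \<Longrightarrow> q' \<in> grid (b * c) UNIV \<Longrightarrow> q \<noteq> q' \<Longrightarrow> Q q \<inter> Q q' = {}"
    and lo: "0 < lo" "\<And>q. q \<in> grid (b * c) UNIV \<Longrightarrow> lo \<le> real (card (Q q))"
    and hi: "0 \<le> hi" "\<And>q. q \<in> grid (b * c) UNIV \<Longrightarrow> real (card (Q q)) \<le> hi"
    and w0: "0 < w0" "\<And>q q' i j. q \<in> grid (b * c) UNIV \<Longrightarrow> q' \<in> grid (b * c) UNIV \<Longrightarrow> adjacent q q' \<Longrightarrow>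
        i \<in> Q q \<Longrightarrow> j \<in> Q q' \<Longrightarrow> w0 \<le> w i j"
    and orth: "\<And>s. s \<in> grid c UNIV \<Longrightarrow> ip n f (cell_functional Q b s) = 0"
  shows "(\<Sum>q\<in>grid (b * c) UNIV. \<Sum>i\<in>Q q. (f i)\<^sup>2) \<le>
    (2 / (lo * w0) + 2 * hi * 2 ^ CARD('m) * (real b)\<^sup>2 / (lo\<^sup>2 * w0)) * dirichlet_energy n w f"
proof -
  let ?G = "grid (b * c) (UNIV :: 'm set)" and ?K = "2 ^ CARD('m) * (real b)\<^sup>2"
  have finG: "finite ?G" by (simp add: finite_grid)
  have finQ: "finite (Q q)" if "q \<in> ?G" for q using sub[OF that] finite_subset by blast
  have neQ: "Q q \<noteq> {}" if "q \<in> ?G" for q using lo(1) lo(2)[OF that] by auto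
  define D where "D q q' = (\<Sum>i\<in>Q q. \<Sum>j\<in>Q q'. w i j * (f i - f j)\<^sup>2)" for q q'
  have D_nonneg: "0 \<le> D q q'" for q q' unfolding D_def by (intro sum_nonneg mult_nonneg_nonneg w_nonneg) auto
  have D_ge: "(\<Sum>i\<in>Q q. \<Sum>j\<in>Q q'. (f i - f j)\<^sup>2) \<le> D q q' / w0"
    if "q \<in> ?G" "q' \<in> ?G" "adjacent q q'" for q q'
  proof -
    have "w0 * (\<Sum>i\<in>Q q. \<Sum>j\<in>Q q'. (f i - f j)\<^sup>2) \<le> D q q'"
      unfolding D_def sum_distrib_left using w0(2) that by (intro sum_mono mult_right_mono) auto
    then show ?thesis using w0(1) by (simp add: field_simps)
  qed
  have avg_step: "(avg f (Q q) - avg f (Q q'))\<^sup>2 \<le> D q q' / (lo\<^sup>2 * w0)"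
    if "q \<in> ?G" "q' \<in> ?G" "adjacent q q'" for q q'
  proof -
    have "(avg f (Q q) - avg f (Q q'))\<^sup>2 \<le> (\<Sum>i\<in>Q q. \<Sum>j\<in>Q q'. (f i - f j)\<^sup>2) / (real (card (Q q)) * real (card (Q q')))"
      using that by (intro avg_diff_square_le finQ neQ)
    also have "\<dots> \<le> (D q q' / w0) / (lo * lo)"
      using lo that D_ge[OF that] w0(1) D_nonneg[of q q'] by (intro frac_le mult_mono sum_nonneg) auto
    finally show ?thesis by (simp add: power2_eq_square mult_ac)
  qed
  have self: "(\<Sum>i\<in>Q q. (f i)\<^sup>2) \<le> 2 / (lo * w0) * D q q + 2 * hi * (avg f (Q q))\<^sup>2" if q: "q \<in> ?G" for q
  proof -
    have "(f i)\<^sup>2 \<le> 2 * ((\<Sum>j\<in>Q q. (f i - f j)\<^sup>2) / lo) + 2 * (avg f (Q q))\<^sup>2" if "i \<in> Q q" for i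
    proof -
      have "(f i - avg f (Q q))\<^sup>2 \<le> (\<Sum>j\<in>Q q. (f i - f j)\<^sup>2) / real (card (Q q))"
        using avg_diff_square_le[of "{i}" "Q q" f] finQ[OF q] neQ[OF q] by (simp add: avg_def)
      also have "\<dots> \<le> (\<Sum>j\<in>Q q. (f i - f j)\<^sup>2) / lo"
        using lo(1) lo(2)[OF q] by (intro divide_left_mono sum_nonneg mult_pos_pos) auto
      finally have "(f i - avg f (Q q))\<^sup>2 \<le> (\<Sum>j\<in>Q q. (f i - f j)\<^sup>2) / lo" .
      moreover have "(f i)\<^sup>2 \<le> 2 * (f i - avg f (Q q))\<^sup>2 + 2 * (avg f (Q q))\<^sup>2"
        using zero_le_power2[of "f i - 2 * avg f (Q q)"] by (simp add: power2_eq_square algebra_simps)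
      ultimately show ?thesis by linarith
    qed
    then have "(\<Sum>i\<in>Q q. (f i)\<^sup>2) \<le> (\<Sum>i\<in>Q q. 2 * ((\<Sum>j\<in>Q q. (f i - f j)\<^sup>2) / lo) + 2 * (avg f (Q q))\<^sup>2)"
      by (rule sum_mono)
    also have "\<dots> = 2 / lo * (\<Sum>i\<in>Q q. \<Sum>j\<in>Q q. (f i - f j)\<^sup>2) + 2 * real (card (Q q)) * (avg f (Q q))\<^sup>2"
      by (simp add: sum.distrib sum_distrib_left sum_divide_distrib)
    also have "\<dots> \<le> 2 / lo * (D q q / w0) + 2 * hi * (avg f (Q q))\<^sup>2"
      using lo(1) hi(2)[OF q] by (intro add_mono mult_left_mono mult_right_mono D_ge q) (auto simp: adjacent_def)
    finally show ?thesis by simp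
  qed
  have next_le: "(\<Sum>k\<in>UNIV. if Suc (q k) < b * c then D q (q(k := Suc (q k))) else 0) \<le> (\<Sum>q'\<in>?G. D q q')"
    if q: "q \<in> ?G" for q
  proof -
    let ?K = "{k. Suc (q k) < b * c}"
    have inj: "inj_on (\<lambda>k. q(k := Suc (q k))) ?K"
      by (rule inj_onI) (metis fun_upd_apply n_not_Suc_n)
    have "(\<Sum>k\<in>UNIV. if Suc (q k) < b * c then D q (q(k := Suc (q k))) else 0) = (\<Sum>k\<in>?K. D q (q(k := Suc (q k))))"
      by (simp add: sum.If_cases)
    also have "\<dots> = (\<Sum>q'\<in>(\<lambda>k. q(k := Suc (q k))) ` ?K. D q q')"
      by (simp add: sum.reindex[OF inj])
    also have "\<dots> \<le> (\<Sum>q'\<in>?G. D q q')"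
      using q by (intro sum_mono2 finG D_nonneg) (auto simp: grid_UNIV)
    finally show ?thesis .
  qed
  \<comment> \<open>The cells are disjoint, so different pairs of cells use different pairs of
    vertices and no edge is counted twice.\<close>
  have total: "(\<Sum>q\<in>?G. \<Sum>q'\<in>?G. D q q') \<le> dirichlet_energy n w f"
  proof -
    let ?U = "\<Union>q\<in>?G. Q q"
    have U: "(\<Sum>q\<in>?G. \<Sum>i\<in>Q q. h i) = (\<Sum>i\<in>?U. h i)" for h :: "nat \<Rightarrow> real"
      using finG finQ disj by (intro sum.UNION_disjoint[symmetric]) auto
    have "(\<Sum>q\<in>?G. \<Sum>q'\<in>?G. D q q') = (\<Sum>q\<in>?G. \<Sum>i\<in>Q q. \<Sum>q'\<in>?G. \<Sum>j\<in>Q q'. w i j * (f i - f j)\<^sup>2)"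
      unfolding D_def by (intro sum.cong refl) (rule sum.swap)
    also have "\<dots> = (\<Sum>i\<in>?U. \<Sum>j\<in>?U. w i j * (f i - f j)\<^sup>2)"
      unfolding U ..
    also have "\<dots> \<le> (\<Sum>i\<in>?U. \<Sum>j<n. w i j * (f i - f j)\<^sup>2)"
      using sub by (intro sum_mono sum_mono2) (auto intro!: mult_nonneg_nonneg w_nonneg)
    also have "\<dots> \<le> dirichlet_energy n w f"
      unfolding dirichlet_energy_def
      using sub by (intro sum_mono2 sum_nonneg) (auto intro!: mult_nonneg_nonneg w_nonneg)
    finally show ?thesis .
  qed
  have diag: "(\<Sum>q\<in>?G. D q q) \<le> dirichlet_energy n w f"
    by (rule order_trans[OF sum_mono total]) (auto intro!: member_le_sum D_nonneg finG)
  have cell: "(\<Sum>t\<in>grid b UNIV. (avg f (Q (\<lambda>k. b * s k + t k)))\<^sup>2) \<le>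
      ?K * (\<Sum>t\<in>grid b UNIV. \<Sum>k\<in>UNIV. if Suc (b * s k + t k) < b * c then D (\<lambda>k. b * s k + t k) ((\<lambda>k. b * s k + t k)(k := Suc (b * s k + t k))) / (lo\<^sup>2 * w0) else 0)"
    if s: "s \<in> grid c (UNIV :: 'm set)" for s
  proof -
    let ?q = "\<lambda>t k. b * s k + t k"
    let ?F = "\<lambda>t. avg f (Q (?q t))"
    have lt: "b * s k + u < b * c" if "u < b" for k u
    proof -
      have "b * s k + u < b * Suc (s k)" using that by simp
      also have "\<dots> \<le> b * c" using s by (intro mult_le_mono2) (simp add: grid_UNIV Suc_leI)
      finally show ?thesis .
    qed
    then have in_G: "?q t \<in> ?G" if "t \<in> grid b UNIV" for t
      using that by (simp add: grid_UNIV)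
    have "(\<Sum>t\<in>grid b UNIV. ?F t) = 0"
      using orth[OF s] ip_cell_functional[of b Q s n f] sub in_G by simp
    then have "(\<Sum>t\<in>grid b UNIV. (?F t)\<^sup>2) \<le> ?K * grid_energy b UNIV ?F"
      using grid_poincare[where I = UNIV and b = b and F = ?F] b by simp
    \<comment> \<open>The guard is widened from edges inside the block to edges inside the whole
      grid. Summed over the blocks, the right-hand sides then merge into one sum over all
      cells.\<close>
    also have "grid_energy b UNIV ?F \<le> (\<Sum>t\<in>grid b UNIV. \<Sum>k\<in>UNIV. if Suc (?q t k) < b * c then D (?q t) ((?q t)(k := Suc (?q t k))) / (lo\<^sup>2 * w0) else 0)"
      unfolding grid_energy_def
    proof (intro sum_mono)
      fix t k assume t: "t \<in> grid b (UNIV :: 'm set)"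
      show "(if Suc (t k) < b then (?F (t(k := Suc (t k))) - ?F t)\<^sup>2 else 0) \<le> (if Suc (?q t k) < b * c then D (?q t) ((?q t)(k := Suc (?q t k))) / (lo\<^sup>2 * w0) else 0)"
      proof (cases "Suc (t k) < b")
        case True
        have up: "?q (t(k := Suc (t k))) = (?q t)(k := Suc (?q t k))" by (rule ext) simp
        have "t(k := Suc (t k)) \<in> grid b UNIV" using t True by (simp add: grid_UNIV)
        from in_G[OF this] have G': "(?q t)(k := Suc (?q t k)) \<in> ?G" unfolding up .
        have "(avg f (Q (?q t)) - avg f (Q ((?q t)(k := Suc (?q t k)))))\<^sup>2 \<le> D (?q t) ((?q t)(k := Suc (?q t k))) / (lo\<^sup>2 * w0)"
          by (rule avg_step[OF in_G[OF t] G']) (simp add: adjacent_def)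
        moreover have "Suc (?q t k) < b * c" using lt[OF True, of k] by simp
        ultimately show ?thesis using True unfolding up by (simp add: power2_commute)
      next
        case False
        then show ?thesis using D_nonneg w0(1) by simp
      qed
    qed
    finally show ?thesis by (simp add: mult_left_mono)
  qed
  have "(\<Sum>q\<in>?G. (avg f (Q q))\<^sup>2) = (\<Sum>s\<in>grid c UNIV. \<Sum>t\<in>grid b UNIV. (avg f (Q (\<lambda>k. b * s k + t k)))\<^sup>2)"
    by (rule sum_grid_mult[OF b])
  also have "\<dots> \<le> (\<Sum>s\<in>grid c UNIV. ?K * (\<Sum>t\<in>grid b UNIV. \<Sum>k\<in>UNIV. if Suc (b * s k + t k) < b * c then D (\<lambda>k. b * s k + t k) ((\<lambda>k. b * s k + t k)(k := Suc (b * s k + t k))) / (lo\<^sup>2 * w0) else 0))"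
    by (intro sum_mono cell)
  also have "\<dots> = ?K * (\<Sum>q\<in>?G. \<Sum>k\<in>UNIV. if Suc (q k) < b * c then D q (q(k := Suc (q k))) / (lo\<^sup>2 * w0) else 0)"
    unfolding sum_grid_mult[OF b] sum_distrib_left ..
  also have "\<dots> = ?K * ((\<Sum>q\<in>?G. \<Sum>k\<in>UNIV. if Suc (q k) < b * c then D q (q(k := Suc (q k))) else 0) / (lo\<^sup>2 * w0))"
    unfolding sum_divide_distrib by (intro arg_cong2[where f="(*)"] sum.cong refl) auto
  also have "\<dots> \<le> ?K * (dirichlet_energy n w f / (lo\<^sup>2 * w0))"
    using w0(1) by (intro mult_left_mono divide_right_mono order_trans[OF sum_mono total] next_le) auto
  finally have avgs: "(\<Sum>q\<in>?G. (avg f (Q q))\<^sup>2) \<le> ?K * (dirichlet_energy n w f / (lo\<^sup>2 * w0))" .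
  have "(\<Sum>q\<in>?G. \<Sum>i\<in>Q q. (f i)\<^sup>2) \<le> (\<Sum>q\<in>?G. 2 / (lo * w0) * D q q + 2 * hi * (avg f (Q q))\<^sup>2)"
    by (intro sum_mono self)
  also have "\<dots> = 2 / (lo * w0) * (\<Sum>q\<in>?G. D q q) + 2 * hi * (\<Sum>q\<in>?G. (avg f (Q q))\<^sup>2)"
    by (simp add: sum.distrib sum_distrib_left)
  finally have fin: "(\<Sum>q\<in>?G. \<Sum>i\<in>Q q. (f i)\<^sup>2) \<le> 2 / (lo * w0) * (\<Sum>q\<in>?G. D q q) + 2 * hi * (\<Sum>q\<in>?G. (avg f (Q q))\<^sup>2)" .
    have "2 / (lo * w0) * (\<Sum>q\<in>?G. D q q) + 2 * hi * (\<Sum>q\<in>?G. (avg f (Q q))\<^sup>2) \<le>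
      2 / (lo * w0) * dirichlet_energy n w f + 2 * hi * (?K * (dirichlet_energy n w f / (lo\<^sup>2 * w0)))"
      using lo(1) w0(1) hi(1) by (intro add_mono mult_left_mono diag avgs) auto
    with fin show ?thesis by (simp add: algebra_simps)
qed

section \<open>Bump functions and the fundamental lemma\<close>

text \<open>For \<open>k = 0\<close> this is the classical smooth function exp(-1/x) that vanishes
  to infinite order at 0. The powers of 1/x make the family closed under differentiation up to
  linear combination.\<close>

definition flat :: "nat \<Rightarrow> real \<Rightarrow> real" where
  "flat k x = (if x > 0 then (1 / x) ^ k * exp (- (1 / x)) else 0)"

lemma flat_tendsto_0: "(flat k \<longlongrightarrow> 0) (at 0)"
proof -
  have "((\<lambda>x. (1 / x) ^ k * exp (- (1 / x))) \<longlongrightarrow> 0) (at_right (0::real))"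
  proof -
    have "((\<lambda>y. y ^ k / exp y) \<longlongrightarrow> (0::real)) at_top" by (rule tendsto_power_div_exp_0)
    from filterlim_compose[OF this filterlim_inverse_at_top_right]
    show ?thesis by (simp add: exp_minus field_simps)
  qed
  moreover have "\<forall>\<^sub>F x in at_right (0::real). (1 / x) ^ k * exp (- (1 / x)) = flat k x"
    by (auto simp: eventually_at_right_field flat_def intro!: exI[of _ 1])
  ultimately have r: "(flat k \<longlongrightarrow> 0) (at_right 0)" by (rule Lim_transform_eventually)
  have "\<forall>\<^sub>F x in at_left (0::real). 0 = flat k x"
    by (auto simp: eventually_at_left_field flat_def intro!: exI[of _ "-1"])
  from Lim_transform_eventually[OF tendsto_const this]
  have l: "(flat k \<longlongrightarrow> 0) (at_left 0)" .
  show ?thesis using l r by (simp add: filterlim_at_split)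
qed

lemma flat_has_derivative:
  "(flat k has_real_derivative flat (k + 2) x - real k * flat (k + 1) x) (at x)"
proof -
  consider "x > 0" | "x < 0" | "x = 0" by linarith
  then show ?thesis
  proof cases
    case 1
    have "((\<lambda>x. (1 / x) ^ k * exp (- (1 / x))) has_real_derivative flat (k + 2) x - real k * flat (k + 1) x) (at x)"
    proof -
      have "((\<lambda>x. 1 / x) has_real_derivative - (1 / x)\<^sup>2) (at x)"
        using 1 by (auto intro!: derivative_eq_intros simp: power2_eq_square)
      from DERIV_power[OF this, of k]
      have "((\<lambda>x. (1 / x) ^ k) has_real_derivative - (real k * (1 / x) ^ (k + 1))) (at x)"
        by (cases k) (simp_all add: power2_eq_square)
      moreover have "((\<lambda>x. exp (- (1 / x))) has_real_derivative exp (- (1 / x)) * (1 / x)\<^sup>2) (at x)"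
        using 1 by (auto intro!: derivative_eq_intros simp: power2_eq_square)
      ultimately have "((\<lambda>x. (1 / x) ^ k * exp (- (1 / x))) has_real_derivative
          (- (real k * (1 / x) ^ (k + 1))) * exp (- (1 / x)) + (exp (- (1 / x)) * (1 / x)\<^sup>2) * (1 / x) ^ k) (at x)"
        by (rule DERIV_mult)
      then show ?thesis using 1 by (simp add: flat_def power_add power2_eq_square mult_ac)
    qed
    then show ?thesis
      by (rule DERIV_cong_ev[THEN iffD1, rotated -1])
        (use 1 in \<open>auto simp: flat_def eventually_nhds intro!: exI[of _ "{0<..}"]\<close>)
  next
    case 2
    have "((\<lambda>_. 0) has_real_derivative flat (k + 2) x - real k * flat (k + 1) x) (at x)"
      using 2 by (simp add: flat_def)
    then show ?thesis
      by (rule DERIV_cong_ev[THEN iffD1, rotated -1])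
        (use 2 in \<open>auto simp: flat_def eventually_nhds intro!: exI[of _ "{..<0}"]\<close>)
  next
    case 3
    \<comment> \<open>At 0 the difference quotient of \<open>flat k\<close> is
      \<open>flat (Suc k)\<close>, so its limit is already known.\<close>
    have "((\<lambda>h. (flat k h - flat k 0) / (h - 0)) \<longlongrightarrow> 0) (at 0)"
    proof (rule Lim_transform_eventually[OF flat_tendsto_0[of "Suc k"]])
      show "\<forall>\<^sub>F h in at 0. flat (Suc k) h = (flat k h - flat k 0) / (h - 0)"
        by (auto simp: eventually_at_filter flat_def)
    qed
    then show ?thesis using 3 by (simp add: has_field_derivative_iff flat_def)
  qed
qed

text \<open>A class of functions closed under all directional derivatives consists of smooth functions.\<close>

inductive flat_algebra :: "('a::euclidean_space \<Rightarrow> real) \<Rightarrow> bool" where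
  const: "flat_algebra (\<lambda>_. c)"
| flat: "flat_algebra (\<lambda>u. flat k (u \<bullet> c + d))"
| add: "flat_algebra f \<Longrightarrow> flat_algebra g \<Longrightarrow> flat_algebra (\<lambda>u. f u + g u)"
| mult: "flat_algebra f \<Longrightarrow> flat_algebra g \<Longrightarrow> flat_algebra (\<lambda>u. f u * g u)"

lemma flat_algebra_derivative:
  "flat_algebra f \<Longrightarrow> \<exists>f'. (\<forall>u. (f has_derivative f' u) (at u)) \<and> (\<forall>v. flat_algebra (\<lambda>u. f' u v))"
proof (induction rule: flat_algebra.induct)
  case (const c)
  show ?case by (intro exI[of _ "\<lambda>u v. 0"]) (auto intro: flat_algebra.const)
next
  case (flat k c d)
  let ?f' = "\<lambda>u v. (flat (k + 2) (u \<bullet> c + d) + (- real k) * flat (k + 1) (u \<bullet> c + d)) * (v \<bullet> c)"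
  have "((\<lambda>u. flat k (u \<bullet> c + d)) has_derivative ?f' u) (at u)" for u
    by (rule has_derivative_eq_rhs, rule has_derivative_compose[where g = "flat k" and f = "\<lambda>u. u \<bullet> c + d"],
        rule derivative_eq_intros, (rule derivative_eq_intros refl)+,
        rule flat_has_derivative[unfolded has_field_derivative_def]) auto
  moreover have "flat_algebra (\<lambda>u. ?f' u v)" for v
    by (intro flat_algebra.intros)
  ultimately show ?case by (intro exI[of _ ?f']) blast
next
  case (add f g)
  then obtain f' g' where "\<And>u. (f has_derivative f' u) (at u)" "\<And>v. flat_algebra (\<lambda>u. f' u v)"
    "\<And>u. (g has_derivative g' u) (at u)" "\<And>v. flat_algebra (\<lambda>u. g' u v)" by blast
  then show ?case
    by (intro exI[of _ "\<lambda>u v. f' u v + g' u v"]) (auto intro!: has_derivative_add flat_algebra.add)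
next
  case (mult f g)
  then obtain f' g' where "\<And>u. (f has_derivative f' u) (at u)" "\<And>v. flat_algebra (\<lambda>u. f' u v)"
    "\<And>u. (g has_derivative g' u) (at u)" "\<And>v. flat_algebra (\<lambda>u. g' u v)" by blast
  with mult.hyps show ?case
    by (intro exI[of _ "\<lambda>u v. f u * g' u v + f' u v * g u"])
      (auto intro!: has_derivative_mult flat_algebra.add flat_algebra.mult)
qed

lemma smooth_on_flat_algebra:
  assumes "flat_algebra f" shows "smooth_on UNIV f"
proof -
  have "C_k_on k UNIV f" if "flat_algebra f" for k and f :: "'a \<Rightarrow> real"
    using that
  proof (induction k arbitrary: f)
    case 0
    then obtain f' where "\<And>u. (f has_derivative f' u) (at u)" using flat_algebra_derivative by blast
    then show ?case
      by (auto intro!: continuous_at_imp_continuous_on has_derivative_continuous)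
  next
    case (Suc k)
    then obtain f' where f': "\<And>u. (f has_derivative f' u) (at u)" "\<And>v. flat_algebra (\<lambda>u. f' u v)"
      using flat_algebra_derivative by blast
    have "frechet_derivative f (at u) = f' u" for u
      using frechet_derivative_at[OF f'(1)] by simp
    then show ?case using f' Suc.IH by (auto simp: differentiable_def)
  qed
  then show ?thesis using assms by (simp add: smooth_on_def)
qed

text \<open>A factor is nonzero only where the point is more than 1/k away from the corresponding
  face. The support is therefore compact inside the open box, and as k grows the product tends to
  the indicator of the box.\<close>

definition bump :: "'a::euclidean_space \<Rightarrow> 'a \<Rightarrow> nat \<Rightarrow> 'a \<Rightarrow> real" where
  "bump a b k u = (\<Prod>i\<in>Basis. flat 0 (real k * (u \<bullet> i - a \<bullet> i) - 1) * flat 0 (real k * (b \<bullet> i - u \<bullet> i) - 1))"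

lemma smooth_on_bump: "smooth_on UNIV (bump a b k)"
proof -
  have *: "flat_algebra (\<lambda>u. \<Prod>i\<in>I. flat 0 (real k * (u \<bullet> i - a \<bullet> i) - 1) * flat 0 (real k * (b \<bullet> i - u \<bullet> i) - 1))"
    if "finite I" for I
    using that
  proof induction
    case empty then show ?case by (simp add: flat_algebra.const)
  next
    case (insert i I)
    have "flat_algebra (\<lambda>u. flat 0 (u \<bullet> (real k *\<^sub>R i) + (- real k * (a \<bullet> i) - 1)) * flat 0 (u \<bullet> (- real k *\<^sub>R i) + (real k * (b \<bullet> i) - 1)) *
      (\<Prod>i\<in>I. flat 0 (real k * (u \<bullet> i - a \<bullet> i) - 1) * flat 0 (real k * (b \<bullet> i - u \<bullet> i) - 1)))"
      by (intro flat_algebra.mult flat_algebra.flat insert.IH)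
    then show ?case using insert by (simp add: algebra_simps)
  qed
  show ?thesis unfolding bump_def[abs_def] by (intro smooth_on_flat_algebra *) simp
qed

lemma bump_bounds: "0 \<le> bump a b k u" "bump a b k u \<le> 1"
proof -
  have f: "0 \<le> flat 0 x" "flat 0 x \<le> 1" for x by (auto simp: flat_def)
  show "0 \<le> bump a b k u" unfolding bump_def by (intro prod_nonneg mult_nonneg_nonneg f)
  show "bump a b k u \<le> 1" unfolding bump_def by (intro prod_le_1 conjI mult_nonneg_nonneg mult_le_one f)
qed

lemma bump_support:
  "{u. bump a b k u \<noteq> 0} \<subseteq> cbox (a + (1 / real k) *\<^sub>R One) (b - (1 / real k) *\<^sub>R One)"
proof (cases "k = 0")
  case True
  have "\<exists>i::'a. i \<in> Basis" using nonempty_Basis by blast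
  then have "bump a b k u = 0" for u using True by (auto simp: bump_def flat_def)
  then show ?thesis by simp
next
  case False
  show ?thesis
  proof
    fix u assume "u \<in> {u. bump a b k u \<noteq> 0}"
    then have "flat 0 (real k * (u \<bullet> i - a \<bullet> i) - 1) \<noteq> 0" "flat 0 (real k * (b \<bullet> i - u \<bullet> i) - 1) \<noteq> 0"
      if "i \<in> Basis" for i using that by (auto simp: bump_def)
    then have "real k * (u \<bullet> i - a \<bullet> i) - 1 > 0" "real k * (b \<bullet> i - u \<bullet> i) - 1 > 0" if "i \<in> Basis" for i
      using that by (meson flat_def)+
    then show "u \<in> cbox (a + (1 / real k) *\<^sub>R One) (b - (1 / real k) *\<^sub>R One)"
      using False by (auto simp: mem_box inner_simps field_simps less_imp_le)
  qed
qed

lemma closure_bump_support: "compact (closure {u. bump a b k u \<noteq> 0})" "closure {u. bump a b k u \<noteq> 0} \<subseteq> box a b"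
proof -
  let ?C = "cbox (a + (1 / real k) *\<^sub>R One) (b - (1 / real k) *\<^sub>R One)"
  have sub: "closure {u. bump a b k u \<noteq> 0} \<subseteq> ?C"
    by (rule closure_minimal[OF bump_support closed_cbox])
  then show "compact (closure {u. bump a b k u \<noteq> 0})"
    by (meson bounded_cbox bounded_subset closed_closure compact_eq_bounded_closed)
  show "closure {u. bump a b k u \<noteq> 0} \<subseteq> box a b"
  proof (cases "k = 0")
    case True
    have "\<exists>i::'a. i \<in> Basis" using nonempty_Basis by blast
    then have "bump a b k u = 0" for u using True by (auto simp: bump_def flat_def)
    then show ?thesis by simp
  next
    case False
    have "?C \<subseteq> box a b"
    proof
      fix u assume u: "u \<in> ?C"
      show "u \<in> box a b" unfolding mem_box
      proof (intro ballI conjI)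
        fix i :: 'a assume i: "i \<in> Basis"
        with u have "a \<bullet> i + 1 / real k \<le> u \<bullet> i" "u \<bullet> i \<le> b \<bullet> i - 1 / real k"
          by (auto simp: mem_box inner_simps)
        moreover have "0 < 1 / real k" using False by simp
        ultimately show "a \<bullet> i < u \<bullet> i" "u \<bullet> i < b \<bullet> i" by linarith+
      qed
    qed
    with sub show ?thesis by blast
  qed
qed

lemma bump_tendsto: "(\<lambda>k. bump a b k u) \<longlonglongrightarrow> indicator (box a b) u"
proof (cases "u \<in> box a b")
  case True
  have lim: "(\<lambda>k. flat 0 (real k * t - 1)) \<longlonglongrightarrow> 1" if "0 < t" for t
  proof -
    have top: "filterlim (\<lambda>k. real k * t - 1) at_top sequentially"
      using filterlim_tendsto_add_at_top[OF tendsto_const[of "-1"]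
          filterlim_at_top_mult_tendsto_pos[OF tendsto_const[of t] that filterlim_real_sequentially]]
      by simp
    have "((\<lambda>x. exp (- (inverse x))) \<longlongrightarrow> exp (- (0::real))) at_top"
      by (intro tendsto_intros tendsto_inverse_0_at_top filterlim_ident)
    then have "((\<lambda>x. exp (- (1 / x))) \<longlongrightarrow> (1::real)) at_top" by (simp add: inverse_eq_divide)
    moreover have "\<forall>\<^sub>F x in at_top. exp (- (1 / x)) = flat 0 x"
      using eventually_gt_at_top[of 0] by eventually_elim (simp add: flat_def)
    ultimately have "(flat 0 \<longlongrightarrow> 1) at_top" by (rule Lim_transform_eventually)
    from filterlim_compose[OF this top] show ?thesis .
  qed
  have "(\<lambda>k. bump a b k u) \<longlonglongrightarrow> (\<Prod>i\<in>(Basis::'a set). 1 * 1)"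
    unfolding bump_def using True by (intro tendsto_prod tendsto_mult lim) (auto simp: mem_box)
  then show ?thesis using True by simp
next
  case False
  have "bump a b k u = 0" for k
    using closure_bump_support(2)[of a b k] closure_subset[of "{u. bump a b k u \<noteq> 0}"] False by blast
  then show ?thesis using False by simp
qed

lemma bump_test_function: "bump a b k \<in> test_functions (box a b)"
  unfolding test_functions_def using smooth_on_bump closure_bump_support by blast

text \<open>\<open>ennreal\<close> cuts negative values off at 0, so F and -F as densities give the
  measures of the positive and the negative part. These agree on boxes, an intersection-stable
  generator of the Borel sets, hence everywhere, and so do the densities almost everywhere.\<close>

lemma AE_0_if_box_integrals_0:
  fixes F :: "'a::euclidean_space \<Rightarrow> real"
  assumes int: "integrable lborel F" and zero: "\<And>a b. (LINT u|lborel. indicator (box a b) u * F u) = 0"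
  shows "AE u in lborel. F u = 0"
proof -
  have [measurable]: "F \<in> borel_measurable borel" using int by auto
  let ?M = "\<lambda>F. density lborel (\<lambda>u. ennreal (F u))"
  let ?E = "range (\<lambda>(a, b). box a b::'a set)"
  let ?A = "\<lambda>n::nat. box (- (real n *\<^sub>R One)) (real n *\<^sub>R One) :: 'a set"
  have inj: "x = y" if "x \<noteq> \<infinity>" "y \<noteq> \<infinity>" "enn2real x = enn2real y" for x y :: ennreal
    using that by (metis ennreal_enn2real less_top infinity_ennreal_def)
  have eq: "emeasure (?M F) X = emeasure (?M (\<lambda>u. - F u)) X" if "X \<in> ?E" for X
  proof -
    obtain a b where X: "X = box a b" using \<open>X \<in> ?E\<close> by auto
    have intX: "integrable lborel (\<lambda>u. indicator X u * F u)"
      using integrable_mult_indicator[OF _ int, of X] X by simp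
    have fin: "(\<integral>\<^sup>+ u. ennreal (indicator X u * F u) \<partial>lborel) \<noteq> \<infinity>" "(\<integral>\<^sup>+ u. ennreal (- (indicator X u * F u)) \<partial>lborel) \<noteq> \<infinity>"
      using intX unfolding real_integrable_def by blast+
    have "enn2real (\<integral>\<^sup>+ u. ennreal (indicator X u * F u) \<partial>lborel) = enn2real (\<integral>\<^sup>+ u. ennreal (- (indicator X u * F u)) \<partial>lborel)"
      using zero[of a b] real_lebesgue_integral_def[OF intX] X by simp
    then have "(\<integral>\<^sup>+ u. ennreal (indicator X u * F u) \<partial>lborel) = (\<integral>\<^sup>+ u. ennreal (- (indicator X u * F u)) \<partial>lborel)"
      by (rule inj[OF fin])
    moreover have "ennreal (indicator X u * G) = ennreal G * indicator X u" for G u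
      by (auto simp: indicator_def)
    moreover have "ennreal (- (indicator X u * G)) = ennreal (- G) * indicator X u" for G u
      by (auto simp: indicator_def)
    ultimately show ?thesis using X by (simp add: emeasure_density)
  qed
  have "?M F = ?M (\<lambda>u. - F u)"
  proof (rule measure_eqI_generator_eq[where A = ?A and E = ?E and \<Omega> = UNIV])
    show "Int_stable ?E" by (auto simp: Int_stable_def box_Int_box)
    show "?E \<subseteq> Pow UNIV" "sets (?M F) = sigma_sets UNIV ?E" "sets (?M (\<lambda>u. - F u)) = sigma_sets UNIV ?E"
      by (simp_all add: borel_eq_box)
    show "range ?A \<subseteq> ?E" "(\<Union>i. ?A i) = UNIV" unfolding UN_box_eq_UNIV by auto
    show "emeasure (?M F) (?A i) \<noteq> \<infinity>" for i
    proof -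
      have "emeasure (?M F) (?A i) \<le> (\<integral>\<^sup>+ u. ennreal (F u) \<partial>lborel)"
        by (subst emeasure_density) (auto intro!: nn_integral_mono simp: indicator_def)
      also have "\<dots> < \<infinity>" using int unfolding real_integrable_def by (simp add: top.not_eq_extremum)
      finally show ?thesis by simp
    qed
  qed (use eq in auto)
  then have "AE u in lborel. ennreal (F u) = ennreal (- F u)"
    by (intro sigma_finite_measure.density_unique[OF sigma_finite_lborel]) auto
  then show ?thesis
  proof eventually_elim
    case (elim u)
    then show ?case by (cases "F u" "0::real" rule: linorder_cases) (auto simp: ennreal_neg)
  qed
qed

text \<open>Bumps approximate the indicator of any smaller box under the integrable bound |F|, so
  the integral of F over each such box vanishes.\<close>

lemma du_Bois_Reymond:
  fixes F :: "real^'m \<Rightarrow> real"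
  assumes int: "integrable lborel F"
    and zero: "\<And>\<psi>. \<psi> \<in> test_functions (box a b) \<Longrightarrow> (LINT u|lborel. F u * \<psi> u) = 0"
  shows "AE u in lborel. u \<in> box a b \<longrightarrow> F u = 0"
proof -
  have [measurable]: "F \<in> borel_measurable borel" using int by auto
  have bz: "(LINT u|lborel. indicator (box c d) u * F u) = 0" if sub: "box c d \<subseteq> box a b" for c d
  proof -
    have "(\<lambda>k. LINT u|lborel. bump c d k u * F u) \<longlonglongrightarrow> (LINT u|lborel. indicator (box c d) u * F u)"
    proof (rule integral_dominated_convergence[where w = "\<lambda>u. \<bar>F u\<bar>"])
      have "bump c d k \<in> borel_measurable borel" for k
      proof -
        have "continuous_on UNIV (bump c d k)"
          using smooth_on_bump[of c d k] unfolding smooth_on_def by (metis C_k_on.simps(1))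
        then show ?thesis by (rule borel_measurable_continuous_onI)
      qed
      then show "(\<lambda>u. bump c d k u * F u) \<in> borel_measurable lborel" for k by simp
      show "AE u in lborel. norm (bump c d k u * F u) \<le> \<bar>F u\<bar>" for k
        using bump_bounds[of c d k] by (auto simp: abs_mult intro!: mult_left_le_one_le)
      show "AE u in lborel. (\<lambda>k. bump c d k u * F u) \<longlonglongrightarrow> indicator (box c d) u * F u"
        by (auto intro!: tendsto_intros bump_tendsto)
    qed (use int in auto)
    moreover have "(LINT u|lborel. bump c d k u * F u) = 0" for k
    proof -
      have "bump c d k \<in> test_functions (box a b)"
        using bump_test_function[of c d k] sub by (auto simp: test_functions_def)
      from zero[OF this] show ?thesis by (simp add: mult.commute)
    qed
    ultimately show ?thesis by (simp add: LIMSEQ_const_iff)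
  qed
  have "AE u in lborel. indicator (box a b) u * F u = 0"
  proof (rule AE_0_if_box_integrals_0)
    show "integrable lborel (\<lambda>u. indicator (box a b) u * F u)"
      using integrable_mult_indicator[OF _ int, of "box a b"] by simp
    fix c d :: "real^'m"
    \<comment> \<open>After F is cut off to \<open>box a b\<close>, an arbitrary box only matters
      through its intersection with \<open>box a b\<close>, which is again a box.\<close>
    obtain c' d' where box: "box c d \<inter> box a b = box c' d'" by (auto simp: box_Int_box)
    have "(LINT u|lborel. indicator (box c d) u * (indicator (box a b) u * F u)) = (LINT u|lborel. indicator (box c' d') u * F u)"
      unfolding box[symmetric] by (rule Bochner_Integration.integral_cong) (auto simp: indicator_def)
    also have "\<dots> = 0" using box by (intro bz) auto
    finally show "(LINT u|lborel. indicator (box c d) u * (indicator (box a b) u * F u)) = 0" .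
  qed
  then show ?thesis by eventually_elim (auto simp: indicator_def)
qed

section \<open>Difference quotients of weakly differentiable functions\<close>

lemma lborel_translate:
  fixes f :: "'a::euclidean_space \<Rightarrow> 'b::{banach, second_countable_topology}"
  assumes [measurable]: "f \<in> borel_measurable borel"
  shows "(LINT u|lborel. f (u + c)) = (LINT u|lborel. f u)"
    and "integrable lborel (\<lambda>u. f (u + c)) \<longleftrightarrow> integrable lborel f"
proof -
  have l: "lborel = distr lborel borel (\<lambda>u. u + c)"
  proof -
    have "(\<lambda>u. u + c) = (+) c" by (auto simp: add.commute)
    then show ?thesis by (simp add: lborel_distr_plus)
  qed
  show "(LINT u|lborel. f (u + c)) = (LINT u|lborel. f u)"
    by (subst (2) l) (simp add: integral_distr)
  show "integrable lborel (\<lambda>u. f (u + c)) \<longleftrightarrow> integrable lborel f"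
    by (subst (2) l) (simp add: integrable_distr_eq)
qed

lemma nn_integral_lborel_translate:
  fixes f :: "'a::euclidean_space \<Rightarrow> ennreal"
  assumes [measurable]: "f \<in> borel_measurable borel"
  shows "(\<integral>\<^sup>+u. f (u + c) \<partial>lborel) = (\<integral>\<^sup>+u. f u \<partial>lborel)"
proof -
  have l: "lborel = distr lborel borel (\<lambda>u. u + c)"
  proof -
    have "(\<lambda>u. u + c) = (+) c" by (auto simp: add.commute)
    then show ?thesis by (simp add: lborel_distr_plus)
  qed
  show ?thesis by (subst (2) l) (simp add: nn_integral_distr)
qed

lemma zero_outside_support:
  fixes \<psi> :: "'a::euclidean_space \<Rightarrow> real"
  assumes u: "u \<notin> closure {u. \<psi> u \<noteq> 0}"
  shows "\<psi> u = 0" and "frechet_derivative \<psi> (at u) v = 0"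
proof -
  have z: "\<psi> x = 0" if "x \<in> - closure {u. \<psi> u \<noteq> 0}" for x
    using that closure_subset[of "{u. \<psi> u \<noteq> 0}"] by blast
  show "\<psi> u = 0" using z u by blast
  have "((\<lambda>_. 0) has_derivative (\<lambda>_. 0)) (at u)" by (rule has_derivative_const)
  then have "(\<psi> has_derivative (\<lambda>_. 0)) (at u)"
  proof (rule has_derivative_transform_within_open)
    show "open (- closure {u. \<psi> u \<noteq> 0})" by (rule open_Compl[OF closed_closure])
    show "u \<in> - closure {u. \<psi> u \<noteq> 0}" unfolding Compl_iff by (rule u)
    show "0 = \<psi> x" if "x \<in> - closure {u. \<psi> u \<noteq> 0}" for x by (rule z[OF that, symmetric])
  qed
  from frechet_derivative_at[OF this] show "frechet_derivative \<psi> (at u) v = 0" by metis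
qed

lemma test_function_derivative:
  assumes "\<psi> \<in> test_functions S"
  shows "(\<psi> has_derivative frechet_derivative \<psi> (at u)) (at u)"
    and "continuous_on UNIV \<psi>"
    and "continuous_on UNIV (\<lambda>u. frechet_derivative \<psi> (at u) v)"
    and "\<exists>B. \<forall>u. \<bar>\<psi> u\<bar> \<le> B"
    and "\<exists>B. \<forall>u. \<bar>frechet_derivative \<psi> (at u) v\<bar> \<le> B"
proof -
  let ?C = "closure {u. \<psi> u \<noteq> 0}"
  have sm: "smooth_on UNIV \<psi>" and C: "compact ?C" using assms by (auto simp: test_functions_def)
  have "C_k_on 1 UNIV \<psi>" "C_k_on 0 UNIV \<psi>" using sm by (auto simp: smooth_on_def)
  then show d: "(\<psi> has_derivative frechet_derivative \<psi> (at u)) (at u)" and c: "continuous_on UNIV \<psi>"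
    and c': "continuous_on UNIV (\<lambda>u. frechet_derivative \<psi> (at u) v)" for u v
    by (auto simp: frechet_derivative_works)
  have bdd: "\<exists>B. \<forall>u. \<bar>F u\<bar> \<le> B" if F: "continuous_on UNIV F" "\<And>u. u \<notin> ?C \<Longrightarrow> F u = 0" for F :: "real^'a \<Rightarrow> real"
  proof -
    have "compact (F ` ?C)" using F(1) C by (intro compact_continuous_image) (auto intro: continuous_on_subset)
    then obtain B where B: "\<And>x. x \<in> F ` ?C \<Longrightarrow> norm x \<le> B" using compact_imp_bounded bounded_iff by metis
    have "\<bar>F u\<bar> \<le> max B 0" for u using B[of "F u"] F(2)[of u] by (cases "u \<in> ?C") auto
    then show ?thesis by blast
  qed
  show "\<exists>B. \<forall>u. \<bar>\<psi> u\<bar> \<le> B"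
    by (rule bdd[of \<psi>, OF c]) (rule zero_outside_support(1))
  show "\<exists>B. \<forall>u. \<bar>frechet_derivative \<psi> (at u) v\<bar> \<le> B"
    by (rule bdd[of "\<lambda>u. frechet_derivative \<psi> (at u) v", OF c'[of v]]) (rule zero_outside_support(2))
qed

lemma smooth_on_translate:
  fixes f :: "'a::euclidean_space \<Rightarrow> 'b::euclidean_space"
  assumes "smooth_on UNIV f" shows "smooth_on UNIV (\<lambda>u. f (u + c))"
proof -
  have "C_k_on k UNIV (\<lambda>u. f (u + c))" if "C_k_on k UNIV f" for k and f :: "'a \<Rightarrow> 'b"
    using that
  proof (induction k arbitrary: f)
    case 0
    then have "continuous_on UNIV f" by simp
    then have "continuous_on UNIV (\<lambda>u. f (u + c))"
      by (rule continuous_on_compose2) (auto intro!: continuous_intros)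
    then show ?case by simp
  next
    case (Suc k)
    have "((\<lambda>u. f (u + c)) has_derivative frechet_derivative f (at (u + c))) (at u)" for u
    proof -
      have "((\<lambda>u. u + c) has_derivative (\<lambda>v. v)) (at u)" by (auto intro!: derivative_eq_intros)
      moreover have "(f has_derivative frechet_derivative f (at (u + c))) (at (u + c))"
        using Suc.prems by (auto simp: frechet_derivative_works)
      ultimately show ?thesis by (rule has_derivative_compose)
    qed
    then have "(\<lambda>u. f (u + c)) differentiable (at u)"
      and "frechet_derivative (\<lambda>u. f (u + c)) (at u) = frechet_derivative f (at (u + c))" for u
      by (auto simp: differentiable_def intro: frechet_derivative_at[symmetric])
    moreover have "C_k_on k UNIV (\<lambda>u. frechet_derivative f (at (u + c)) v)" for v
      using Suc.IH[of "\<lambda>x. frechet_derivative f (at x) v"] Suc.prems by simp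
    ultimately show ?case by simp
  qed
  then show ?thesis using assms by (simp add: smooth_on_def)
qed

lemma frechet_derivative_translate:
  assumes "\<psi> \<in> test_functions S"
  shows "frechet_derivative (\<lambda>u. \<psi> (u + c)) (at u) = frechet_derivative \<psi> (at (u + c))"
proof -
  have "((\<lambda>u. u + c) has_derivative (\<lambda>v. v)) (at u)" by (auto intro!: derivative_eq_intros)
  from has_derivative_compose[OF this test_function_derivative(1)[OF assms]]
  show ?thesis using frechet_derivative_at by metis
qed

lemma test_functions_translate:
  assumes \<psi>: "\<psi> \<in> test_functions S" and S: "\<And>u. u \<in> S \<Longrightarrow> u - c \<in> S'"
  shows "(\<lambda>u. \<psi> (u + c)) \<in> test_functions S'"
proof -
  have eq: "{u. \<psi> (u + c) \<noteq> 0} = (\<lambda>u. - c + u) ` {u. \<psi> u \<noteq> 0}"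
    by (force simp: image_iff algebra_simps intro: exI[of _ "_ + c"])
  have "closure {u. \<psi> (u + c) \<noteq> 0} = (\<lambda>u. - c + u) ` closure {u. \<psi> u \<noteq> 0}"
    unfolding eq by (rule closure_translation)
  moreover have "smooth_on UNIV (\<lambda>u. \<psi> (u + c))"
    using \<psi> by (auto simp: test_functions_def intro: smooth_on_translate)
  moreover have "compact ((\<lambda>u. - c + u) ` closure {u. \<psi> u \<noteq> 0})"
    using \<psi> by (intro compact_translation) (simp add: test_functions_def)
  moreover have "(\<lambda>u. - c + u) ` closure {u. \<psi> u \<noteq> 0} \<subseteq> S'"
  proof -
    have "- c + u \<in> S'" if "u \<in> closure {u. \<psi> u \<noteq> 0}" for u
    proof -
      have "u \<in> S" using \<psi> that unfolding test_functions_def by blast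
      from S[OF this] show ?thesis by simp
    qed
    then show ?thesis by blast
  qed
  ultimately show ?thesis by (simp only: test_functions_def mem_Collect_eq simp_thms)
qed

text \<open>The segment parameter gets a probability measure, so that Jensen's inequality for
  expectations applies to averages along a segment.\<close>

abbreviation unit_interval :: "real measure" where
  "unit_interval \<equiv> restrict_space lborel {0..1}"

interpretation unit_interval: prob_space unit_interval
  by (rule prob_spaceI) (simp add: emeasure_restrict_space space_restrict_space)

interpretation unit_lborel: pair_sigma_finite unit_interval "lborel :: 'a::euclidean_space measure"
  by unfold_locales

text \<open>The identity is tested against a smooth \<psi>. Translation by t h and the derivative
  move onto \<psi>, for which the classical fundamental theorem holds; Fubini exchanges the
  integrals over t and u, and \<open>du_Bois_Reymond\<close> removes \<psi>.\<close>

lemma weak_FTC: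
  fixes g :: "real^'m \<Rightarrow> real" and dg :: "'m \<Rightarrow> real^'m \<Rightarrow> real"
  assumes g: "integrable lborel g" and dg: "\<And>i. integrable lborel (dg i)"
    and weak: "\<And>i \<psi>. \<psi> \<in> test_functions (box a b) \<Longrightarrow>
      (LINT u|lborel. g u * frechet_derivative \<psi> (at u) (axis i 1)) = - (LINT u|lborel. dg i u * \<psi> u)"
  shows "AE u in lborel. u \<in> box a b \<and> u + h \<in> box a b \<longrightarrow>
    g (u + h) - g u = (LINT t|unit_interval. (\<Sum>i\<in>UNIV. h $ i * dg i (u + t *\<^sub>R h)))"
proof -
  define G where "G u = (\<Sum>i\<in>UNIV. h $ i * dg i u)" for u
  have G: "integrable lborel G" unfolding G_def using dg by (intro Bochner_Integration.integrable_sum) auto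
  have [measurable]: "g \<in> borel_measurable borel" "G \<in> borel_measurable borel" using g G by auto
  have [measurable]: "(\<lambda>t. t) \<in> borel_measurable unit_interval"
    by (rule measurable_restrict_space1) simp
  have bounded_times: "integrable lborel (\<lambda>u. f u * H u)"
    if "integrable lborel f" "continuous_on UNIV H" "\<exists>B. \<forall>u. \<bar>H u\<bar> \<le> B" for f H :: "real^'m \<Rightarrow> real"
  proof -
    from that(3) obtain B where B: "\<And>u. \<bar>H u\<bar> \<le> B" by blast
    have [measurable]: "H \<in> borel_measurable borel" using that(2) by (rule borel_measurable_continuous_onI)
    show ?thesis
      by (rule Bochner_Integration.integrable_bound[where f = "\<lambda>u. B * f u"])
        (use that B in \<open>auto simp: abs_mult mult.commute[of "\<bar>f _\<bar>"] intro!: mult_right_mono AE_I2 order_trans[OF B abs_ge_self]\<close>)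
  qed
  have weak_G: "(LINT u|lborel. g u * frechet_derivative \<psi> (at u) h) = - (LINT u|lborel. G u * \<psi> u)"
    if \<psi>: "\<psi> \<in> test_functions (box a b)" for \<psi>
  proof -
    note td = test_function_derivative[OF \<psi>]
    have "frechet_derivative \<psi> (at u) h = (\<Sum>i\<in>UNIV. h $ i * frechet_derivative \<psi> (at u) (axis i 1))" for u
    proof -
      have "linear (frechet_derivative \<psi> (at u))" using td(1) has_derivative_linear by blast
      then have "frechet_derivative \<psi> (at u) (\<Sum>i\<in>UNIV. h $ i *\<^sub>R axis i 1) = (\<Sum>i\<in>UNIV. h $ i * frechet_derivative \<psi> (at u) (axis i 1))"
        by (simp add: linear_sum linear_scale)
      then show ?thesis using basis_expansion[of h] by (simp add: scalar_mult_eq_scaleR)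
    qed
    then have "(LINT u|lborel. g u * frechet_derivative \<psi> (at u) h) = (LINT u|lborel. (\<Sum>i\<in>UNIV. h $ i * (g u * frechet_derivative \<psi> (at u) (axis i 1))))"
      by (simp add: sum_distrib_left mult_ac)
    also have "\<dots> = (\<Sum>i\<in>UNIV. h $ i * (LINT u|lborel. g u * frechet_derivative \<psi> (at u) (axis i 1)))"
      using bounded_times[OF g td(3,5)] by (subst Bochner_Integration.integral_sum) auto
    also have "\<dots> = (\<Sum>i\<in>UNIV. h $ i * - (LINT u|lborel. dg i u * \<psi> u))"
      using weak[OF \<psi>] by simp
    also have "\<dots> = - (LINT u|lborel. (\<Sum>i\<in>UNIV. h $ i * (dg i u * \<psi> u)))"
      using bounded_times[OF dg td(2,4)] by (subst Bochner_Integration.integral_sum) (auto simp: sum_negf)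
    also have "\<dots> = - (LINT u|lborel. G u * \<psi> u)" by (simp add: G_def sum_distrib_left mult_ac)
    finally show ?thesis .
  qed
  define F where "F u = g (u + h) - g u - (LINT t|unit_interval. G (u + t *\<^sub>R h))" for u
  have intG: "integrable (unit_interval \<Otimes>\<^sub>M lborel) (\<lambda>(t, u). G (u + t *\<^sub>R h))"
  proof (rule unit_lborel.Fubini_integrable)
    have "(LINT u|lborel. \<bar>G (u + c)\<bar>) = (LINT u|lborel. \<bar>G u\<bar>)" for c
      by (rule lborel_translate(1)[where f = "\<lambda>u. \<bar>G u\<bar>"]) simp
    then show "integrable unit_interval (\<lambda>t. LINT u|lborel. norm (case (t, u) of (t, u) \<Rightarrow> G (u + t *\<^sub>R h)))"
      by simp
    show "AE t in unit_interval. integrable lborel (\<lambda>u. case (t, u) of (t, u) \<Rightarrow> G (u + t *\<^sub>R h))"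
      using G by (simp add: lborel_translate(2))
  qed measurable
  have "integrable lborel F"
    unfolding F_def using g unit_lborel.integrable_snd[OF intG]
    by (intro Bochner_Integration.integrable_diff) (auto simp: lborel_translate(2))
  \<comment> \<open>The points whose translate also lies in the box form a box again, so
    \<open>du_Bois_Reymond\<close> applies there; by convexity the whole segment from u to u + h
    stays inside.\<close>
  obtain a' b' where O: "box a b \<inter> box (a - h) (b - h) = box a' b'" by (auto simp: box_Int_box)
  have O_iff: "u \<in> box a' b' \<longleftrightarrow> u \<in> box a b \<and> u + h \<in> box a b" for u
    unfolding O[symmetric] by (auto simp: mem_box_cart algebra_simps)
  have O_seg: "u + t *\<^sub>R h \<in> box a b" if "u \<in> box a' b'" "0 \<le> t" "t \<le> 1" for u t
  proof -
    have "(1 - t) *\<^sub>R u + t *\<^sub>R (u + h) \<in> box a b"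
      using O_iff[THEN iffD1, OF that(1)] that(2,3) by (intro convexD[OF convex_box(2)]) auto
    then show ?thesis by (simp add: algebra_simps)
  qed
  have "(LINT u|lborel. F u * \<psi> u) = 0" if \<psi>: "\<psi> \<in> test_functions (box a' b')" for \<psi>
  proof -
    note td = test_function_derivative[OF \<psi>]
    have [measurable]: "\<psi> \<in> borel_measurable borel" "(\<lambda>u. frechet_derivative \<psi> (at u) h) \<in> borel_measurable borel"
      using td(2,3) by (auto intro: borel_measurable_continuous_onI)
    from td(4) obtain B where B: "\<And>u. \<bar>\<psi> u\<bar> \<le> B" by blast
    from td(5)[of h] obtain B' where B': "\<And>u. \<bar>frechet_derivative \<psi> (at u) h\<bar> \<le> B'" by blast
    have cont_tr: "continuous_on UNIV (\<lambda>u. f (u + c))" if "continuous_on UNIV f" for f :: "real^'m \<Rightarrow> real" and c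
      by (rule continuous_on_compose2[OF that]) (auto intro!: continuous_intros)
    have tr: "(\<lambda>u. \<psi> (u + - (t *\<^sub>R h))) \<in> test_functions (box a b)" if "0 \<le> t" "t \<le> 1" for t
      using O_seg[OF _ that] by (intro test_functions_translate[OF \<psi>]) auto
    have i1: "integrable lborel (\<lambda>u. g (u + h) * \<psi> u)"
      using g by (intro bounded_times td) (simp add: lborel_translate(2))
    have i2: "integrable lborel (\<lambda>u. g u * \<psi> u)" using g by (intro bounded_times td)
    have i2': "integrable lborel (\<lambda>u. g u * \<psi> (u + - h))"
      using g B by (intro bounded_times cont_tr td) auto
    have i3: "integrable (unit_interval \<Otimes>\<^sub>M lborel) (\<lambda>(t, u). G (u + t *\<^sub>R h) * \<psi> u)"
    proof (rule Bochner_Integration.integrable_bound[OF integrable_mult_right[OF intG, of B]])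
      have "\<bar>G (u + t *\<^sub>R h) * \<psi> u\<bar> \<le> \<bar>B * G (u + t *\<^sub>R h)\<bar>" for t u
        using mult_right_mono[OF order_trans[OF B[of u] abs_ge_self], of "\<bar>G (u + t *\<^sub>R h)\<bar>"]
        by (simp add: abs_mult mult.commute)
      then show "AE x in unit_interval \<Otimes>\<^sub>M lborel. norm (case x of (t, u) \<Rightarrow> G (u + t *\<^sub>R h) * \<psi> u) \<le>
          norm (B * (case x of (t, u) \<Rightarrow> G (u + t *\<^sub>R h)))"
        by (intro AE_I2) (simp add: split_beta)
    qed measurable
    have i4: "integrable (unit_interval \<Otimes>\<^sub>M lborel) (\<lambda>(t, u). g u * frechet_derivative \<psi> (at (u + - (t *\<^sub>R h))) h)"
    proof (rule unit_lborel.Fubini_integrable)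
      show "AE t in unit_interval. integrable lborel (\<lambda>u. case (t, u) of (t, u) \<Rightarrow> g u * frechet_derivative \<psi> (at (u + - (t *\<^sub>R h))) h)"
        unfolding prod.case using B' by (intro AE_I2 bounded_times g cont_tr[OF td(3)]) blast
      have "integrable unit_interval (\<lambda>t. LINT u|lborel. \<bar>g u * frechet_derivative \<psi> (at (u + - (t *\<^sub>R h))) h\<bar>)"
      proof (rule unit_interval.integrable_const_bound[where B = "LINT u|lborel. \<bar>g u\<bar> * B'"])
        show "AE t in unit_interval. norm (LINT u|lborel. \<bar>g u * frechet_derivative \<psi> (at (u + - (t *\<^sub>R h))) h\<bar>) \<le> (LINT u|lborel. \<bar>g u\<bar> * B')"
        proof (intro AE_I2)
          fix t
          have "(LINT u|lborel. \<bar>g u * frechet_derivative \<psi> (at (u + - (t *\<^sub>R h))) h\<bar>) \<le> (LINT u|lborel. \<bar>g u\<bar> * B')"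
            using g B' by (intro integral_mono integrable_abs bounded_times cont_tr[OF td(3)])
              (auto simp: abs_mult intro!: mult_left_mono)
          then show "norm (LINT u|lborel. \<bar>g u * frechet_derivative \<psi> (at (u + - (t *\<^sub>R h))) h\<bar>) \<le> (LINT u|lborel. \<bar>g u\<bar> * B')"
            by simp
        qed
      qed measurable
      then show "integrable unit_interval (\<lambda>t. LINT u|lborel. norm (case (t, u) of (t, u) \<Rightarrow> g u * frechet_derivative \<psi> (at (u + - (t *\<^sub>R h))) h))"
        by simp
    qed measurable
    \<comment> \<open>The minus sign in front of t h comes from moving the translation onto
      \<psi>.\<close>
    have FTC: "(LINT t|unit_interval. frechet_derivative \<psi> (at (u + - (t *\<^sub>R h))) h) = \<psi> u - \<psi> (u + - h)" for u
    proof -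
      have "((\<lambda>t. - \<psi> (u + - (t *\<^sub>R h))) has_real_derivative frechet_derivative \<psi> (at (u + - (t *\<^sub>R h))) h) (at t)" for t
      proof -
        have lin: "linear (frechet_derivative \<psi> (at (u - t *\<^sub>R h)))" using td(1) has_derivative_linear by blast
        have "((\<lambda>t. u + - (t *\<^sub>R h)) has_derivative (\<lambda>s. - (s *\<^sub>R h))) (at t)"
          by (auto intro!: derivative_eq_intros)
        from has_derivative_minus[OF has_derivative_compose[OF this td(1)]]
        have "((\<lambda>t. - \<psi> (u + - (t *\<^sub>R h))) has_derivative (\<lambda>s. - frechet_derivative \<psi> (at (u + - (t *\<^sub>R h))) (- (s *\<^sub>R h)))) (at t)" .
        then show ?thesis
          unfolding has_field_derivative_def
          by (rule has_derivative_eq_rhs) (auto simp: linear_neg[OF lin] linear_scale[OF lin] fun_eq_iff)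
      qed
      moreover have "continuous_on UNIV (\<lambda>t. frechet_derivative \<psi> (at (u + - (t *\<^sub>R h))) h)"
        by (rule continuous_on_compose2[OF td(3)]) (auto intro!: continuous_intros)
      ultimately have "(LBINT t. indicator {0..1} t *\<^sub>R frechet_derivative \<psi> (at (u + - (t *\<^sub>R h))) h) = - \<psi> (u + - (1 *\<^sub>R h)) - - \<psi> (u + - (0 *\<^sub>R h))"
        by (intro integral_FTC_Icc)
          (auto simp: has_real_derivative_iff_has_vector_derivative[symmetric] intro: has_field_derivative_at_within continuous_on_subset)
      then show ?thesis by (subst integral_restrict_space) auto
    qed
    have "(LINT u|lborel. (LINT t|unit_interval. G (u + t *\<^sub>R h)) * \<psi> u) = (LINT u|lborel. (LINT t|unit_interval. G (u + t *\<^sub>R h) * \<psi> u))"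
      by simp
    also have "\<dots> = (LINT t|unit_interval. (LINT u|lborel. G (u + t *\<^sub>R h) * \<psi> u))"
      by (rule unit_lborel.Fubini_integral[OF i3])
    also have "\<dots> = (LINT t|unit_interval. (- (LINT u|lborel. g u * frechet_derivative \<psi> (at (u + - (t *\<^sub>R h))) h)))"
    proof (intro Bochner_Integration.integral_cong refl)
      fix t assume "t \<in> space unit_interval"
      then have t: "0 \<le> t" "t \<le> 1" by (auto simp: space_restrict_space)
      \<comment> \<open>For each t the translate of \<psi> is an admissible test function on the
        original box, by \<open>tr\<close>, so the weak derivative in direction \<open>h\<close> can
        be used.\<close>
      have "(LINT u|lborel. G (u + t *\<^sub>R h) * \<psi> u) = (LINT u|lborel. G u * \<psi> (u + - (t *\<^sub>R h)))"
        using lborel_translate(1)[of "\<lambda>u. G u * \<psi> (u + - (t *\<^sub>R h))" "t *\<^sub>R h"] by simp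
      also have "\<dots> = - (LINT u|lborel. g u * frechet_derivative \<psi> (at (u + - (t *\<^sub>R h))) h)"
        using weak_G[OF tr[OF t]] unfolding frechet_derivative_translate[OF \<psi>] by simp
      finally show "(LINT u|lborel. G (u + t *\<^sub>R h) * \<psi> u) = - (LINT u|lborel. g u * frechet_derivative \<psi> (at (u + - (t *\<^sub>R h))) h)" .
    qed
    also have "\<dots> = - (LINT u|lborel. (LINT t|unit_interval. g u * frechet_derivative \<psi> (at (u + - (t *\<^sub>R h))) h))"
      using unit_lborel.Fubini_integral[OF i4] by simp
    also have "\<dots> = - (LINT u|lborel. g u * (\<psi> u - \<psi> (u + - h)))"
      by (simp only: integral_mult_right_zero FTC)
    also have "\<dots> = (LINT u|lborel. g u * \<psi> (u + - h)) - (LINT u|lborel. g u * \<psi> u)"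
      using i2 i2' by (simp add: right_diff_distrib)
    also have "(LINT u|lborel. g u * \<psi> (u + - h)) = (LINT u|lborel. g (u + h) * \<psi> u)"
      using lborel_translate(1)[of "\<lambda>u. g u * \<psi> (u + - h)" h] by simp
    finally have *: "(LINT u|lborel. (LINT t|unit_interval. G (u + t *\<^sub>R h)) * \<psi> u) = (LINT u|lborel. g (u + h) * \<psi> u) - (LINT u|lborel. g u * \<psi> u)" .
    have i5: "integrable lborel (\<lambda>u. (LINT t|unit_interval. G (u + t *\<^sub>R h)) * \<psi> u)"
      using unit_lborel.integrable_snd[OF i3] by simp
    have "(LINT u|lborel. F u * \<psi> u) = (LINT u|lborel. g (u + h) * \<psi> u - g u * \<psi> u - (LINT t|unit_interval. G (u + t *\<^sub>R h)) * \<psi> u)"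
      by (simp add: F_def left_diff_distrib)
    also have "\<dots> = 0" using i1 i2 i5 * by simp
    finally show ?thesis .
  qed
  then have "AE u in lborel. u \<in> box a' b' \<longrightarrow> F u = 0"
    by (rule du_Bois_Reymond[OF \<open>integrable lborel F\<close>])
  then show ?thesis by eventually_elim (auto simp: O_iff F_def G_def)
qed

text \<open>Jensen's inequality without integrability: a non-integrable X has expectation 0 by
  convention, and if only the square fails to be integrable the right-hand side is infinite.\<close>

lemma (in prob_space) expectation_square_le:
  fixes X :: "'a \<Rightarrow> real"
  assumes [measurable]: "X \<in> borel_measurable M"
  shows "ennreal ((expectation X)\<^sup>2) \<le> (\<integral>\<^sup>+x. ennreal ((X x)\<^sup>2) \<partial>M)"
proof (cases "integrable M X \<and> integrable M (\<lambda>x. (X x)\<^sup>2)")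
  case True
  then have "0 \<le> expectation (\<lambda>x. (X x)\<^sup>2) - (expectation X)\<^sup>2"
    using variance_eq[of X] variance_positive[of X] by simp
  then show ?thesis using True by (simp add: nn_integral_eq_integral)
next
  case False
  then show ?thesis
  proof (cases "integrable M X")
    case True
    with False have "\<not> integrable M (\<lambda>x. (X x)\<^sup>2)" by simp
    then have "(\<integral>\<^sup>+x. ennreal ((X x)\<^sup>2) \<partial>M) = \<infinity>"
      by (simp add: integrable_iff_bounded less_top[symmetric])
    then show ?thesis by simp
  qed (simp add: not_integrable_integral_eq)
qed

text \<open>Jensen along the segment from u to u + h, Fubini, translation invariance of Lebesgue
  measure, and Cauchy-Schwarz for the directional derivative in direction \<open>h\<close>.\<close>

lemma L2_difference_le:
  fixes g :: "real^'m \<Rightarrow> real" and dg :: "'m \<Rightarrow> real^'m \<Rightarrow> real"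
  assumes g: "integrable lborel g" and dg: "\<And>i. integrable lborel (dg i)"
    and weak: "\<And>i \<psi>. \<psi> \<in> test_functions (box a b) \<Longrightarrow>
      (LINT u|lborel. g u * frechet_derivative \<psi> (at u) (axis i 1)) = - (LINT u|lborel. dg i u * \<psi> u)"
  shows "(\<integral>\<^sup>+u. indicator (box a b) u * indicator (box a b) (u + h) * ennreal ((g (u + h) - g u)\<^sup>2) \<partial>lborel) \<le>
    ennreal ((norm h)\<^sup>2) * (\<integral>\<^sup>+u. indicator (box a b) u * ennreal (\<Sum>i\<in>UNIV. (dg i u)\<^sup>2) \<partial>lborel)"
proof -
  define G where "G u = (\<Sum>i\<in>UNIV. h $ i * dg i u)" for u
  have [measurable]: "g \<in> borel_measurable borel" "\<And>i. dg i \<in> borel_measurable borel" using g dg by auto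
  have [measurable]: "G \<in> borel_measurable borel" unfolding G_def by measurable
  have [measurable]: "(\<lambda>t. t) \<in> borel_measurable unit_interval"
    by (rule measurable_restrict_space1) simp
  let ?I = "\<lambda>u. indicator (box a b) u * indicator (box a b) (u + h) :: ennreal"
  have FTC: "AE u in lborel. u \<in> box a b \<and> u + h \<in> box a b \<longrightarrow>
    g (u + h) - g u = (LINT t|unit_interval. (\<Sum>i\<in>UNIV. h $ i * dg i (u + t *\<^sub>R h)))"
    by (rule weak_FTC[OF g dg]) (rule weak)
  have "(\<integral>\<^sup>+u. ?I u * ennreal ((g (u + h) - g u)\<^sup>2) \<partial>lborel) \<le>
      (\<integral>\<^sup>+u. \<integral>\<^sup>+t. ?I u * ennreal ((G (u + t *\<^sub>R h))\<^sup>2) \<partial>unit_interval \<partial>lborel)"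
  proof (rule nn_integral_mono_AE)
    show "AE u in lborel. ?I u * ennreal ((g (u + h) - g u)\<^sup>2) \<le> (\<integral>\<^sup>+t. ?I u * ennreal ((G (u + t *\<^sub>R h))\<^sup>2) \<partial>unit_interval)"
      using FTC
    proof eventually_elim
      case (elim u)
      show ?case
      proof (cases "u \<in> box a b \<and> u + h \<in> box a b")
        case True
        with elim have "g (u + h) - g u = (LINT t|unit_interval. G (u + t *\<^sub>R h))" by (simp add: G_def)
        then show ?thesis
          using True unit_interval.expectation_square_le[of "\<lambda>t. G (u + t *\<^sub>R h)"] by simp
      qed auto
    qed
  qed
  also have "\<dots> = (\<integral>\<^sup>+t. \<integral>\<^sup>+u. ?I u * ennreal ((G (u + t *\<^sub>R h))\<^sup>2) \<partial>lborel \<partial>unit_interval)"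
    by (rule unit_lborel.Fubini') measurable
  also have "\<dots> \<le> (\<integral>\<^sup>+t. (\<integral>\<^sup>+u. indicator (box a b) u * ennreal ((G u)\<^sup>2) \<partial>lborel) \<partial>unit_interval)"
  \<comment> \<open>For fixed t, convexity replaces the two endpoint conditions by the condition
    that u + t h lies in the box; a translation by t h then makes the bound independent of
    t.\<close>
  proof (rule nn_integral_mono)
    fix t assume "t \<in> space unit_interval"
    then have t: "0 \<le> t" "t \<le> 1" by (auto simp: space_restrict_space)
    have "(\<integral>\<^sup>+u. ?I u * ennreal ((G (u + t *\<^sub>R h))\<^sup>2) \<partial>lborel) \<le> (\<integral>\<^sup>+u. indicator (box a b) (u + t *\<^sub>R h) * ennreal ((G (u + t *\<^sub>R h))\<^sup>2) \<partial>lborel)"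
    proof (intro nn_integral_mono mult_right_mono)
      fix u
      have "u + t *\<^sub>R h \<in> box a b" if "u \<in> box a b" "u + h \<in> box a b"
      proof -
        have "(1 - t) *\<^sub>R u + t *\<^sub>R (u + h) \<in> box a b"
          using that t by (intro convexD[OF convex_box(2)]) auto
        then show ?thesis by (simp add: algebra_simps)
      qed
      then show "?I u \<le> indicator (box a b) (u + t *\<^sub>R h)" by (auto simp: indicator_def)
    qed simp
    also have "\<dots> = (\<integral>\<^sup>+u. indicator (box a b) u * ennreal ((G u)\<^sup>2) \<partial>lborel)"
      by (rule nn_integral_lborel_translate) measurable
    finally show "(\<integral>\<^sup>+u. ?I u * ennreal ((G (u + t *\<^sub>R h))\<^sup>2) \<partial>lborel) \<le> (\<integral>\<^sup>+u. indicator (box a b) u * ennreal ((G u)\<^sup>2) \<partial>lborel)" .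
  qed
  also have "\<dots> = (\<integral>\<^sup>+u. indicator (box a b) u * ennreal ((G u)\<^sup>2) \<partial>lborel)"
    using unit_interval.emeasure_space_1 by (simp add: space_restrict_space)
  also have "\<dots> \<le> (\<integral>\<^sup>+u. ennreal ((norm h)\<^sup>2) * (indicator (box a b) u * ennreal (\<Sum>i\<in>UNIV. (dg i u)\<^sup>2)) \<partial>lborel)"
  proof (rule nn_integral_mono)
    fix u
    have "(G u)\<^sup>2 \<le> (\<Sum>i\<in>UNIV. (h $ i)\<^sup>2) * (\<Sum>i\<in>UNIV. (dg i u)\<^sup>2)"
      unfolding G_def by (rule Cauchy_Schwarz_ineq_sum)
    also have "(\<Sum>i\<in>UNIV. (h $ i)\<^sup>2) = (norm h)\<^sup>2" by (simp add: norm_vec_def L2_set_def sum_nonneg)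
    finally show "indicator (box a b) u * ennreal ((G u)\<^sup>2) \<le> ennreal ((norm h)\<^sup>2) * (indicator (box a b) u * ennreal (\<Sum>i\<in>UNIV. (dg i u)\<^sup>2))"
      by (auto simp: indicator_def ennreal_mult[symmetric] sum_nonneg intro!: ennreal_leI)
  qed
  also have "\<dots> = ennreal ((norm h)\<^sup>2) * (\<integral>\<^sup>+u. indicator (box a b) u * ennreal (\<Sum>i\<in>UNIV. (dg i u)\<^sup>2) \<partial>lborel)"
    by (rule nn_integral_cmult) measurable
  finally show ?thesis .
qed

lemma emeasure_norm_le:
  "emeasure lborel {h :: real^'m. norm h \<le> R} \<le> ennreal ((2 * R) ^ CARD('m))" if "0 \<le> R"
proof -
  have "{h :: real^'m. norm h \<le> R} \<subseteq> cbox (\<chi> i. - R) (\<chi> i. R)"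
  proof
    fix h :: "real^'m" assume "h \<in> {h. norm h \<le> R}"
    then have "\<bar>h $ i\<bar> \<le> R" for i using component_le_norm_cart[of h i] by simp
    then show "h \<in> cbox (\<chi> i. - R) (\<chi> i. R)" by (auto simp: mem_box_cart abs_le_iff minus_le_iff)
  qed
  then have "emeasure lborel {h :: real^'m. norm h \<le> R} \<le> emeasure lborel (cbox (\<chi> i. - R) (\<chi> i. R) :: (real^'m) set)"
    by (intro emeasure_mono) auto
  also have "\<dots> = ennreal (measure lborel (cbox (\<chi> i. - R) (\<chi> i. R) :: (real^'m) set))"
    using emeasure_lborel_cbox_finite[of "(\<chi> i. - R) :: real^'m" "\<chi> i. R"]
    by (intro emeasure_eq_ennreal_measure) (simp add: less_top)
  also have "measure lborel (cbox (\<chi> i. - R) (\<chi> i. R) :: (real^'m) set) = (2 * R) ^ CARD('m)"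
  proof (subst content_cbox_cart)
    have "0 \<in> cbox (\<chi> i. - R) ((\<chi> i. R) :: real^'m)" using that by (simp add: mem_box_cart)
    then show "cbox (\<chi> i. - R) ((\<chi> i. R) :: real^'m) \<noteq> {}" by blast
  qed simp
  finally show ?thesis .
qed

text \<open>With v = u + h the double integral becomes an integral over displacements of the bound
  in \<open>L2_difference_le\<close>. Displacements of norm at most \<open>R\<close> contribute
  \<open>R\<close> squared each and fill a volume of at most
  \<open>(2 * R) ^ CARD('m)\<close>.\<close>

lemma nonlocal_energy_le:
  fixes g :: "real^'m \<Rightarrow> real" and dg :: "'m \<Rightarrow> real^'m \<Rightarrow> real"
  assumes sub: "cbox a b \<subseteq> U" and weak: "\<And>i. has_weak_partial U i g (dg i)" and R: "0 \<le> R"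
  shows "(\<integral>\<^sup>+u. \<integral>\<^sup>+v. indicator (box a b) u * indicator (box a b) v * indicator {h. norm h \<le> R} (v - u) * ennreal ((g v - g u)\<^sup>2) \<partial>lborel \<partial>lborel) \<le>
    ennreal ((2 * R) ^ CARD('m) * R\<^sup>2) * (\<integral>\<^sup>+u. indicator (box a b) u * ennreal (\<Sum>i\<in>UNIV. (dg i u)\<^sup>2) \<partial>lborel)"
proof -
  let ?B = "box a b"
  \<comment> \<open>Weak differentiability gives integrability on compact subsets of
    \<open>U\<close> only. Cutting off at the closed box makes everything globally integrable, and
    test functions supported in the open box do not notice it.\<close>
  define g' where "g' u = indicator (cbox a b) u * g u" for u
  define dg' where "dg' i u = indicator (cbox a b) u * dg i u" for i u
  have int: "integrable lborel g'" "integrable lborel (dg' i)" for i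
    using weak[of i] sub compact_cbox[of a b] unfolding has_weak_partial_def set_integrable_def g'_def dg'_def by auto
  have [measurable]: "g' \<in> borel_measurable borel" "\<And>i. dg' i \<in> borel_measurable borel" using int by auto
  have weak': "(LINT u|lborel. g' u * frechet_derivative \<psi> (at u) (axis i 1)) = - (LINT u|lborel. dg' i u * \<psi> u)"
    if \<psi>: "\<psi> \<in> test_functions (box a b)" for i \<psi>
  proof -
    have \<psi>U: "\<psi> \<in> test_functions U" using \<psi> sub box_subset_cbox unfolding test_functions_def by blast
    have C: "closure {u. \<psi> u \<noteq> 0} \<subseteq> box a b" using \<psi> by (simp add: test_functions_def)
    have z: "\<psi> u = 0" "frechet_derivative \<psi> (at u) v = 0" if "u \<notin> box a b" for u v
      using that C by (blast intro: zero_outside_support)+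
    have in_cbox: "u \<in> cbox a b \<and> u \<in> U" if "u \<in> box a b" for u using that box_subset_cbox sub by blast
    have "(LINT u:U|lborel. g u * frechet_derivative \<psi> (at u) (axis i 1)) = - (LINT u:U|lborel. dg i u * \<psi> u)"
      using weak[of i] \<psi>U by (simp add: has_weak_partial_def)
    moreover have "(LINT u:U|lborel. g u * frechet_derivative \<psi> (at u) (axis i 1)) = (LINT u|lborel. g' u * frechet_derivative \<psi> (at u) (axis i 1))"
      unfolding set_lebesgue_integral_def
    proof (intro Bochner_Integration.integral_cong refl)
      show "indicator U u *\<^sub>R (g u * frechet_derivative \<psi> (at u) (axis i 1)) = g' u * frechet_derivative \<psi> (at u) (axis i 1)" for u
        using z(2)[of u] in_cbox[of u] by (cases "u \<in> box a b") (auto simp: g'_def)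
    qed
    moreover have "(LINT u:U|lborel. dg i u * \<psi> u) = (LINT u|lborel. dg' i u * \<psi> u)"
      unfolding set_lebesgue_integral_def
    proof (intro Bochner_Integration.integral_cong refl)
      show "indicator U u *\<^sub>R (dg i u * \<psi> u) = dg' i u * \<psi> u" for u
        using z(1)[of u] in_cbox[of u] by (cases "u \<in> box a b") (auto simp: dg'_def)
    qed
    ultimately show ?thesis by simp
  qed
  have in_cbox: "u \<in> cbox a b" if "u \<in> box a b" for u using that box_subset_cbox by blast
  define E where "E = (\<integral>\<^sup>+u. indicator ?B u * ennreal (\<Sum>i\<in>UNIV. (dg i u)\<^sup>2) \<partial>lborel)"
  have E: "E = (\<integral>\<^sup>+u. indicator ?B u * ennreal (\<Sum>i\<in>UNIV. (dg' i u)\<^sup>2) \<partial>lborel)"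
    unfolding E_def using in_cbox by (intro nn_integral_cong) (auto simp: dg'_def indicator_def)
  have "(\<integral>\<^sup>+u. \<integral>\<^sup>+v. indicator ?B u * indicator ?B v * indicator {h. norm h \<le> R} (v - u) * ennreal ((g v - g u)\<^sup>2) \<partial>lborel \<partial>lborel)
      = (\<integral>\<^sup>+u. \<integral>\<^sup>+v. indicator ?B u * indicator ?B v * indicator {h. norm h \<le> R} (v - u) * ennreal ((g' v - g' u)\<^sup>2) \<partial>lborel \<partial>lborel)"
    using in_cbox by (intro nn_integral_cong) (auto simp: g'_def indicator_def)
  also have "\<dots> = (\<integral>\<^sup>+u. \<integral>\<^sup>+h. indicator ?B u * indicator ?B (u + h) * indicator {h. norm h \<le> R} h * ennreal ((g' (u + h) - g' u)\<^sup>2) \<partial>lborel \<partial>lborel)"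
  proof (rule nn_integral_cong)
    fix u
    show "(\<integral>\<^sup>+v. indicator ?B u * indicator ?B v * indicator {h. norm h \<le> R} (v - u) * ennreal ((g' v - g' u)\<^sup>2) \<partial>lborel)
      = (\<integral>\<^sup>+h. indicator ?B u * indicator ?B (u + h) * indicator {h. norm h \<le> R} h * ennreal ((g' (u + h) - g' u)\<^sup>2) \<partial>lborel)"
      using nn_integral_lborel_translate[where c = u and f = "\<lambda>v. indicator ?B u * indicator ?B v * indicator {h. norm h \<le> R} (v - u) * ennreal ((g' v - g' u)\<^sup>2)"]
      by (simp add: add.commute[of _ u])
  qed
  also have "\<dots> = (\<integral>\<^sup>+h. \<integral>\<^sup>+u. indicator ?B u * indicator ?B (u + h) * indicator {h. norm h \<le> R} h * ennreal ((g' (u + h) - g' u)\<^sup>2) \<partial>lborel \<partial>lborel)"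
    by (rule lborel_pair.Fubini') measurable
  also have "\<dots> \<le> (\<integral>\<^sup>+h. ennreal (R\<^sup>2) * E * indicator {h :: real^'m. norm h \<le> R} h \<partial>lborel)"
  proof (rule nn_integral_mono)
    fix h :: "real^'m"
    have "(\<integral>\<^sup>+u. indicator ?B u * indicator ?B (u + h) * ennreal ((g' (u + h) - g' u)\<^sup>2) \<partial>lborel) \<le> ennreal ((norm h)\<^sup>2) * E"
      unfolding E by (rule L2_difference_le[OF int]) (rule weak')
    also have "\<dots> \<le> ennreal (R\<^sup>2) * E" if "norm h \<le> R"
      using that by (intro mult_right_mono ennreal_leI power_mono) auto
    finally show "(\<integral>\<^sup>+u. indicator ?B u * indicator ?B (u + h) * indicator {h. norm h \<le> R} h * ennreal ((g' (u + h) - g' u)\<^sup>2) \<partial>lborel) \<le>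
      ennreal (R\<^sup>2) * E * indicator {h. norm h \<le> R} h"
      by (cases "norm h \<le> R") auto
  qed
  also have "\<dots> = ennreal (R\<^sup>2) * E * emeasure lborel {h :: real^'m. norm h \<le> R}"
    by (rule nn_integral_cmult_indicator) simp
  also have "\<dots> \<le> ennreal (R\<^sup>2) * E * ennreal ((2 * R) ^ CARD('m))"
    by (intro mult_left_mono emeasure_norm_le R) simp
  also have "\<dots> = ennreal ((2 * R) ^ CARD('m) * R\<^sup>2) * E"
    using R by (simp add: ennreal_mult mult_ac)
  finally show ?thesis unfolding E_def .
qed

section \<open>Charts of a compact submanifold\<close>

lemma continuous_on_det:
  fixes A :: "'a::topological_space \<Rightarrow> real^'n^'n"
  assumes "\<And>i j. continuous_on S (\<lambda>x. A x $ i $ j)"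
  shows "continuous_on S (\<lambda>x. det (A x))"
  unfolding det_def by (intro continuous_intros assms)

text \<open>The straight path from the Gram matrix to the identity has the quadratic form t |x|^2 +
  (1 - t) |f x|^2, which is positive for nonzero x. Its determinant never vanishes and ends at 1, so
  by the intermediate value theorem it is positive at the start.\<close>

lemma Gram_det_pos:
  fixes f :: "real^'m \<Rightarrow> real^'d"
  assumes f: "linear f" "inj f"
  shows "0 < det (\<chi> i j. f (axis i 1) \<bullet> f (axis j 1) :: real^'m^'m)"
proof -
  define A where "A t = (\<chi> i j. t * (if i = j then 1 else 0) + (1 - t) * (f (axis i 1) \<bullet> f (axis j 1)) :: real^'m^'m)" for t
  have nz: "det (A t) \<noteq> 0" if t: "0 \<le> t" "t \<le> 1" for t
  proof -
    have "x = 0" if x: "A t *v x = 0" for x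
    proof -
      have fx: "f x = (\<Sum>i\<in>UNIV. x $ i *\<^sub>R f (axis i 1))"
      proof -
        have "f x = f (\<Sum>i\<in>UNIV. x $ i *\<^sub>R axis i 1)"
          using basis_expansion[of x] by (simp add: scalar_mult_eq_scaleR)
        then show ?thesis using f(1) by (simp add: linear_sum linear_scale)
      qed
      have "x \<bullet> (A t *v x) = (\<Sum>i\<in>UNIV. \<Sum>j\<in>UNIV. x $ i * (A t $ i $ j * x $ j))"
        by (simp add: inner_vec_def matrix_vector_mult_def sum_distrib_left)
      also have "\<dots> = (\<Sum>i\<in>UNIV. \<Sum>j\<in>UNIV. (if i = j then t * (x $ i)\<^sup>2 else 0) + (1 - t) * ((x $ i *\<^sub>R f (axis i 1)) \<bullet> (x $ j *\<^sub>R f (axis j 1))))"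
        by (intro sum.cong refl) (simp add: A_def power2_eq_square algebra_simps)
      also have "\<dots> = t * (\<Sum>i\<in>UNIV. (x $ i)\<^sup>2) + (1 - t) * (f x \<bullet> f x)"
        unfolding fx inner_sum_left inner_sum_right sum.distrib sum_distrib_left by simp (rule sum.swap)
      finally have "t * (\<Sum>i\<in>UNIV. (x $ i)\<^sup>2) + (1 - t) * (f x \<bullet> f x) = 0"
        using x by simp
      moreover have "0 \<le> t * (\<Sum>i\<in>UNIV. (x $ i)\<^sup>2)" "0 \<le> (1 - t) * (f x \<bullet> f x)"
        using t by (auto intro!: mult_nonneg_nonneg sum_nonneg)
      ultimately have "t * (\<Sum>i\<in>UNIV. (x $ i)\<^sup>2) = 0" "(1 - t) * (f x \<bullet> f x) = 0" by linarith+
      then have "(\<Sum>i\<in>UNIV. (x $ i)\<^sup>2) = 0 \<or> f x = 0" by (cases "t = 0") auto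
      then show "x = 0"
      proof
        assume "(\<Sum>i\<in>UNIV. (x $ i)\<^sup>2) = 0"
        then show ?thesis by (simp add: sum_nonneg_eq_0_iff vec_eq_iff)
      next
        assume "f x = 0"
        then show ?thesis using f linear_injective_0 by blast
      qed
    qed
    then have "\<exists>B. B ** A t = mat 1" by (simp add: matrix_left_invertible_ker)
    then show ?thesis using invertible_det_nz invertible_left_inverse by blast
  qed
  have cont: "continuous_on {0..1} (\<lambda>t. det (A t))"
    by (intro continuous_on_det) (auto simp: A_def intro!: continuous_intros)
  have "det (A 1) = 1"
  proof -
    have "A 1 = mat 1" by (simp add: A_def mat_def vec_eq_iff)
    then show ?thesis by simp
  qed
  have "0 < det (A 0)"
  proof (rule ccontr)
    assume "\<not> 0 < det (A 0)"
    then have "\<exists>t\<ge>0. t \<le> 1 \<and> det (A t) = 0"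
      using \<open>det (A 1) = 1\<close> cont by (intro IVT') auto
    then show False using nz by blast
  qed
  then show ?thesis by (simp add: A_def)
qed

text \<open>Here \<open>1\<close> is the vector of ones, so \<open>cube\<close> is a ball of the
  maximum norm with radius \<open>s\<close>.\<close>

definition cube :: "real^'m \<Rightarrow> real \<Rightarrow> (real^'m) set" where
  "cube u s = cbox (u - s *\<^sub>R 1) (u + s *\<^sub>R 1)"

definition open_cube :: "real^'m \<Rightarrow> real \<Rightarrow> (real^'m) set" where
  "open_cube u s = box (u - s *\<^sub>R 1) (u + s *\<^sub>R 1)"

lemma mem_cube: "v \<in> cube u s \<longleftrightarrow> (\<forall>i. \<bar>v $ i - u $ i\<bar> \<le> s)"
  by (auto simp: cube_def mem_box_cart abs_le_iff algebra_simps)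

lemma mem_open_cube: "v \<in> open_cube u s \<longleftrightarrow> (\<forall>i. \<bar>v $ i - u $ i\<bar> < s)"
  by (auto simp: open_cube_def mem_box_cart abs_less_iff algebra_simps)

lemma open_cube_subset: "open_cube u s \<subseteq> cube u s"
  by (auto simp: mem_cube mem_open_cube less_imp_le)

definition volume_density :: "(real^'m \<Rightarrow> real^'d) \<Rightarrow> real^'m \<Rightarrow> real" where
  "volume_density \<phi> u = sqrt (det (metric_tensor \<phi> u))"

text \<open>A single constant \<open>k\<close> serves all bounds and may be enlarged, so that
  finitely many charts can share one constant.\<close>

definition good_chart :: "real \<Rightarrow> (real^'d) set \<Rightarrow> (real^'m) set \<Rightarrow> (real^'m \<Rightarrow> real^'d) \<Rightarrow> real^'m \<Rightarrow> real \<Rightarrow> bool" where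
  "good_chart k X U \<phi> u0 s \<longleftrightarrow> local_param X U \<phi> \<and> cube u0 s \<subseteq> U \<and> 1 / k \<le> s \<and> s \<le> k \<and>
     (\<forall>u\<in>cube u0 s. \<forall>v\<in>cube u0 s. norm (\<phi> u - \<phi> v) \<le> k * norm (u - v) \<and> norm (u - v) \<le> k * norm (\<phi> u - \<phi> v)) \<and>
     (\<forall>u\<in>cube u0 s. \<forall>i. norm (frechet_derivative \<phi> (at u) (axis i 1)) \<le> k) \<and>
     (\<forall>u\<in>cube u0 s. 1 / k \<le> volume_density \<phi> u \<and> volume_density \<phi> u \<le> k)"

lemma good_chart_mono:
  assumes "good_chart k X U \<phi> u0 s" "k \<le> k'" "0 < k"
  shows "good_chart k' X U \<phi> u0 s"
proof -
  have kk: "1 / k' \<le> 1 / k" using assms by (simp add: frac_le)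
  have km: "x \<le> k' * norm v" if "x \<le> k * norm v" for x and v :: "real^'d"
    using that mult_right_mono[OF assms(2) norm_ge_zero[of v]] by linarith
  have km': "x \<le> k' * norm v" if "x \<le> k * norm v" for x and v :: "real^'m"
    using that mult_right_mono[OF assms(2) norm_ge_zero[of v]] by linarith
  note gc = assms(1)[unfolded good_chart_def]
  show ?thesis
    unfolding good_chart_def
  proof (intro conjI ballI allI)
    show "local_param X U \<phi>" "cube u0 s \<subseteq> U" using gc by blast+
    have "1 / k \<le> s" "s \<le> k" using gc by blast+
    then show "1 / k' \<le> s" "s \<le> k'" using kk assms(2) by linarith+
    fix u assume u: "u \<in> cube u0 s"
    have "1 / k \<le> volume_density \<phi> u" "volume_density \<phi> u \<le> k" using gc u by blast+
    then show "1 / k' \<le> volume_density \<phi> u" "volume_density \<phi> u \<le> k'" using kk assms(2) by linarith+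
    have "norm (frechet_derivative \<phi> (at u) (axis i 1)) \<le> k" for i using gc u by blast
    then show "norm (frechet_derivative \<phi> (at u) (axis i 1)) \<le> k'" for i using assms(2) order_trans by blast
    fix v assume v: "v \<in> cube u0 s"
    show "norm (\<phi> u - \<phi> v) \<le> k' * norm (u - v)" using gc u v by (blast intro: km')
    show "norm (u - v) \<le> k' * norm (\<phi> u - \<phi> v)" using gc u v by (blast intro: km)
  qed
qed

lemma local_param_C1:
  assumes "local_param X U \<phi>"
  shows "open U" and "u \<in> U \<Longrightarrow> (\<phi> has_derivative frechet_derivative \<phi> (at u)) (at u)"
    and "continuous_on U (\<lambda>u. frechet_derivative \<phi> (at u) v)"
    and "u \<in> U \<Longrightarrow> linear (frechet_derivative \<phi> (at u))"
    and "u \<in> U \<Longrightarrow> inj (frechet_derivative \<phi> (at u))"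
    and "continuous_on U \<phi>"
    and "continuous_on U (\<lambda>u. det (metric_tensor \<phi> u))"
    and "continuous_on U (volume_density \<phi>)"
proof -
  have "C_k_on 1 U \<phi>" using assms by (auto simp: local_param_def smooth_on_def)
  then show d: "u \<in> U \<Longrightarrow> (\<phi> has_derivative frechet_derivative \<phi> (at u)) (at u)"
    and c: "continuous_on U (\<lambda>u. frechet_derivative \<phi> (at u) v)" for u v
    unfolding One_nat_def C_k_on.simps by (blast intro: frechet_derivative_works[THEN iffD1])+
  show "u \<in> U \<Longrightarrow> linear (frechet_derivative \<phi> (at u))" using d has_derivative_linear by blast
  show "open U" "u \<in> U \<Longrightarrow> inj (frechet_derivative \<phi> (at u))" using assms by (auto simp: local_param_def)
  show "continuous_on U \<phi>" using assms by (auto simp: local_param_def homeomorphism_def)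
  show "continuous_on U (\<lambda>u. det (metric_tensor \<phi> u))"
    unfolding metric_tensor_def by (rule continuous_on_det) (simp only: vec_lambda_beta, intro continuous_on_inner c)
  then show "continuous_on U (volume_density \<phi>)"
    unfolding volume_density_def[abs_def] by (intro continuous_intros)
qed

lemma linear_norm_le_sum:
  fixes f :: "real^'m \<Rightarrow> 'b::real_normed_vector"
  assumes "linear f" "\<And>i. norm (f (axis i 1)) \<le> B"
  shows "norm (f v) \<le> real CARD('m) * B * norm v"
proof -
  have "f v = (\<Sum>i\<in>UNIV. v $ i *\<^sub>R f (axis i 1))"
  proof -
    have "f v = f (\<Sum>i\<in>UNIV. v $ i *\<^sub>R axis i 1)"
      using basis_expansion[of v] by (simp add: scalar_mult_eq_scaleR)
    then show ?thesis using assms(1) by (simp add: linear_sum linear_scale)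
  qed
  also have "norm \<dots> \<le> (\<Sum>i\<in>(UNIV::'m set). norm v * B)"
    by (rule sum_norm_le) (auto intro!: mult_mono assms component_le_norm_cart)
  also have "\<dots> = real CARD('m) * B * norm v" by simp
  finally show ?thesis .
qed

text \<open>Near \<open>u0\<close> the chart differs from its linearization by a map with Lipschitz
  constant c/2, where c bounds the injective derivative at \<open>u0\<close> from below. A
  perturbation of that size preserves both Lipschitz bounds; the volume density is positive by
  \<open>Gram_det_pos\<close> and continuous.\<close>

lemma exists_good_chart:
  fixes X :: "(real^'d) set"
  assumes X: "smooth_submanifold TYPE('m::finite) X" "x \<in> X"
  shows "\<exists>k (U :: (real^'m) set) \<phi> u0 s. good_chart k X U \<phi> u0 s \<and> 0 < k \<and> \<phi> u0 = x"
proof -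
  obtain U :: "(real^'m) set" and \<phi> where lp: "local_param X U \<phi>" and "x \<in> \<phi> ` U"
    using X by (auto simp: smooth_submanifold_def)
  then obtain u0 where u0: "u0 \<in> U" "\<phi> u0 = x" by auto
  note C1 = local_param_C1[OF lp]
  let ?m = "real CARD('m)"
  define D where "D u = frechet_derivative \<phi> (at u)" for u
  obtain c where c: "0 < c" "\<And>v. c * norm v \<le> norm (D u0 v)"
    using linear_inj_bounded_below_pos[OF C1(4,5)] u0 unfolding D_def by metis
  obtain B where B: "0 < B" "\<And>v. norm (D u0 v) \<le> B * norm v"
    using linear_bounded_pos[OF C1(4)] u0 unfolding D_def by metis
  \<comment> \<open>If all \<open>CARD('m)\<close> columns of two derivatives differ by less than
    this, the derivatives differ by at most c/2 in operator norm.\<close>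
  define \<epsilon> where "\<epsilon> = c / (2 * ?m)"
  have \<epsilon>: "0 < \<epsilon>" using c by (simp add: \<epsilon>_def)
  define g where "g = volume_density \<phi> u0"
  have g: "0 < g"
    unfolding g_def volume_density_def metric_tensor_def
    using Gram_det_pos[OF C1(4,5)] u0 by simp
  have ev: "\<forall>\<^sub>F u in nhds u0. u \<in> U \<inter> f -` Q"
    if "continuous_on U f" "open Q" "f u0 \<in> Q" for f :: "real^'m \<Rightarrow> 'z::topological_space" and Q
  proof (rule eventually_nhds_in_open)
    show "open (U \<inter> f -` Q)" by (rule continuous_open_preimage[OF that(1) C1(1) that(2)])
    show "u0 \<in> U \<inter> f -` Q" using u0(1) that(3) by blast
  qed
  have "\<forall>\<^sub>F u in nhds u0. \<forall>i\<in>UNIV. norm (D u (axis i 1) - D u0 (axis i 1)) < \<epsilon>"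
  proof (rule eventually_ball_finite, simp, rule ballI)
    fix i :: 'm
    have "\<forall>\<^sub>F u in nhds u0. u \<in> U \<inter> (\<lambda>u. D u (axis i 1)) -` ball (D u0 (axis i 1)) \<epsilon>"
      by (rule ev) (use \<epsilon> C1(3) in \<open>auto simp: D_def\<close>)
    then show "\<forall>\<^sub>F u in nhds u0. norm (D u (axis i 1) - D u0 (axis i 1)) < \<epsilon>"
      by eventually_elim (simp add: dist_norm norm_minus_commute)
  qed
  moreover have "\<forall>\<^sub>F u in nhds u0. g / 2 < volume_density \<phi> u \<and> volume_density \<phi> u < 2 * g"
  proof -
    have "\<forall>\<^sub>F u in nhds u0. u \<in> U \<inter> volume_density \<phi> -` {g / 2<..<2 * g}"
      by (rule ev[OF C1(8)]) (use g in \<open>auto simp: g_def\<close>)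
    then show ?thesis by eventually_elim simp
  qed
  moreover have "\<forall>\<^sub>F u in nhds u0. u \<in> U" using C1(1) u0(1) by (rule eventually_nhds_in_open)
  ultimately have "\<forall>\<^sub>F u in nhds u0. (\<forall>i. norm (D u (axis i 1) - D u0 (axis i 1)) < \<epsilon>) \<and>
      (g / 2 < volume_density \<phi> u \<and> volume_density \<phi> u < 2 * g) \<and> u \<in> U"
    by eventually_elim simp
  then obtain d where d: "0 < d" and near: "\<And>u. dist u u0 < d \<Longrightarrow> (\<forall>i. norm (D u (axis i 1) - D u0 (axis i 1)) < \<epsilon>) \<and>
      (g / 2 < volume_density \<phi> u \<and> volume_density \<phi> u < 2 * g) \<and> u \<in> U"
    unfolding eventually_nhds_metric by blast
  \<comment> \<open>The norm is at most the sum of the coordinates, so points of the cube lie within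
    d/2 of the centre.\<close>
  define s where "s = d / (2 * ?m)"
  have s: "0 < s" using d by (simp add: s_def)
  have cube_near: "dist u u0 < d" if "u \<in> cube u0 s" for u
  proof -
    have "norm (u - u0) \<le> (\<Sum>i\<in>UNIV. \<bar>(u - u0) $ i\<bar>)" by (rule norm_le_l1_cart)
    also have "\<dots> \<le> (\<Sum>i\<in>(UNIV::'m set). s)" using that by (intro sum_mono) (auto simp: mem_cube)
    also have "\<dots> = d / 2" by (simp add: s_def)
    finally show ?thesis using d by (simp add: dist_norm)
  qed
  have inU: "cube u0 s \<subseteq> U" using near cube_near by blast
  have D_close: "norm (D u v - D u0 v) \<le> c / 2 * norm v" if u: "u \<in> cube u0 s" for u v
  proof -
    have "linear (\<lambda>v. D u v - D u0 v)"
      using C1(4) u inU u0 by (auto intro!: linear_compose_sub simp: D_def)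
    from linear_norm_le_sum[OF this, of \<epsilon> v]
    have "norm (D u v - D u0 v) \<le> ?m * \<epsilon> * norm v"
      using near[OF cube_near[OF u]] by (auto intro: less_imp_le)
    also have "?m * \<epsilon> = c / 2" by (simp add: \<epsilon>_def)
    finally show ?thesis .
  qed
  have diff: "norm ((\<phi> u - D u0 u) - (\<phi> v - D u0 v)) \<le> c / 2 * norm (u - v)"
    if u: "u \<in> cube u0 s" and v: "v \<in> cube u0 s" for u v
  proof (rule differentiable_bound[OF _ _ _ u v])
    show "convex (cube u0 s)" by (simp add: cube_def)
    fix w assume w: "w \<in> cube u0 s"
    have l0: "(D u0 has_derivative D u0) (at w within cube u0 s)"
      using C1(4)[OF u0(1)] unfolding D_def by (intro bounded_linear_imp_has_derivative) (simp add: linear_conv_bounded_linear)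
    have "(\<phi> has_derivative D w) (at w within cube u0 s)"
      unfolding D_def by (rule has_derivative_at_withinI[OF C1(2)[OF subsetD[OF inU w]]])
    from has_derivative_diff[OF this l0]
    show "((\<lambda>u. \<phi> u - D u0 u) has_derivative (\<lambda>v. D w v - D u0 v)) (at w within cube u0 s)" .
    show "onorm (\<lambda>v. D w v - D u0 v) \<le> c / 2"
      by (rule onorm_bound) (use c D_close[OF w] in auto)
  qed
  have D_lin: "D u0 u - D u0 v = D u0 (u - v)" for u v
    using C1(4)[OF u0(1)] by (simp add: D_def linear_diff)
  have upper: "norm (\<phi> u - \<phi> v) \<le> (B + c / 2) * norm (u - v)" if "u \<in> cube u0 s" "v \<in> cube u0 s" for u v
  proof -
    have "\<phi> u - \<phi> v = ((\<phi> u - D u0 u) - (\<phi> v - D u0 v)) + D u0 (u - v)" by (simp add: D_lin[symmetric])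
    then have "norm (\<phi> u - \<phi> v) \<le> c / 2 * norm (u - v) + B * norm (u - v)"
      using diff[OF that] B(2)[of "u - v"] norm_triangle_mono by metis
    then show ?thesis by (simp add: algebra_simps)
  qed
  have lower: "norm (u - v) \<le> 2 / c * norm (\<phi> u - \<phi> v)" if "u \<in> cube u0 s" "v \<in> cube u0 s" for u v
  proof -
    have "D u0 (u - v) = (\<phi> u - \<phi> v) - ((\<phi> u - D u0 u) - (\<phi> v - D u0 v))" by (simp add: D_lin[symmetric])
    then have "norm (D u0 (u - v)) \<le> norm (\<phi> u - \<phi> v) + norm ((\<phi> u - D u0 u) - (\<phi> v - D u0 v))"
      by (metis norm_triangle_ineq4)
    with diff[OF that] c(2)[of "u - v"] have "c / 2 * norm (u - v) \<le> norm (\<phi> u - \<phi> v)" by (simp add: field_simps)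
    then show ?thesis using c by (simp add: field_simps)
  qed
  have D_bound: "norm (D u (axis i 1)) \<le> B + c / 2" if "u \<in> cube u0 s" for u and i :: 'm
  proof -
    have "norm (D u (axis i 1)) \<le> norm (D u0 (axis i 1)) + norm (D u (axis i 1) - D u0 (axis i 1))"
      by (rule norm_triangle_sub)
    also have "\<dots> \<le> B * norm (axis i (1::real)) + c / 2 * norm (axis i (1::real))"
      by (intro add_mono B D_close that)
    finally show ?thesis by (simp add: norm_axis_1)
  qed
  define k where "k = max (max (B + c / 2) (2 / c)) (max (max s (1 / s)) (max (2 * g) (2 / g)))"
  have k: "B + c / 2 \<le> k" "2 / c \<le> k" "s \<le> k" "1 / s \<le> k" "2 * g \<le> k" "2 / g \<le> k" by (simp_all add: k_def)
  have k0: "0 < k" using k(3) s by linarith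
  have "good_chart k X U \<phi> u0 s"
    unfolding good_chart_def
  proof (intro conjI ballI allI)
    show "1 / k \<le> s" using k(4) k0 s by (simp add: field_simps)
    fix u assume u: "u \<in> cube u0 s"
    have "1 / k \<le> g / 2" using k(6) k0 g by (simp add: field_simps)
    then show "1 / k \<le> volume_density \<phi> u" using near[OF cube_near[OF u]] by auto
    show "volume_density \<phi> u \<le> k" using near[OF cube_near[OF u]] k(5) by auto
    show "norm (frechet_derivative \<phi> (at u) (axis i 1)) \<le> k" for i using D_bound[OF u, of i] k(1) by (simp add: D_def)
    fix v assume v: "v \<in> cube u0 s"
    show "norm (\<phi> u - \<phi> v) \<le> k * norm (u - v)"
      using upper[OF u v] mult_right_mono[OF k(1) norm_ge_zero[of "u - v"]] by linarith
    show "norm (u - v) \<le> k * norm (\<phi> u - \<phi> v)"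
      using lower[OF u v] mult_right_mono[OF k(2) norm_ge_zero[of "\<phi> u - \<phi> v"]] by linarith
  qed (use lp inU k in auto)
  then show ?thesis using k0 u0(2) by blast
qed

lemma openin_chart_image:
  assumes lp: "local_param X U \<phi>" and O: "open O'" "O' \<subseteq> U"
  shows "openin (top_of_set X) (\<phi> ` O')"
proof -
  obtain \<psi> where h: "homeomorphism U (\<phi> ` U) \<phi> \<psi>" using lp by (auto simp: local_param_def)
  have "openin (top_of_set U) O'" using O by (simp add: open_subset)
  then have "openin (top_of_set (\<phi> ` U)) (\<phi> ` O')" by (rule homeomorphism_imp_open_map[OF h])
  moreover have "openin (top_of_set X) (\<phi> ` U)" using lp by (simp add: local_param_def)
  ultimately show ?thesis by (rule openin_trans)
qed

text \<open>Compactness gives finitely many patches and a Lebesgue number \<epsilon> for them. The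
  statement is about pairs because the nonlocal energy involves two nearby points, which have to be
  compared in one chart.\<close>

lemma finite_chart_cover:
  fixes X :: "(real^'d) set"
  assumes X: "smooth_submanifold TYPE('m::finite) X" "compact X"
  shows "\<exists>k \<epsilon> (T :: ((real^'m) set \<times> (real^'m \<Rightarrow> real^'d) \<times> (real^'m) \<times> real) set).
    finite T \<and> 0 < k \<and> 0 < \<epsilon> \<and> (\<forall>(U, \<phi>, u0, s)\<in>T. good_chart k X U \<phi> u0 s) \<and>
    (\<forall>x\<in>X. \<forall>y\<in>X. dist x y < \<epsilon> \<longrightarrow> (\<exists>(U, \<phi>, u0, s)\<in>T. x \<in> \<phi> ` open_cube u0 s \<and> y \<in> \<phi> ` open_cube u0 s))"
proof -
  define G where "G = {(k, U :: (real^'m) set, \<phi> :: real^'m \<Rightarrow> real^'d, u0, s). 0 < k \<and> good_chart k X U \<phi> u0 s}"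
  define im where "im = (\<lambda>(k :: real, U :: (real^'m) set, \<phi> :: real^'m \<Rightarrow> real^'d, u0, s). \<phi> ` open_cube u0 s)"
  have op: "openin (top_of_set X) (im p)" if "p \<in> G" for p
  proof -
    obtain k U \<phi> u0 s where p: "p = (k, U, \<phi>, u0, s)" by (cases p) auto
    have lp: "local_param X U \<phi>" and "cube u0 s \<subseteq> U" using that by (auto simp: p G_def good_chart_def)
    then have "openin (top_of_set X) (\<phi> ` open_cube u0 s)"
      using open_cube_subset[of u0 s] by (intro openin_chart_image[OF lp]) (auto simp: open_cube_def)
    then show ?thesis by (simp add: p im_def)
  qed
  have cov: "\<exists>p\<in>G. x \<in> im p" if x: "x \<in> X" for x
  proof -
    obtain k U \<phi> u0 s where gc: "good_chart k X (U :: (real^'m) set) \<phi> u0 s" "0 < k" "\<phi> u0 = x"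
      using exists_good_chart[OF X(1) x] by blast
    have "0 < 1 / k" using gc(2) by simp
    also have "1 / k \<le> s" using gc(1) by (simp add: good_chart_def)
    finally have "0 < s" .
    then have "u0 \<in> open_cube u0 s" by (simp add: mem_open_cube)
    then have "x \<in> im (k, U, \<phi>, u0, s)" using gc(3) by (auto simp: im_def)
    moreover have "(k, U, \<phi>, u0, s) \<in> G" using gc by (simp add: G_def)
    ultimately show ?thesis by blast
  qed
  obtain G' where G': "G' \<subseteq> G" "finite G'" "X \<subseteq> (\<Union>p\<in>G'. im p)"
  proof -
    have "\<exists>op. \<forall>p\<in>G. open (op p) \<and> im p = X \<inter> op p"
      using op unfolding openin_open by metis
    then obtain op' where op': "\<And>p. p \<in> G \<Longrightarrow> open (op' p) \<and> im p = X \<inter> op' p" by blast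
    have "X \<subseteq> (\<Union>p\<in>G. op' p)" using cov op' by blast
    then obtain G' where "G' \<subseteq> G" "finite G'" "X \<subseteq> (\<Union>p\<in>G'. op' p)"
      using compactE_image[OF X(2), of G op'] op' by blast
    then show ?thesis using that[of G'] op' by blast
  qed
  \<comment> \<open>The inserted 1 keeps the maximum defined and positive even when there is no
    chart.\<close>
  define k where "k = Max (insert 1 (fst ` G'))"
  have k_ge: "fst p \<le> k" if "p \<in> G'" for p unfolding k_def using G'(2) that by (intro Max_ge) auto
  have "1 \<le> k" unfolding k_def using G'(2) by (intro Max_ge) auto
  obtain \<epsilon> where \<epsilon>: "0 < \<epsilon>" "\<And>x y. x \<in> X \<Longrightarrow> y \<in> X \<Longrightarrow> dist x y < \<epsilon> \<Longrightarrow> \<exists>p\<in>G'. x \<in> im p \<and> y \<in> im p"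
  proof (cases "X = {}")
    case True then show ?thesis using that[of 1] by simp
  next
    case False
    have "\<exists>op. \<forall>p\<in>G'. open (op p) \<and> im p = X \<inter> op p"
      using op G'(1) unfolding openin_open by (metis subsetD)
    then obtain op' where op': "\<And>p. p \<in> G' \<Longrightarrow> open (op' p) \<and> im p = X \<inter> op' p" by blast
    obtain \<delta> where \<delta>: "0 < \<delta>" "\<And>T. T \<subseteq> X \<Longrightarrow> diameter T < \<delta> \<Longrightarrow> \<exists>B\<in>op' ` G'. T \<subseteq> B"
    proof (rule Lebesgue_number_lemma[OF X(2), of "op' ` G'"])
      show "op' ` G' \<noteq> {}" using False G'(3) by auto
      show "X \<subseteq> \<Union> (op' ` G')" using G'(3) op' by blast
    qed (use op' in auto)
    show ?thesis
    proof (rule that[OF \<delta>(1)])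
      fix x y assume xy: "x \<in> X" "y \<in> X" "dist x y < \<delta>"
      have "diameter {x, y} \<le> dist x y" by (rule diameter_le) (auto simp: dist_norm norm_minus_commute)
      then have "\<exists>B\<in>op' ` G'. {x, y} \<subseteq> B" using xy by (intro \<delta>(2)) auto
      then show "\<exists>p\<in>G'. x \<in> im p \<and> y \<in> im p" using xy op' by fastforce
    qed
  qed
  show ?thesis
  proof (intro exI conjI)
    show "finite (snd ` G')" using G'(2) by simp
    show "0 < k" using \<open>1 \<le> k\<close> by simp
    show "0 < \<epsilon>" by fact
    show "\<forall>(U, \<phi>, u0, s)\<in>snd ` G'. good_chart k X U \<phi> u0 s"
    proof (rule ballI)
      fix q assume "q \<in> snd ` G'"
      then obtain p where "p \<in> G'" "q = snd p" by blast
      moreover obtain k' U \<phi> u0 s where "p = (k', U, \<phi>, u0, s)" by (cases p) auto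
      ultimately have p: "(k', U, \<phi>, u0, s) \<in> G'" and q: "q = (U, \<phi>, u0, s)" by simp_all
      then have "0 < k'" "good_chart k' X U \<phi> u0 s" using G'(1) by (auto simp: G_def)
      then show "case q of (U, \<phi>, u0, s) \<Rightarrow> good_chart k X U \<phi> u0 s"
        using k_ge[OF p] by (auto simp: q intro: good_chart_mono)
    qed
    show "\<forall>x\<in>X. \<forall>y\<in>X. dist x y < \<epsilon> \<longrightarrow> (\<exists>(U, \<phi>, u0, s)\<in>snd ` G'. x \<in> \<phi> ` open_cube u0 s \<and> y \<in> \<phi> ` open_cube u0 s)"
    proof (intro ballI impI)
      fix x y assume "x \<in> X" "y \<in> X" "dist x y < \<epsilon>"
      from \<epsilon>(2)[OF this] obtain p where p: "p \<in> G'" "x \<in> im p" "y \<in> im p" by blast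
      obtain k' U \<phi> u0 s where eq: "p = (k', U, \<phi>, u0, s)" by (cases p) auto
      show "\<exists>(U, \<phi>, u0, s)\<in>snd ` G'. x \<in> \<phi> ` open_cube u0 s \<and> y \<in> \<phi> ` open_cube u0 s"
      proof (rule bexI)
        show "case (U, \<phi>, u0, s) of (U, \<phi>, u0, s) \<Rightarrow> x \<in> \<phi> ` open_cube u0 s \<and> y \<in> \<phi> ` open_cube u0 s"
          using p(2,3) by (simp add: eq im_def)
        show "(U, \<phi>, u0, s) \<in> snd ` G'" using imageI[OF p(1), of snd] by (simp add: eq)
      qed
    qed
  qed
qed

lemma space_sets_volume:
  assumes "riemannian_volume TYPE('m::finite) X vol" "compact X"
  shows "space vol = X" and "sets vol = sets (restrict_space borel X)"
    and "A \<in> sets borel \<Longrightarrow> A \<subseteq> X \<Longrightarrow> A \<in> sets vol"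
proof -
  show sets: "sets vol = sets (restrict_space borel X)" using assms by (simp add: riemannian_volume_def)
  show "space vol = X" using sets_eq_imp_space_eq[OF sets] by (simp add: space_restrict_space)
  show "A \<in> sets vol" if "A \<in> sets borel" "A \<subseteq> X"
    using that compact_imp_closed[OF assms(2)] unfolding sets by (subst sets_restrict_space_iff) auto
qed

text \<open>The image is a preimage under the inverse chart, which is continuous on the Borel patch
  and becomes a total Borel map when extended by 0.\<close>

lemma chart_image_measurable:
  fixes X :: "(real^'d) set"
  assumes vol: "riemannian_volume TYPE('m::finite) X vol" and X: "compact X"
    and lp: "local_param X U \<phi>" and A: "A \<in> sets borel" "A \<subseteq> (U :: (real^'m) set)"
  shows "\<phi> ` A \<in> sets vol"
proof -
  obtain \<psi> where h: "homeomorphism U (\<phi> ` U) \<phi> \<psi>" and op: "openin (top_of_set X) (\<phi> ` U)"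
    using lp by (auto simp: local_param_def)
  have sub: "\<phi> ` U \<subseteq> X" using op openin_imp_subset by blast
  from op obtain T where T: "open T" "\<phi> ` U = X \<inter> T" by (auto simp: openin_open)
  have b: "\<phi> ` U \<in> sets borel"
    unfolding T(2) using compact_imp_closed[OF X] T(1) by (intro sets.Int) auto
  have "continuous_on (\<phi> ` U) \<psi>" using h by (simp add: homeomorphism_def)
  then have m: "(\<lambda>x. if x \<in> \<phi> ` U then \<psi> x else 0) \<in> borel_measurable borel"
    using b by (intro borel_measurable_continuous_on_if) auto
  have inv: "\<psi> (\<phi> u) = u" if "u \<in> U" for u using h that by (simp add: homeomorphism_def)
  have "\<phi> ` A = \<phi> ` U \<inter> ((\<lambda>x. if x \<in> \<phi> ` U then \<psi> x else 0) -` A \<inter> space borel)"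
    using A(2) inv by (auto simp: image_iff) (metis subsetD inv)+
  also have "\<dots> \<in> sets borel" by (rule sets.Int[OF b measurable_sets[OF m A(1)]])
  finally show ?thesis using space_sets_volume(3)[OF vol X] sub A(2) by blast
qed

lemma chart_measurable:
  fixes X :: "(real^'d) set"
  assumes vol: "riemannian_volume TYPE('m::finite) X vol" and X: "compact X" "x0 \<in> X"
    and lp: "local_param X U \<phi>" and A: "A \<in> sets borel" "A \<subseteq> (U :: (real^'m) set)"
  shows "(\<lambda>u. if u \<in> A then \<phi> u else x0) \<in> measurable borel vol"
proof -
  have "openin (top_of_set X) (\<phi> ` U)" using lp by (simp add: local_param_def)
  then have sub: "\<phi> ` U \<subseteq> X" using openin_imp_subset by blast
  have "(\<lambda>u. if u \<in> A then \<phi> u else x0) \<in> measurable borel borel"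
    using A continuous_on_subset[OF local_param_C1(6)[OF lp] A(2)]
    by (intro borel_measurable_continuous_on_if) auto
  then have "(\<lambda>u. if u \<in> A then \<phi> u else x0) \<in> measurable borel (restrict_space borel X)"
  proof (rule measurable_restrict_space2[rotated])
    have "\<phi> u \<in> X" if "u \<in> A" for u using sub A(2) that by blast
    then show "(\<lambda>u. if u \<in> A then \<phi> u else x0) \<in> space borel \<rightarrow> X" using X(2) by auto
  qed
  then show ?thesis using space_sets_volume(2)[OF vol X(1)] by (simp cong: measurable_cong_sets)
qed

text \<open>\<open>riemannian_volume\<close> prescribes only the measures of chart images. Hence the
  volume restricted to the patch is the image under the chart of Lebesgue measure on
  \<open>A\<close> with the volume density, and integrals can be pulled back.\<close>

lemma nn_integral_chart:
  fixes X :: "(real^'d) set"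
  assumes vol: "riemannian_volume TYPE('m::finite) X vol" and X: "compact X"
    and lp: "local_param X U \<phi>" and A: "A \<in> sets borel" "A \<subseteq> (U :: (real^'m) set)"
    and h[measurable]: "h \<in> borel_measurable vol"
  shows "(\<integral>\<^sup>+x. indicator (\<phi> ` A) x * h x \<partial>vol) =
    (\<integral>\<^sup>+u. indicator A u * (h (\<phi> u) * ennreal (volume_density \<phi> u)) \<partial>lborel)"
proof (cases "A = {}")
  case True then show ?thesis by simp
next
  case False
  have "openin (top_of_set X) (\<phi> ` U)" using lp by (simp add: local_param_def)
  then have sub: "\<phi> ` U \<subseteq> X" using openin_imp_subset by blast
  with False A(2) obtain x0 where x0: "x0 \<in> X" by blast
  \<comment> \<open>Outside \<open>A\<close> the chart may leave \<open>X\<close>; a fixed point of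
    \<open>X\<close> there makes it a total measurable map into \<open>vol\<close>.\<close>
  define \<phi>' where "\<phi>' u = (if u \<in> A then \<phi> u else x0)" for u
  have m[measurable]: "\<phi>' \<in> measurable borel vol"
    unfolding \<phi>'_def by (rule chart_measurable[OF vol X x0 lp A])
  have mA[measurable]: "\<phi> ` A \<in> sets vol" by (rule chart_image_measurable[OF vol X lp A])
  have [measurable]: "A \<in> sets borel" by (rule A)
  define d where "d u = indicator A u * volume_density \<phi> u" for u
  have d[measurable]: "d \<in> borel_measurable borel"
    unfolding d_def using borel_measurable_continuous_on_indicator[OF A(1) continuous_on_subset[OF local_param_C1(8)[OF lp] A(2)]]
    by simp
  let ?M = "density lborel (\<lambda>u. ennreal (d u))"
  have eq: "density vol (indicator (\<phi> ` A)) = distr ?M vol \<phi>'"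
  proof (rule measure_eqI)
    fix B assume "B \<in> sets (density vol (indicator (\<phi> ` A)))"
    then have B[measurable]: "B \<in> sets vol" by simp
    have B': "A \<inter> \<phi>' -` B \<in> sets borel" using measurable_sets[OF m B] A(1) by auto
    have im: "\<phi> ` (A \<inter> \<phi>' -` B) = \<phi> ` A \<inter> B" by (auto simp: \<phi>'_def)
    have "emeasure (density vol (indicator (\<phi> ` A))) B = (\<integral>\<^sup>+x. indicator (\<phi> ` A \<inter> B) x \<partial>vol)"
      unfolding indicator_inter_arith by (rule emeasure_density) simp_all
    also have "\<dots> = emeasure vol (\<phi> ` A \<inter> B)" by (rule nn_integral_indicator) simp
    also have "\<dots> = emeasure vol (\<phi> ` (A \<inter> \<phi>' -` B))" by (simp add: im)
    also have "\<dots> = (\<integral>\<^sup>+u\<in>A \<inter> \<phi>' -` B. ennreal (sqrt (det (metric_tensor \<phi> u))) \<partial>lborel)"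
      using vol lp B' A(2) unfolding riemannian_volume_def by blast
    also have "\<dots> = (\<integral>\<^sup>+u. ennreal (d u) * indicator (\<phi>' -` B) u \<partial>lborel)"
      by (intro nn_integral_cong) (auto simp: d_def volume_density_def indicator_def)
    also have "\<dots> = emeasure ?M (\<phi>' -` B)"
      using measurable_sets[OF m B] by (subst emeasure_density) auto
    also have "\<dots> = emeasure (distr ?M vol \<phi>') B"
      by (subst emeasure_distr) auto
    finally show "emeasure (density vol (indicator (\<phi> ` A))) B = emeasure (distr ?M vol \<phi>') B" .
  qed simp
  have "(\<integral>\<^sup>+x. indicator (\<phi> ` A) x * h x \<partial>vol) = (\<integral>\<^sup>+x. h x \<partial>density vol (indicator (\<phi> ` A)))"
    by (subst nn_integral_density) auto
  also have "\<dots> = (\<integral>\<^sup>+u. h (\<phi>' u) \<partial>?M)"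
    unfolding eq by (rule nn_integral_distr) auto
  also have "\<dots> = (\<integral>\<^sup>+u. ennreal (d u) * h (\<phi>' u) \<partial>lborel)"
    by (rule nn_integral_density) auto
  also have "\<dots> = (\<integral>\<^sup>+u. indicator A u * (h (\<phi> u) * ennreal (volume_density \<phi> u)) \<partial>lborel)"
    by (intro nn_integral_cong) (auto simp: d_def \<phi>'_def indicator_def mult.commute)
  finally show ?thesis .
qed

section \<open>Nonlocal energies on a submanifold\<close>

lemma measurable_ident_volume:
  assumes "riemannian_volume TYPE('m::finite) X vol" "compact X"
  shows "(\<lambda>x. x) \<in> borel_measurable vol"
  unfolding measurable_cong_sets[OF space_sets_volume(2)[OF assms] refl]
  by (rule measurable_restrict_space1) simp

text \<open>In coordinates this is \<open>nonlocal_energy_le\<close> with radius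
  \<open>k * r\<close>. The powers of \<open>k\<close> arise as follows: 2 from the volume densities
  of the two integrals, \<open>CARD('m) + 2\<close> from the enlarged radius, 2 from the lengths of
  the coordinate vectors and 1 from restoring the volume density under the gradient
  integral.\<close>

lemma chart_nonlocal_energy_le:
  fixes X :: "(real^'d) set" and f :: "real^'d \<Rightarrow> real" and U :: "(real^'m::finite) set"
  assumes vol: "riemannian_volume TYPE('m) X vol" and X: "compact X" and fin: "finite_measure vol"
    and gc: "good_chart k X U \<phi> u0 s" and k: "0 < k"
    and f[measurable]: "f \<in> borel_measurable vol" and G: "has_weak_gradient TYPE('m) X vol f G" and r: "0 \<le> r"
  defines "I \<equiv> \<phi> ` open_cube u0 s"
  shows "(\<integral>\<^sup>+x. \<integral>\<^sup>+y. indicator I x * (indicator I y * (indicator {z. norm z \<le> r} (x - y) * ennreal ((f x - f y)\<^sup>2))) \<partial>vol \<partial>vol) \<le>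
    ennreal (2 ^ CARD('m) * real CARD('m) * k ^ (CARD('m) + 7) * r ^ (CARD('m) + 2)) * (\<integral>\<^sup>+x. ennreal ((norm (G x))\<^sup>2) \<partial>vol)"
proof -
  interpret finite_measure vol by fact
  let ?m = "CARD('m)" and ?O = "open_cube u0 s" and ?vd = "\<lambda>u. ennreal (volume_density \<phi> u)"
  let ?H = "\<lambda>x y. indicator {z. norm z \<le> r} (x - y) * ennreal ((f x - f y)\<^sup>2)"
  have lp: "local_param X U \<phi>" and cU: "cube u0 s \<subseteq> U" using gc by (auto simp: good_chart_def)
  have oc: "u \<in> cube u0 s" if "u \<in> ?O" for u using that open_cube_subset by blast
  have O: "?O \<in> sets borel" "?O \<subseteq> U" using oc cU by (auto simp: open_cube_def)
  have [measurable]: "?O \<in> sets borel" by (rule O)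
  have [measurable]: "G \<in> borel_measurable vol" using G by (simp add: has_weak_gradient_def)
  have [measurable]: "I \<in> sets vol" unfolding I_def by (rule chart_image_measurable[OF vol X lp O])
  have [measurable]: "(\<lambda>x. x) \<in> borel_measurable vol"
    by (rule measurable_ident_volume[OF vol X])
  have vd: "1 / k \<le> volume_density \<phi> u" "volume_density \<phi> u \<le> k" if "u \<in> ?O" for u
    using gc oc[OF that] by (auto simp: good_chart_def)
  have u0: "u0 \<in> ?O"
  proof -
    have "0 < 1 / k" using k by simp
    also have "1 / k \<le> s" using gc by (simp add: good_chart_def)
    finally show ?thesis by (simp add: mem_open_cube)
  qed
  have "openin (top_of_set X) (\<phi> ` U)" using lp by (simp add: local_param_def)
  then have "\<phi> ` U \<subseteq> X" using openin_imp_subset by blast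
  then have x0: "\<phi> u0 \<in> X" using O u0 by blast
  have m_g: "(\<lambda>u. h (if u \<in> ?O then \<phi> u else \<phi> u0)) \<in> borel_measurable borel"
    if "h \<in> borel_measurable vol" for h :: "real^'d \<Rightarrow> real"
    by (rule measurable_compose[OF chart_measurable[OF vol X x0 lp O] that])
  \<comment> \<open>Only the values on the open cube matter; the constant value outside makes the
    pullback Borel on the whole space.\<close>
  define g where "g u = f (if u \<in> ?O then \<phi> u else \<phi> u0)" for u
  have [measurable]: "g \<in> borel_measurable borel" unfolding g_def by (rule m_g[OF f])
  define e where "e u v = indicator ?O u * indicator ?O v * indicator {h. norm h \<le> k * r} (v - u) * ennreal ((g v - g u)\<^sup>2)" for u v
  have [measurable]: "(\<lambda>(u, v). e u v) \<in> borel_measurable (lborel \<Otimes>\<^sub>M lborel)" unfolding e_def by measurable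
  have [measurable]: "(\<lambda>v. e u v) \<in> borel_measurable lborel" for u unfolding e_def by measurable
  have "(\<integral>\<^sup>+x. \<integral>\<^sup>+y. indicator I x * (indicator I y * ?H x y) \<partial>vol \<partial>vol) = (\<integral>\<^sup>+x. indicator I x * (\<integral>\<^sup>+y. indicator I y * ?H x y \<partial>vol) \<partial>vol)"
    by (intro nn_integral_cong nn_integral_cmult) measurable
  also have "\<dots> = (\<integral>\<^sup>+u. indicator ?O u * ((\<integral>\<^sup>+y. indicator I y * ?H (\<phi> u) y \<partial>vol) * ?vd u) \<partial>lborel)"
    unfolding I_def by (rule nn_integral_chart[OF vol X lp O]) (simp add: I_def[symmetric])
  also have "\<dots> = (\<integral>\<^sup>+u. indicator ?O u * ((\<integral>\<^sup>+v. indicator ?O v * (?H (\<phi> u) (\<phi> v) * ?vd v) \<partial>lborel) * ?vd u) \<partial>lborel)"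
  proof (rule nn_integral_cong)
    fix u
    have "(\<integral>\<^sup>+y. indicator I y * ?H (\<phi> u) y \<partial>vol) = (\<integral>\<^sup>+v. indicator ?O v * (?H (\<phi> u) (\<phi> v) * ?vd v) \<partial>lborel)"
      unfolding I_def by (rule nn_integral_chart[OF vol X lp O]) measurable
    then show "indicator ?O u * ((\<integral>\<^sup>+y. indicator I y * ?H (\<phi> u) y \<partial>vol) * ?vd u) = indicator ?O u * ((\<integral>\<^sup>+v. indicator ?O v * (?H (\<phi> u) (\<phi> v) * ?vd v) \<partial>lborel) * ?vd u)"
      by simp
  qed
  also have "\<dots> \<le> (\<integral>\<^sup>+u. ennreal k * (\<integral>\<^sup>+v. ennreal k * e u v \<partial>lborel) \<partial>lborel)"
  proof (rule nn_integral_mono)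
    fix u
    show "indicator ?O u * ((\<integral>\<^sup>+v. indicator ?O v * (?H (\<phi> u) (\<phi> v) * ?vd v) \<partial>lborel) * ?vd u) \<le> ennreal k * (\<integral>\<^sup>+v. ennreal k * e u v \<partial>lborel)"
    proof (cases "u \<in> ?O")
      case u: True
      have "(\<integral>\<^sup>+v. indicator ?O v * (?H (\<phi> u) (\<phi> v) * ?vd v) \<partial>lborel) \<le> (\<integral>\<^sup>+v. ennreal k * e u v \<partial>lborel)"
      proof (rule nn_integral_mono)
        fix v
        show "indicator ?O v * (?H (\<phi> u) (\<phi> v) * ?vd v) \<le> ennreal k * e u v"
        proof (cases "v \<in> ?O \<and> norm (\<phi> u - \<phi> v) \<le> r")
          case v: True
          have "norm (v - u) \<le> k * norm (\<phi> v - \<phi> u)"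
            using gc oc[OF u] oc[of v] v by (auto simp: good_chart_def)
          also have "\<dots> \<le> k * r" using v k by (intro mult_left_mono) (auto simp: norm_minus_commute)
          finally have "e u v = ennreal ((f (\<phi> u) - f (\<phi> v))\<^sup>2)"
            using u v by (simp add: e_def g_def power2_commute)
          moreover have "?vd v \<le> ennreal k" using vd(2)[of v] v by (intro ennreal_leI) auto
          ultimately show ?thesis
            using v by (simp add: mult.commute[of _ "?vd v"] mult_right_mono)
        qed auto
      qed
      moreover have "?vd u \<le> ennreal k" using vd(2)[OF u] by (intro ennreal_leI)
      ultimately have "(\<integral>\<^sup>+v. indicator ?O v * (?H (\<phi> u) (\<phi> v) * ?vd v) \<partial>lborel) * ?vd u \<le> (\<integral>\<^sup>+v. ennreal k * e u v \<partial>lborel) * ennreal k"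
        by (intro mult_mono) auto
      then show ?thesis using u by (simp add: mult.commute)
    qed simp
  qed
  also have "\<dots> = ennreal (k\<^sup>2) * (\<integral>\<^sup>+u. \<integral>\<^sup>+v. e u v \<partial>lborel \<partial>lborel)"
    using k by (simp add: nn_integral_cmult power2_eq_square ennreal_mult mult.assoc)
  also have "(\<integral>\<^sup>+u. \<integral>\<^sup>+v. e u v \<partial>lborel \<partial>lborel) = (\<integral>\<^sup>+u. \<integral>\<^sup>+v. indicator ?O u * indicator ?O v * indicator {h. norm h \<le> k * r} (v - u) * ennreal ((f (\<phi> v) - f (\<phi> u))\<^sup>2) \<partial>lborel \<partial>lborel)"
    by (intro nn_integral_cong) (auto simp: e_def g_def indicator_def)
  also have "\<dots> \<le> ennreal ((2 * (k * r)) ^ ?m * (k * r)\<^sup>2) * (\<integral>\<^sup>+u. indicator ?O u * ennreal (\<Sum>i\<in>UNIV. (G (\<phi> u) \<bullet> frechet_derivative \<phi> (at u) (axis i 1))\<^sup>2) \<partial>lborel)"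
    unfolding open_cube_def
  proof (rule nonlocal_energy_le)
    show "cbox (u0 - s *\<^sub>R 1) (u0 + s *\<^sub>R 1) \<subseteq> U" using cU by (simp add: cube_def)
    show "has_weak_partial U i (\<lambda>u. f (\<phi> u)) (\<lambda>u. G (\<phi> u) \<bullet> frechet_derivative \<phi> (at u) (axis i 1))" for i
      using G lp by (simp add: has_weak_gradient_def)
    show "0 \<le> k * r" using k r by simp
  qed
  also have "(\<integral>\<^sup>+u. indicator ?O u * ennreal (\<Sum>i\<in>UNIV. (G (\<phi> u) \<bullet> frechet_derivative \<phi> (at u) (axis i 1))\<^sup>2) \<partial>lborel) \<le>
      (\<integral>\<^sup>+u. ennreal (real ?m * k ^ 3) * (indicator ?O u * (ennreal ((norm (G (if u \<in> ?O then \<phi> u else \<phi> u0)))\<^sup>2) * ennreal (indicator ?O u * volume_density \<phi> u))) \<partial>lborel)"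
  proof (rule nn_integral_mono)
    fix u
    show "indicator ?O u * ennreal (\<Sum>i\<in>UNIV. (G (\<phi> u) \<bullet> frechet_derivative \<phi> (at u) (axis i 1))\<^sup>2) \<le>
      ennreal (real ?m * k ^ 3) * (indicator ?O u * (ennreal ((norm (G (if u \<in> ?O then \<phi> u else \<phi> u0)))\<^sup>2) * ennreal (indicator ?O u * volume_density \<phi> u)))"
    proof (cases "u \<in> ?O")
      case True
      have "(\<Sum>i\<in>UNIV. (G (\<phi> u) \<bullet> frechet_derivative \<phi> (at u) (axis i 1))\<^sup>2) \<le> (\<Sum>i\<in>(UNIV :: 'm set). (norm (G (\<phi> u)))\<^sup>2 * k\<^sup>2)"
      proof (rule sum_mono)
        fix i :: 'm
        have "\<bar>G (\<phi> u) \<bullet> frechet_derivative \<phi> (at u) (axis i 1)\<bar> \<le> norm (G (\<phi> u)) * norm (frechet_derivative \<phi> (at u) (axis i 1))"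
          by (rule Cauchy_Schwarz_ineq2)
        also have "\<dots> \<le> norm (G (\<phi> u)) * k"
          using gc oc[OF True] by (intro mult_left_mono) (auto simp: good_chart_def)
        finally have "\<bar>G (\<phi> u) \<bullet> frechet_derivative \<phi> (at u) (axis i 1)\<bar>\<^sup>2 \<le> (norm (G (\<phi> u)) * k)\<^sup>2"
          by (intro power_mono) auto
        then show "(G (\<phi> u) \<bullet> frechet_derivative \<phi> (at u) (axis i 1))\<^sup>2 \<le> (norm (G (\<phi> u)))\<^sup>2 * k\<^sup>2"
          by (simp add: power_mult_distrib)
      qed
      also have "\<dots> = real ?m * k\<^sup>2 * (norm (G (\<phi> u)))\<^sup>2" by simp
      also have "\<dots> \<le> real ?m * k\<^sup>2 * (norm (G (\<phi> u)))\<^sup>2 * (k * volume_density \<phi> u)"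
      proof (rule mult_le_cancel_left1[THEN iffD2])
        have "1 \<le> k * volume_density \<phi> u" using vd(1)[OF True] k by (simp add: field_simps)
        then show "(0 < real ?m * k\<^sup>2 * (norm (G (\<phi> u)))\<^sup>2 \<longrightarrow> 1 \<le> k * volume_density \<phi> u) \<and> (real ?m * k\<^sup>2 * (norm (G (\<phi> u)))\<^sup>2 < 0 \<longrightarrow> k * volume_density \<phi> u \<le> 1)"
          by (auto simp: not_less[symmetric] mult_less_0_iff)
      qed
      also have "\<dots> = (real ?m * k ^ 3) * ((norm (G (\<phi> u)))\<^sup>2 * volume_density \<phi> u)"
        by (simp add: power2_eq_square power3_eq_cube)
      finally have *: "ennreal (\<Sum>i\<in>UNIV. (G (\<phi> u) \<bullet> frechet_derivative \<phi> (at u) (axis i 1))\<^sup>2) \<le> ennreal ((real ?m * k ^ 3) * ((norm (G (\<phi> u)))\<^sup>2 * volume_density \<phi> u))"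
        by (rule ennreal_leI)
      have "0 < 1 / k" using k by simp
      then have "0 \<le> volume_density \<phi> u" using vd(1)[OF True] by linarith
      with * show ?thesis using True k by (simp add: ennreal_mult)
    qed simp
  qed
  also have "\<dots> = ennreal (real ?m * k ^ 3) * (\<integral>\<^sup>+u. indicator ?O u * (ennreal ((norm (G (if u \<in> ?O then \<phi> u else \<phi> u0)))\<^sup>2) * ennreal (indicator ?O u * volume_density \<phi> u)) \<partial>lborel)"
  proof (rule nn_integral_cmult)
    have [measurable]: "(\<lambda>u. (norm (G (if u \<in> ?O then \<phi> u else \<phi> u0)))\<^sup>2) \<in> borel_measurable borel"
      by (rule m_g) measurable
    have [measurable]: "(\<lambda>u. indicator ?O u * volume_density \<phi> u) \<in> borel_measurable borel"
      using borel_measurable_continuous_on_indicator[OF O(1) continuous_on_subset[OF local_param_C1(8)[OF lp] O(2)]] by simp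
    show "(\<lambda>u. indicator ?O u * (ennreal ((norm (G (if u \<in> ?O then \<phi> u else \<phi> u0)))\<^sup>2) * ennreal (indicator ?O u * volume_density \<phi> u))) \<in> borel_measurable lborel"
      by measurable
  qed
  also have "(\<integral>\<^sup>+u. indicator ?O u * (ennreal ((norm (G (if u \<in> ?O then \<phi> u else \<phi> u0)))\<^sup>2) * ennreal (indicator ?O u * volume_density \<phi> u)) \<partial>lborel)
      = (\<integral>\<^sup>+u. indicator ?O u * (ennreal ((norm (G (\<phi> u)))\<^sup>2) * ?vd u) \<partial>lborel)"
    by (intro nn_integral_cong) (auto simp: indicator_def)
  also have "\<dots> = (\<integral>\<^sup>+x. indicator I x * ennreal ((norm (G x))\<^sup>2) \<partial>vol)"
    unfolding I_def by (rule nn_integral_chart[OF vol X lp O, symmetric]) measurable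
  also have "\<dots> \<le> (\<integral>\<^sup>+x. ennreal ((norm (G x))\<^sup>2) \<partial>vol)"
    by (intro nn_integral_mono) (auto simp: indicator_def)
  finally have "(\<integral>\<^sup>+x. \<integral>\<^sup>+y. indicator I x * (indicator I y * ?H x y) \<partial>vol \<partial>vol) \<le>
      ennreal (k\<^sup>2) * (ennreal ((2 * (k * r)) ^ ?m * (k * r)\<^sup>2) * (ennreal (real ?m * k ^ 3) * (\<integral>\<^sup>+x. ennreal ((norm (G x))\<^sup>2) \<partial>vol)))"
    by (simp add: mult_left_mono)
  also have "\<dots> = ennreal (k\<^sup>2 * ((2 * (k * r)) ^ ?m * (k * r)\<^sup>2) * (real ?m * k ^ 3)) * (\<integral>\<^sup>+x. ennreal ((norm (G x))\<^sup>2) \<partial>vol)"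
    using k r by (simp add: ennreal_mult mult.assoc)
  also have "k\<^sup>2 * ((2 * (k * r)) ^ ?m * (k * r)\<^sup>2) * (real ?m * k ^ 3) = 2 ^ ?m * real ?m * k ^ (?m + 7) * r ^ (?m + 2)"
    by (simp add: power_mult_distrib power_add power2_eq_square power3_eq_cube eval_nat_numeral)
  finally show ?thesis .
qed

text \<open>Below the Lebesgue number every pair at distance at most \<open>r\<close> lies in a
  common patch, so the integrand is at most the sum of its restrictions to the patches.\<close>

lemma manifold_nonlocal_energy_le:
  fixes X :: "(real^'d) set"
  assumes man: "smooth_submanifold TYPE('m::finite) X" and X: "compact X"
    and vol: "riemannian_volume TYPE('m) X vol" and fin: "finite_measure vol"
  shows "\<exists>C \<epsilon>. 0 < C \<and> 0 < \<epsilon> \<and> (\<forall>f G r. f \<in> borel_measurable vol \<longrightarrow> has_weak_gradient TYPE('m) X vol f G \<longrightarrow> 0 \<le> r \<longrightarrow> r < \<epsilon> \<longrightarrow>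
    (\<integral>\<^sup>+x. \<integral>\<^sup>+y. indicator {z. norm z \<le> r} (x - y) * ennreal ((f x - f y)\<^sup>2) \<partial>vol \<partial>vol) \<le>
    ennreal (C * r ^ (CARD('m) + 2)) * (\<integral>\<^sup>+x. ennreal ((norm (G x))\<^sup>2) \<partial>vol))"
proof -
  interpret finite_measure vol by fact
  obtain k \<epsilon> and T :: "((real^'m) set \<times> (real^'m \<Rightarrow> real^'d) \<times> (real^'m) \<times> real) set"
    where T: "finite T" and k: "0 < k" and \<epsilon>: "0 < \<epsilon>"
      and good': "\<forall>(U, \<phi>, u0, s)\<in>T. good_chart k X U \<phi> u0 s"
      and leb: "\<forall>x\<in>X. \<forall>y\<in>X. dist x y < \<epsilon> \<longrightarrow> (\<exists>(U, \<phi>, u0, s)\<in>T. x \<in> \<phi> ` open_cube u0 s \<and> y \<in> \<phi> ` open_cube u0 s)"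
    using finite_chart_cover[OF man X] by (elim exE conjE) (rule that; assumption)
  have good: "good_chart k X U \<phi> u0 s" if "(U, \<phi>, u0, s) \<in> T" for U \<phi> u0 s
    using bspec[OF good' that] by simp
  define I where "I = (\<lambda>(U :: (real^'m) set, \<phi> :: real^'m \<Rightarrow> real^'d, u0, s). \<phi> ` open_cube u0 s)"
  define c where "c = 2 ^ CARD('m) * real CARD('m) * k ^ (CARD('m) + 7)"
  have c: "0 < c" using k by (simp add: c_def)
  have I: "I t \<in> sets vol" if "t \<in> T" for t
  proof -
    obtain U \<phi> u0 s where t: "t = (U, \<phi>, u0, s)" by (cases t) auto
    have lp: "local_param X U \<phi>" and "cube u0 s \<subseteq> U" using good that by (auto simp: t good_chart_def)
    then have "\<phi> ` open_cube u0 s \<in> sets vol"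
      using open_cube_subset[of u0 s] by (intro chart_image_measurable[OF vol X lp]) (auto simp: open_cube_def)
    then show ?thesis by (simp add: t I_def)
  qed
  have main: "(\<integral>\<^sup>+x. \<integral>\<^sup>+y. indicator {z. norm z \<le> r} (x - y) * ennreal ((f x - f y)\<^sup>2) \<partial>vol \<partial>vol) \<le>
    ennreal ((real (card T) * c + 1) * r ^ (CARD('m) + 2)) * (\<integral>\<^sup>+x. ennreal ((norm (G x))\<^sup>2) \<partial>vol)"
    if f[measurable]: "f \<in> borel_measurable vol" and G: "has_weak_gradient TYPE('m) X vol f G" and r: "0 \<le> r" "r < \<epsilon>" for f G r
  proof -
    have [measurable]: "(\<lambda>x. x) \<in> borel_measurable vol"
      by (rule measurable_ident_volume[OF vol X])
    let ?H = "\<lambda>x y. indicator {z. norm z \<le> r} (x - y) * ennreal ((f x - f y)\<^sup>2)"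
    let ?E = "\<integral>\<^sup>+x. ennreal ((norm (G x))\<^sup>2) \<partial>vol"
    have "(\<integral>\<^sup>+x. \<integral>\<^sup>+y. ?H x y \<partial>vol \<partial>vol) \<le> (\<integral>\<^sup>+x. \<integral>\<^sup>+y. (\<Sum>t\<in>T. indicator (I t) x * (indicator (I t) y * ?H x y)) \<partial>vol \<partial>vol)"
    proof (intro nn_integral_mono)
      fix x y assume "x \<in> space vol" "y \<in> space vol"
      then have xy: "x \<in> X" "y \<in> X" using space_sets_volume(1)[OF vol X] by auto
      show "?H x y \<le> (\<Sum>t\<in>T. indicator (I t) x * (indicator (I t) y * ?H x y))"
      proof (cases "norm (x - y) \<le> r")
        case True
        then obtain t where t: "t \<in> T" "x \<in> I t" "y \<in> I t"
        proof -
          have "dist x y < \<epsilon>" using True r(2) by (simp add: dist_norm)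
          then obtain t where "t \<in> T" "case t of (U, \<phi>, u0, s) \<Rightarrow> x \<in> \<phi> ` open_cube u0 s \<and> y \<in> \<phi> ` open_cube u0 s"
            using leb xy by blast
          then show ?thesis using that by (cases t) (auto simp: I_def)
        qed
        have "?H x y = indicator (I t) x * (indicator (I t) y * ?H x y)" using t by simp
        also have "\<dots> \<le> (\<Sum>t\<in>T. indicator (I t) x * (indicator (I t) y * ?H x y))"
          by (rule member_le_sum[OF t(1) _ T]) simp
        finally show ?thesis .
      qed simp
    qed
    also have "\<dots> = (\<Sum>t\<in>T. \<integral>\<^sup>+x. \<integral>\<^sup>+y. indicator (I t) x * (indicator (I t) y * ?H x y) \<partial>vol \<partial>vol)"
    proof -
      have "(\<integral>\<^sup>+y. (\<Sum>t\<in>T. indicator (I t) x * (indicator (I t) y * ?H x y)) \<partial>vol) = (\<Sum>t\<in>T. \<integral>\<^sup>+y. indicator (I t) x * (indicator (I t) y * ?H x y) \<partial>vol)" for x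
      proof (rule nn_integral_sum)
        fix t assume "t \<in> T"
        from I[OF this] show "(\<lambda>y. indicator (I t) x * (indicator (I t) y * ?H x y)) \<in> borel_measurable vol"
          by measurable
      qed
      moreover have "(\<integral>\<^sup>+x. (\<Sum>t\<in>T. \<integral>\<^sup>+y. indicator (I t) x * (indicator (I t) y * ?H x y) \<partial>vol) \<partial>vol) = (\<Sum>t\<in>T. \<integral>\<^sup>+x. \<integral>\<^sup>+y. indicator (I t) x * (indicator (I t) y * ?H x y) \<partial>vol \<partial>vol)"
      proof (rule nn_integral_sum)
        fix t assume "t \<in> T"
        from I[OF this] show "(\<lambda>x. \<integral>\<^sup>+y. indicator (I t) x * (indicator (I t) y * ?H x y) \<partial>vol) \<in> borel_measurable vol"
          by measurable
      qed
      ultimately show ?thesis by simp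
    qed
    also have "\<dots> \<le> (\<Sum>t\<in>T. ennreal (c * r ^ (CARD('m) + 2)) * ?E)"
    proof (rule sum_mono)
      fix t assume tT: "t \<in> T"
      obtain U \<phi> u0 s where t: "t = (U, \<phi>, u0, s)" by (cases t) auto
      show "(\<integral>\<^sup>+x. \<integral>\<^sup>+y. indicator (I t) x * (indicator (I t) y * ?H x y) \<partial>vol \<partial>vol) \<le> ennreal (c * r ^ (CARD('m) + 2)) * ?E"
        using chart_nonlocal_energy_le[OF vol X fin good[OF tT[unfolded t]] k f G r(1)] by (simp add: t I_def c_def)
    qed
    also have "\<dots> = ennreal (real (card T) * (c * r ^ (CARD('m) + 2))) * ?E"
      using c r by (simp add: ennreal_mult ennreal_of_nat_eq_real_of_nat mult.assoc)
    also have "\<dots> \<le> ennreal ((real (card T) * c + 1) * r ^ (CARD('m) + 2)) * ?E"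
      using r by (intro mult_right_mono ennreal_leI) (auto simp: algebra_simps)
    finally show ?thesis .
  qed
  \<comment> \<open>The summand 1 keeps the constant positive for an empty family of charts.\<close>
  have pos: "0 < real (card T) * c + 1" using c by (simp add: add_nonneg_pos)
  show ?thesis
    by (intro exI conjI allI impI) (rule pos, rule \<epsilon>, rule main)
qed

text \<open>The norm is built from a gradient chosen by \<open>SOME\<close>; since membership
  guarantees existence, that choice is itself a weak gradient, and its L2 norm is at most the full
  norm.\<close>

lemma H1_ball_gradient:
  assumes "f \<in> H1_ball m X vol M"
  obtains G where "f \<in> borel_measurable vol" "has_weak_gradient m X vol f G"
    "(\<integral>\<^sup>+x. ennreal ((norm (G x))\<^sup>2) \<partial>vol) \<le> ennreal (M\<^sup>2)"
proof -
  have f: "L2_fun vol f" "\<exists>G. has_weak_gradient m X vol f G \<and> L2_fun vol G" and M: "(H1_norm m X vol f)\<^sup>2 \<le> M\<^sup>2"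
    using assms by (auto simp: H1_ball_def H1_space_def)
  define G where "G = weak_gradient m X vol f"
  have G: "has_weak_gradient m X vol f G" "L2_fun vol G"
    using someI_ex[OF f(2)] by (auto simp: G_def weak_gradient_def)
  let ?I = "LINT x|vol. (norm (G x))\<^sup>2"
  have nn: "0 \<le> ?I" by (rule integral_nonneg_AE) simp
  have "?I = (H1_seminorm m X vol f)\<^sup>2"
    using nn by (simp add: H1_seminorm_def L2_norm_on_def G_def)
  also have "\<dots> \<le> (H1_norm m X vol f)\<^sup>2"
    by (intro power_mono) (auto simp: H1_norm_def H1_seminorm_def L2_norm_on_def)
  finally have "?I \<le> M\<^sup>2" using M by simp
  moreover have "(\<integral>\<^sup>+x. ennreal ((norm (G x))\<^sup>2) \<partial>vol) = ennreal ?I"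
    using G(2) by (intro nn_integral_eq_integral) (auto simp: L2_fun_def)
  ultimately show ?thesis using that[of G] f(1) G(1) by (auto simp: L2_fun_def intro: ennreal_leI)
qed

section \<open>The regression sample\<close>

interpretation std_normal: prob_space std_normal_distribution
  by (rule prob_space_normal_density) simp

interpretation std_normal_product: product_sigma_finite "\<lambda>_ :: nat. std_normal_distribution"
  by unfold_locales

lemma nn_integral_std_normal_affine:
  "(\<integral>\<^sup>+y. ennreal ((b + a * y)\<^sup>2) \<partial>std_normal_distribution) = ennreal (b\<^sup>2 + a\<^sup>2)"
proof -
  have i: "integrable std_normal_distribution (\<lambda>x. x)" "integrable std_normal_distribution (\<lambda>x. x\<^sup>2)"
    using integrable_std_normal_distribution_moment[of 1] integrable_std_normal_distribution_moment[of 2] by simp_all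
  have m: "(LINT x|std_normal_distribution. x) = 0" "(LINT x|std_normal_distribution. x\<^sup>2) = 1"
    using integral_std_normal_distribution_moment_odd[of 1] std_normal_distribution_even_moments(1)[of 1]
    by (simp_all add: numeral_2_eq_2)
  have eq: "(b + a * y)\<^sup>2 = b\<^sup>2 + 2 * a * b * y + a\<^sup>2 * y\<^sup>2" for y
    by (simp add: power2_eq_square algebra_simps)
  have int: "integrable std_normal_distribution (\<lambda>y. b\<^sup>2 + 2 * a * b * y + a\<^sup>2 * y\<^sup>2)" using i by simp
  have "(LINT y|std_normal_distribution. b\<^sup>2 + 2 * a * b * y + a\<^sup>2 * y\<^sup>2) = b\<^sup>2 + a\<^sup>2"
    using i m std_normal.prob_space by simp
  moreover have "(\<integral>\<^sup>+y. ennreal ((b + a * y)\<^sup>2) \<partial>std_normal_distribution) = ennreal (LINT y|std_normal_distribution. b\<^sup>2 + 2 * a * b * y + a\<^sup>2 * y\<^sup>2)"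
    unfolding eq[symmetric] using int[folded eq] by (intro nn_integral_eq_integral) auto
  ultimately show ?thesis by simp
qed

text \<open>One coordinate is integrated at a time with the others fixed. Its mean is 0, so
  \<open>nn_integral_std_normal_affine\<close> adds only the squared coefficient and no covariances
  have to be handled.\<close>

lemma nn_integral_std_normal_linear:
  assumes "finite J"
  shows "(\<integral>\<^sup>+e. ennreal ((\<Sum>j\<in>J. a j * e j)\<^sup>2) \<partial>PiM J (\<lambda>_ :: nat. std_normal_distribution)) = ennreal (\<Sum>j\<in>J. (a j)\<^sup>2)"
  using assms
proof (induction J rule: finite_induct)
  case empty
  then show ?case by (simp add: PiM_empty)
next
  case (insert k J)
  interpret J: prob_space "PiM J (\<lambda>_ :: nat. std_normal_distribution)"
    by (rule prob_space_PiM) (rule std_normal.prob_space_axioms)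
  have m: "(\<lambda>e. ennreal ((\<Sum>j\<in>insert k J. a j * e j)\<^sup>2)) \<in> borel_measurable (PiM (insert k J) (\<lambda>_ :: nat. std_normal_distribution))"
    by measurable
  have mJ: "(\<lambda>e. ennreal ((\<Sum>j\<in>J. a j * e j)\<^sup>2)) \<in> borel_measurable (PiM J (\<lambda>_ :: nat. std_normal_distribution))"
    by measurable
  have "(\<integral>\<^sup>+e. ennreal ((\<Sum>j\<in>insert k J. a j * e j)\<^sup>2) \<partial>PiM (insert k J) (\<lambda>_ :: nat. std_normal_distribution))
    = (\<integral>\<^sup>+e. (\<integral>\<^sup>+y. ennreal ((\<Sum>j\<in>insert k J. a j * (e(k := y)) j)\<^sup>2) \<partial>std_normal_distribution) \<partial>PiM J (\<lambda>_. std_normal_distribution))"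
    by (rule std_normal_product.product_nn_integral_insert[OF insert.hyps m])
  also have "\<dots> = (\<integral>\<^sup>+e. (\<integral>\<^sup>+y. ennreal (((\<Sum>j\<in>J. a j * e j) + a k * y)\<^sup>2) \<partial>std_normal_distribution) \<partial>PiM J (\<lambda>_. std_normal_distribution))"
  proof -
    have "(\<Sum>j\<in>insert k J. a j * (e(k := y)) j) = (\<Sum>j\<in>J. a j * e j) + a k * y" for e y
    proof -
      have "(\<Sum>j\<in>J. a j * (e(k := y)) j) = (\<Sum>j\<in>J. a j * e j)"
        using insert.hyps by (intro sum.cong) auto
      then show ?thesis using insert.hyps by (simp del: fun_upd_apply) simp
    qed
    then show ?thesis by simp
  qed
  also have "\<dots> = (\<integral>\<^sup>+e. ennreal ((\<Sum>j\<in>J. a j * e j)\<^sup>2) + ennreal ((a k)\<^sup>2) \<partial>PiM J (\<lambda>_. std_normal_distribution))"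
    by (simp add: nn_integral_std_normal_affine)
  also have "\<dots> = ennreal (\<Sum>j\<in>J. (a j)\<^sup>2) + ennreal ((a k)\<^sup>2)"
    using mJ by (subst nn_integral_add) (simp_all add: insert.IH J.emeasure_space_1)
  also have "\<dots> = ennreal (\<Sum>j\<in>insert k J. (a j)\<^sup>2)"
    using insert.hyps by (simp add: sum_nonneg add.commute flip: ennreal_plus)
  finally show ?case .
qed

abbreviation noise :: "nat \<Rightarrow> (nat \<Rightarrow> real) measure" where
  "noise n \<equiv> PiM {..<n} (\<lambda>_. std_normal_distribution)"

abbreviation design_law :: "nat \<Rightarrow> 'a measure \<Rightarrow> (nat \<Rightarrow> 'a) measure" where
  "design_law n P \<equiv> PiM {..<n} (\<lambda>_. P)"

lemma prob_space_noise: "prob_space (noise n)"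
  by (rule prob_space_PiM) (rule std_normal.prob_space_axioms)

text \<open>The sample as a function of independent design and noise. This turns conditioning on the
  design into Fubini's theorem.\<close>

definition observe :: "nat \<Rightarrow> ('a \<Rightarrow> real) \<Rightarrow> (nat \<Rightarrow> 'a) \<times> (nat \<Rightarrow> real) \<Rightarrow> nat \<Rightarrow> 'a \<times> real" where
  "observe n f0 = (\<lambda>(x, e). \<lambda>i\<in>{..<n}. (x i, f0 (x i) + e i))"

lemma observe_measurable:
  assumes [measurable]: "f0 \<in> borel_measurable P"
  shows "observe n f0 \<in> measurable (design_law n P \<Otimes>\<^sub>M noise n) (PiM {..<n} (\<lambda>_. P \<Otimes>\<^sub>M borel))"
  unfolding observe_def split_beta'
proof (rule measurable_restrict)
  fix i assume i: "i \<in> {..<n}"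
  have [measurable]: "(\<lambda>p. fst p i) \<in> measurable (design_law n P \<Otimes>\<^sub>M noise n) P"
    using measurable_compose[OF measurable_fst measurable_component_singleton[OF i]] .
  have [measurable]: "(\<lambda>p. snd p i) \<in> borel_measurable (design_law n P \<Otimes>\<^sub>M noise n)"
  proof (rule measurable_compose[OF measurable_snd])
    show "(\<lambda>e. e i) \<in> borel_measurable (noise n)"
      using measurable_component_singleton[OF i, of "\<lambda>_. std_normal_distribution"] by simp
  qed
  show "(\<lambda>p. (fst p i, f0 (fst p i) + snd p i)) \<in> measurable (design_law n P \<Otimes>\<^sub>M noise n) (P \<Otimes>\<^sub>M borel)"
    by measurable
qed

text \<open>A product measure is determined by its values on rectangles, and there the indicator of
  the observed sample factors over the coordinates.\<close>

lemma regression_sample_eq: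
  fixes P :: "(real^'d) measure"
  assumes P: "prob_space P" and f0[measurable]: "f0 \<in> borel_measurable P"
  shows "regression_sample n P f0 =
    distr (design_law n P \<Otimes>\<^sub>M noise n) (PiM {..<n} (\<lambda>_. P \<Otimes>\<^sub>M borel)) (observe n f0)"
proof -
  interpret P: prob_space P by fact
  interpret PX: product_sigma_finite "\<lambda>_ :: nat. P" by unfold_locales
  interpret D: prob_space "design_law n P" by (rule prob_space_PiM) (rule P)
  interpret N: prob_space "noise n" by (rule prob_space_noise)
  let ?h = "\<lambda>(x, e). (x, f0 x + e)"
  have h: "?h \<in> measurable (P \<Otimes>\<^sub>M std_normal_distribution) (P \<Otimes>\<^sub>M borel)" by measurable
  interpret PN: pair_prob_space P std_normal_distribution by unfold_locales
  have law: "prob_space (regression_law P f0)"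
    unfolding regression_law_def by (rule PN.prob_space_distr[OF h])
  interpret law: prob_space "regression_law P f0" by (rule law)
  interpret law: product_sigma_finite "\<lambda>_ :: nat. regression_law P f0" by unfold_locales
  have sets_law: "sets (regression_law P f0) = sets (P \<Otimes>\<^sub>M borel)" by (simp add: regression_law_def)
  have sets_eq: "sets (PiM {..<n} (\<lambda>_. P \<Otimes>\<^sub>M borel)) = sets (PiM {..<n} (\<lambda>_. regression_law P f0))"
    by (rule sets_PiM_cong) (simp_all add: sets_law)
  show ?thesis
    unfolding regression_sample_def
  proof (rule law.PiM_eqI[symmetric])
    show "sets (distr (design_law n P \<Otimes>\<^sub>M noise n) (PiM {..<n} (\<lambda>_. P \<Otimes>\<^sub>M borel)) (observe n f0)) = sets (PiM {..<n} (\<lambda>_. regression_law P f0))"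
      using sets_eq by simp
    fix A assume A': "\<And>i. i \<in> {..<n} \<Longrightarrow> A i \<in> sets (regression_law P f0)"
    have A[measurable]: "A i \<in> sets (P \<Otimes>\<^sub>M borel)" if "i < n" for i using A'[of i] that by (simp add: sets_law)
    let ?I = "\<lambda>i x e. indicator (A i) (x, f0 x + e) :: ennreal"
    have mI: "(\<lambda>e. ?I i x e) \<in> borel_measurable std_normal_distribution" if "i < n" "x \<in> space P" for i x
      using that A[OF that(1)] by measurable
    have mI': "(\<lambda>(x, e). ?I i x e) \<in> borel_measurable (P \<Otimes>\<^sub>M std_normal_distribution)" if "i < n" for i
      using A[OF that] by measurable
    have PiE: "PiE {..<n} A \<in> sets (PiM {..<n} (\<lambda>_. P \<Otimes>\<^sub>M borel))"
      by (rule sets_PiM_I_finite) (use A in auto)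
    have "emeasure (distr (design_law n P \<Otimes>\<^sub>M noise n) (PiM {..<n} (\<lambda>_. P \<Otimes>\<^sub>M borel)) (observe n f0)) (PiE {..<n} A)
      = (\<integral>\<^sup>+z. indicator (PiE {..<n} A) z \<partial>distr (design_law n P \<Otimes>\<^sub>M noise n) (PiM {..<n} (\<lambda>_. P \<Otimes>\<^sub>M borel)) (observe n f0))"
      using PiE by (subst nn_integral_indicator) auto
    also have "\<dots> = (\<integral>\<^sup>+p. indicator (PiE {..<n} A) (observe n f0 p) \<partial>(design_law n P \<Otimes>\<^sub>M noise n))"
      using PiE by (intro nn_integral_distr observe_measurable) auto
    also have "\<dots> = (\<integral>\<^sup>+x. \<integral>\<^sup>+e. indicator (PiE {..<n} A) (observe n f0 (x, e)) \<partial>noise n \<partial>design_law n P)"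
      by (rule N.nn_integral_fst[symmetric])
        (rule measurable_compose[OF observe_measurable[OF f0] borel_measurable_indicator[OF PiE]])
    also have "\<dots> = (\<integral>\<^sup>+x. \<integral>\<^sup>+e. (\<Prod>i<n. ?I i (x i) (e i)) \<partial>noise n \<partial>design_law n P)"
    proof (intro nn_integral_cong)
      fix x e
      show "indicator (PiE {..<n} A) (observe n f0 (x, e)) = (\<Prod>i<n. ?I i (x i) (e i))"
      proof (cases "\<forall>i<n. (x i, f0 (x i) + e i) \<in> A i")
        case True
        then have "observe n f0 (x, e) \<in> PiE {..<n} A" by (auto simp: observe_def)
        then show ?thesis using True by simp
      next
        case False
        then obtain i where i: "i < n" "(x i, f0 (x i) + e i) \<notin> A i" by blast
        then have "observe n f0 (x, e) \<notin> PiE {..<n} A" by (auto simp: observe_def PiE_iff)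
        moreover have "(\<Prod>i<n. ?I i (x i) (e i)) = 0" using i by (intro prod_zero bexI[of _ i]) simp_all
        ultimately show ?thesis by simp
      qed
    qed
    also have "\<dots> = (\<integral>\<^sup>+x. (\<Prod>i<n. \<integral>\<^sup>+e. ?I i (x i) e \<partial>std_normal_distribution) \<partial>design_law n P)"
      by (intro nn_integral_cong std_normal_product.product_nn_integral_prod)
        (auto intro!: mI simp: space_PiM PiE_iff)
    also have "\<dots> = (\<Prod>i<n. \<integral>\<^sup>+x. \<integral>\<^sup>+e. ?I i x e \<partial>std_normal_distribution \<partial>P)"
    proof (rule PX.product_nn_integral_prod)
      fix i assume "i \<in> {..<n}"
      then show "(\<lambda>x. \<integral>\<^sup>+e. ?I i x e \<partial>std_normal_distribution) \<in> borel_measurable P"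
        using std_normal.borel_measurable_nn_integral_fst[OF mI'[of i]] by simp
    qed simp
    also have "\<dots> = (\<Prod>i<n. emeasure (regression_law P f0) (A i))"
    proof (rule prod.cong[OF refl])
      fix i assume "i \<in> {..<n}"
      then have i: "i < n" by simp
      have "emeasure (regression_law P f0) (A i) = (\<integral>\<^sup>+z. indicator (A i) z \<partial>regression_law P f0)"
        using A[OF i] by (subst nn_integral_indicator) (auto simp: sets_law)
      also have "\<dots> = (\<integral>\<^sup>+p. indicator (A i) (?h p) \<partial>(P \<Otimes>\<^sub>M std_normal_distribution))"
        unfolding regression_law_def using A[OF i] by (intro nn_integral_distr h) auto
      also have "\<dots> = (\<integral>\<^sup>+p. (case p of (x, e) \<Rightarrow> ?I i x e) \<partial>(P \<Otimes>\<^sub>M std_normal_distribution))"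
        by (intro nn_integral_cong) (simp add: split_beta)
      also have "\<dots> = (\<integral>\<^sup>+x. \<integral>\<^sup>+e. ?I i x e \<partial>std_normal_distribution \<partial>P)"
        using std_normal.nn_integral_fst[OF mI'[OF i]] by simp
      finally show "(\<integral>\<^sup>+x. \<integral>\<^sup>+e. ?I i x e \<partial>std_normal_distribution \<partial>P) = emeasure (regression_law P f0) (A i)" ..
    qed
    finally show "emeasure (distr (design_law n P \<Otimes>\<^sub>M noise n) (PiM {..<n} (\<lambda>_. P \<Otimes>\<^sub>M borel)) (observe n f0)) (PiE {..<n} A) = (\<Prod>i<n. emeasure (regression_law P f0) (A i))" .
  qed simp
qed

section \<open>Concentration of cell counts\<close>

definition count_in :: "nat \<Rightarrow> 'a set \<Rightarrow> (nat \<Rightarrow> 'a) \<Rightarrow> nat" where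
  "count_in n B x = card {i. i < n \<and> x i \<in> B}"

lemma count_in_eq_sum: "real (count_in n B x) = (\<Sum>i<n. indicator B (x i))"
proof -
  have "(\<Sum>i<n. indicator B (x i)) = (\<Sum>i\<in>{i. i < n \<and> x i \<in> B}. (1::real))"
    by (rule sum.mono_neutral_cong_right) (auto simp: indicator_def)
  then show ?thesis by (simp add: count_in_def)
qed

lemma count_in_measurable:
  assumes [measurable]: "B \<in> sets P"
  shows "(\<lambda>x. real (count_in n B x)) \<in> borel_measurable (design_law n P)"
  unfolding count_in_eq_sum by measurable

text \<open>The exact value is that of a binomial variable, (1 + p (e^s - 1))^n; the inequality 1 +
  x \<le> e^x replaces it by the Poisson expression.\<close>

lemma nn_integral_exp_count:
  assumes P: "prob_space P" and B[measurable]: "B \<in> sets P"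
  shows "(\<integral>\<^sup>+x. ennreal (exp (s * real (count_in n B x))) \<partial>design_law n P) \<le>
    ennreal (exp (real n * (measure P B * (exp s - 1))))"
proof -
  interpret P: prob_space P by fact
  interpret PX: product_sigma_finite "\<lambda>_ :: nat. P" by unfold_locales
  let ?p = "measure P B"
  have "(\<integral>\<^sup>+x. ennreal (exp (s * real (count_in n B x))) \<partial>design_law n P) = (\<integral>\<^sup>+x. (\<Prod>i<n. ennreal (exp (s * indicator B (x i)))) \<partial>design_law n P)"
    by (simp only: count_in_eq_sum sum_distrib_left exp_sum[OF finite_lessThan] prod_ennreal exp_ge_zero)
  also have "\<dots> = (\<Prod>i<n. \<integral>\<^sup>+x. ennreal (exp (s * indicator B x)) \<partial>P)"
    by (rule PX.product_nn_integral_prod) auto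
  also have "(\<integral>\<^sup>+x. ennreal (exp (s * indicator B x)) \<partial>P) = ennreal (1 + ?p * (exp s - 1))"
  proof -
    have i: "integrable P (indicator B :: 'a \<Rightarrow> real)" by (simp add: less_top[symmetric])
    then have int: "integrable P (\<lambda>x. 1 + indicator B x * (exp s - 1))" by simp
    have "(LINT x|P. 1 + indicator B x * (exp s - 1)) = 1 + ?p * (exp s - 1)"
      using i P.prob_space by simp
    moreover have "(\<integral>\<^sup>+x. ennreal (exp (s * indicator B x)) \<partial>P) = (\<integral>\<^sup>+x. ennreal (1 + indicator B x * (exp s - 1)) \<partial>P)"
      by (intro nn_integral_cong) (simp add: indicator_def)
    moreover have "(\<integral>\<^sup>+x. ennreal (1 + indicator B x * (exp s - 1)) \<partial>P) = ennreal (LINT x|P. 1 + indicator B x * (exp s - 1))"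
      by (rule nn_integral_eq_integral[OF int]) (auto simp: indicator_def)
    ultimately show ?thesis by simp
  qed
  also have "(\<Prod>i<n. ennreal (1 + ?p * (exp s - 1))) \<le> (\<Prod>i<n. ennreal (exp (?p * (exp s - 1))))"
    by (intro prod_mono_ennreal ennreal_leI exp_ge_add_one_self)
  also have "\<dots> = ennreal (exp (real n * (?p * (exp s - 1))))"
    by (simp add: ennreal_power exp_of_nat_mult)
  finally show ?thesis .
qed

text \<open>The sign of \<open>s\<close> is left free, so the same bound yields the upper and the
  lower tail.\<close>

lemma exp_Markov_count:
  assumes P: "prob_space P" and B[measurable]: "B \<in> sets P"
  shows "measure (design_law n P) {x \<in> space (design_law n P). a \<le> s * real (count_in n B x)} \<le>
    exp (real n * (measure P B * (exp s - 1)) - a)"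
proof -
  interpret D: prob_space "design_law n P" by (rule prob_space_PiM) (rule P)
  note [measurable] = count_in_measurable[OF B]
  let ?N = "\<lambda>x. real (count_in n B x)"
  let ?E = "{x \<in> space (design_law n P). a \<le> s * ?N x}"
  have "emeasure (design_law n P) ?E = (\<integral>\<^sup>+x. indicator ?E x \<partial>design_law n P)" by simp
  also have "\<dots> \<le> (\<integral>\<^sup>+x. ennreal (exp (- a)) * ennreal (exp (s * ?N x)) \<partial>design_law n P)"
    by (intro nn_integral_mono) (auto simp: indicator_def ennreal_mult[symmetric] mult_exp_exp simp flip: ennreal_1 intro!: ennreal_leI)
  also have "\<dots> = ennreal (exp (- a)) * (\<integral>\<^sup>+x. ennreal (exp (s * ?N x)) \<partial>design_law n P)"
    by (rule nn_integral_cmult) measurable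
  also have "\<dots> \<le> ennreal (exp (- a)) * ennreal (exp (real n * (measure P B * (exp s - 1))))"
    by (intro mult_left_mono nn_integral_exp_count P B) simp
  also have "\<dots> = ennreal (exp (real n * (measure P B * (exp s - 1)) - a))"
    by (simp add: ennreal_mult[symmetric] mult_exp_exp)
  finally show ?thesis by (simp add: D.emeasure_eq_measure)
qed

lemma exp_minus_one_le: "exp (- 1) - 1 \<le> (- 1 / 2 :: real)"
proof -
  have "2 \<le> exp (1::real)" using exp_ge_add_one_self[of 1] by simp
  then have "exp (- (1::real)) \<le> 1 / 2" by (simp add: exp_minus field_simps)
  then show ?thesis by simp
qed

text \<open>Exponential Markov with s = -1 and s = 1. Below, e^-1 - 1 \<le> -1/2 and the threshold
  1/4 leave the exponent -np/4; above, e - 1 \<le> 2 and the threshold 3 leave -np, which is smaller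
  still.\<close>

lemma count_concentration:
  assumes P: "prob_space P" and B: "B \<in> sets P"
  defines "p \<equiv> measure P B"
  shows "measure (design_law n P) {x \<in> space (design_law n P). real n * p / 4 > real (count_in n B x) \<or> real (count_in n B x) > 3 * (real n * p)} \<le>
    2 * exp (- (real n * p / 4))"
proof -
  interpret D: prob_space "design_law n P" by (rule prob_space_PiM) (rule P)
  note [measurable] = count_in_measurable[OF B]
  let ?N = "\<lambda>x. real (count_in n B x)" and ?D = "design_law n P"
  have np: "0 \<le> real n * p" by (simp add: p_def)
  have "{x \<in> space ?D. real n * p / 4 > ?N x \<or> ?N x > 3 * (real n * p)} \<subseteq>
      {x \<in> space ?D. - (real n * p / 4) \<le> - 1 * ?N x} \<union> {x \<in> space ?D. 3 * (real n * p) \<le> 1 * ?N x}" by auto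
  then have "measure ?D {x \<in> space ?D. real n * p / 4 > ?N x \<or> ?N x > 3 * (real n * p)} \<le>
      measure ?D ({x \<in> space ?D. - (real n * p / 4) \<le> - 1 * ?N x} \<union> {x \<in> space ?D. 3 * (real n * p) \<le> 1 * ?N x})"
    by (intro D.finite_measure_mono) auto
  also have "\<dots> \<le> measure ?D {x \<in> space ?D. - (real n * p / 4) \<le> - 1 * ?N x} + measure ?D {x \<in> space ?D. 3 * (real n * p) \<le> 1 * ?N x}"
    by (intro measure_Un_le) auto
  also have "\<dots> \<le> exp (real n * (p * (exp (- 1) - 1)) - - (real n * p / 4)) + exp (real n * (p * (exp 1 - 1)) - 3 * (real n * p))"
    unfolding p_def by (intro add_mono exp_Markov_count P B)
  also have "\<dots> \<le> exp (- (real n * p / 4)) + exp (- (real n * p / 4))"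
  proof (intro add_mono)
    have "real n * p * (exp (- 1) - 1) \<le> real n * p * (- 1 / 2)"
      by (intro mult_left_mono exp_minus_one_le np)
    then show "exp (real n * (p * (exp (- 1) - 1)) - - (real n * p / 4)) \<le> exp (- (real n * p / 4))"
      unfolding exp_le_cancel_iff by (simp only: mult.assoc)
    have "real n * p * (exp 1 - 1) \<le> real n * p * 2"
      using exp_le by (intro mult_left_mono np) simp
    then show "exp (real n * (p * (exp 1 - 1)) - 3 * (real n * p)) \<le> exp (- (real n * p / 4))"
      unfolding exp_le_cancel_iff using np by (simp only: mult.assoc)
  qed
  finally show ?thesis by simp
qed

text \<open>Markov's inequality on the product of design and noise, restricted to the event
  \<open>G\<close> because the trace is controlled only there. The energy needs a bound in mean
  only. The squared sum costs a factor 2, which cancels the half in \<open>smoother_bias\<close> and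
  stays in front of the trace.\<close>

lemma smoothing_probability_ge:
  fixes P :: "(real^'d) measure"
  assumes P: "prob_space P" and f0[measurable]: "f0 \<in> borel_measurable P"
    and ident[measurable]: "(\<lambda>x. x) \<in> borel_measurable P"
    and K: "\<And>t. 0 \<le> t \<Longrightarrow> 0 \<le> K t" and Km[measurable]: "(\<lambda>z :: real^'d. K (norm z / r)) \<in> borel_measurable borel"
    and r: "0 \<le> r" and \<rho>: "0 \<le> \<rho>" and n: "0 < n" and t: "0 < t" and \<tau>: "0 \<le> \<tau>" and \<beta>: "0 \<le> \<beta>"
    and G[measurable]: "Measurable.pred (design_law n P) G"
    and trace: "\<And>x. x \<in> space (design_law n P) \<Longrightarrow> G x \<Longrightarrow>
      (\<Sum>j<n. ip n (smoothing_operator.smoother n (graph_weight K r x) \<rho> (unit_vec j)) (smoothing_operator.smoother n (graph_weight K r x) \<rho> (unit_vec j))) \<le> \<tau>"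
    and energy: "(\<integral>\<^sup>+x. ennreal (dirichlet_energy n (graph_weight K r x) (\<lambda>i. f0 (x i))) \<partial>design_law n P) \<le> ennreal \<beta>"
    and q: "measure (design_law n P) {x \<in> space (design_law n P). \<not> G x} \<le> q"
  shows "1 - q - (\<rho> * \<beta> + 2 * \<tau>) / (real n * t) \<le> measure (regression_sample n P f0)
     {z \<in> space (regression_sample n P f0).
        in_sample_error n f0 (\<lambda>i. fst (z i))
          (laplacian_smoothing n K r \<rho> (\<lambda>i. fst (z i)) (\<lambda>i. snd (z i))) \<le> t}"
proof -
  interpret P: prob_space P by fact
  interpret D: prob_space "design_law n P" by (rule prob_space_PiM) (rule P)
  interpret N: prob_space "noise n" by (rule prob_space_noise)
  interpret DN: pair_prob_space "design_law n P" "noise n" by unfold_locales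
  let ?D = "design_law n P" and ?Q = "PiM {..<n} (\<lambda>_. P \<Otimes>\<^sub>M (borel :: real measure))"
  let ?w = "graph_weight K r"
  have op: "smoothing_operator (?w x) \<rho>" for x :: "nat \<Rightarrow> real^'d"
    by (rule smoothing_operator_graph_weight[OF K r \<rho>])
  let ?S = "\<lambda>x. smoothing_operator.smoother n (?w x) \<rho>"
  define F where "F z = in_sample_error n f0 (\<lambda>i. fst (z i)) (laplacian_smoothing n K r \<rho> (\<lambda>i. fst (z i)) (\<lambda>i. snd (z i)))" for z
  have F_eq: "F z = (\<Sum>i<n. (?S (\<lambda>i. fst (z i)) (\<lambda>i. snd (z i)) i - f0 (fst (z i)))\<^sup>2) / real n" for z
    unfolding F_def in_sample_error_def
    by (intro arg_cong2[where f = "(/)"] sum.cong refl) (simp add: laplacian_smoothing_eq_smoother[OF op])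
  have F[measurable]: "F \<in> borel_measurable ?Q"
  proof -
    have c: "(\<lambda>z. fst (z i)) \<in> measurable ?Q P" "(\<lambda>z. snd (z i)) \<in> borel_measurable ?Q" if "i < n" for i
      using that by (auto intro!: measurable_compose[OF measurable_component_singleton])
    have c': "(\<lambda>z. fst (z i)) \<in> borel_measurable ?Q" if "i < n" for i
      using measurable_compose[OF c(1)[OF that] ident] .
    have w: "(\<lambda>z. ?w (\<lambda>i. fst (z i)) i j) \<in> borel_measurable ?Q" if "i < n" "j < n" for i j
      unfolding graph_weight_def
      by (rule measurable_compose[OF borel_measurable_diff[OF c'[OF that(1)] c'[OF that(2)]] Km])
    have "(\<lambda>z. ?S (\<lambda>i. fst (z i)) (\<lambda>i. snd (z i)) i) \<in> borel_measurable ?Q" if "i < n" for i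
      by (rule smoother_measurable[OF op w c(2) that])
    moreover have "(\<lambda>z. f0 (fst (z i))) \<in> borel_measurable ?Q" if "i < n" for i
      by (rule measurable_compose[OF c(1)[OF that] f0])
    ultimately show ?thesis
      unfolding F_eq[abs_def] by (intro borel_measurable_divide borel_measurable_sum borel_measurable_power borel_measurable_diff) auto
  qed
  let ?f = "\<lambda>x :: nat \<Rightarrow> real^'d. \<lambda>i. f0 (x i)"
  let ?E = "\<lambda>x. dirichlet_energy n (?w x) (?f x)"
  have F_le: "F (observe n f0 (x, e)) \<le> (\<rho> * ?E x + 2 * ip n (?S x e) (?S x e)) / real n" for x e
  proof -
    let ?z = "observe n f0 (x, e)"
    have fst: "fst (?z i) = x i" and snd: "snd (?z i) = f0 (x i) + e i" if "i < n" for i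
      using that by (simp_all add: observe_def)
    \<comment> \<open>The observed sample is extensional and agrees with the design below
      \<open>n\<close> only; \<open>smoother_cong\<close> ignores the remaining indices.\<close>
    have "?S (\<lambda>i. fst (?z i)) (\<lambda>i. snd (?z i)) i = ?S x (\<lambda>i. f0 (x i) + e i) i" if "i < n" for i
      by (rule smoother_cong[OF op op _ _ that]) (simp_all add: graph_weight_def fst snd)
    then have "F ?z = ip n (\<lambda>i. (?S x (?f x) i - ?f x i) + ?S x e i) (\<lambda>i. (?S x (?f x) i - ?f x i) + ?S x e i) / real n"
      unfolding F_eq ip_def
      by (intro arg_cong2[where f = "(/)"] sum.cong refl)
        (simp add: fst smoothing_operator.smoother_add[OF op] power2_eq_square algebra_simps)
    also have "\<dots> \<le> (2 * (\<rho> * ?E x / 2) + 2 * ip n (?S x e) (?S x e)) / real n"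
      using smoothing_operator.smoother_bias[OF op, of n x "?f x"]
      by (intro divide_right_mono order_trans[OF ip_self_add_le] add_mono mult_left_mono) auto
    finally show ?thesis by simp
  qed
  \<comment> \<open>Given the design, each coordinate of the smoothed noise is a linear form in
    independent standard normals; the squared coefficients add up to the trace.\<close>
  have noise_int: "(\<integral>\<^sup>+e. ennreal (ip n (?S x e) (?S x e)) \<partial>noise n) = ennreal (\<Sum>j<n. ip n (?S x (unit_vec j)) (?S x (unit_vec j)))" for x :: "nat \<Rightarrow> real^'d"
  proof -
    have "(\<integral>\<^sup>+e. ennreal (ip n (?S x e) (?S x e)) \<partial>noise n) = (\<integral>\<^sup>+e. (\<Sum>i<n. ennreal ((\<Sum>j<n. ?S x (unit_vec j) i * e j)\<^sup>2)) \<partial>noise n)"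
    proof (rule nn_integral_cong)
      fix e
      have "ip n (?S x e) (?S x e) = (\<Sum>i<n. (\<Sum>j<n. ?S x (unit_vec j) i * e j)\<^sup>2)"
        unfolding ip_def by (intro sum.cong refl) (simp add: smoothing_operator.smoother_expand[OF op, of _ n x e] power2_eq_square)
      then show "ennreal (ip n (?S x e) (?S x e)) = (\<Sum>i<n. ennreal ((\<Sum>j<n. ?S x (unit_vec j) i * e j)\<^sup>2))"
        by (simp add: sum_ennreal)
    qed
    also have "\<dots> = (\<Sum>i<n. \<integral>\<^sup>+e. ennreal ((\<Sum>j<n. ?S x (unit_vec j) i * e j)\<^sup>2) \<partial>noise n)"
      by (rule nn_integral_sum) measurable
    also have "\<dots> = (\<Sum>i<n. ennreal (\<Sum>j<n. (?S x (unit_vec j) i)\<^sup>2))"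
      by (intro sum.cong refl nn_integral_std_normal_linear) simp
    also have "\<dots> = ennreal (\<Sum>i<n. \<Sum>j<n. (?S x (unit_vec j) i)\<^sup>2)"
      by (rule sum_ennreal) (auto intro: sum_nonneg)
    also have "(\<Sum>i<n. \<Sum>j<n. (?S x (unit_vec j) i)\<^sup>2) = (\<Sum>j<n. ip n (?S x (unit_vec j)) (?S x (unit_vec j)))"
      by (subst sum.swap) (simp add: ip_def power2_eq_square)
    finally show ?thesis .
  qed
  have S_meas: "(\<lambda>e. ennreal (ip n (?S x e) (?S x e))) \<in> borel_measurable (noise n)" for x :: "nat \<Rightarrow> real^'d"
  proof -
    have "(\<lambda>e. ?S x e i) \<in> borel_measurable (noise n)" if "i < n" for i
      by (rule smoother_measurable[OF op _ _ that]) auto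
    then show ?thesis unfolding ip_def by (intro measurable_compose[OF _ measurable_ennreal] borel_measurable_sum borel_measurable_times) auto
  qed
  have T: "observe n f0 \<in> measurable (?D \<Otimes>\<^sub>M noise n) ?Q" by (rule observe_measurable[OF f0])
  have FT: "(\<lambda>p. F (observe n f0 p)) \<in> borel_measurable (?D \<Otimes>\<^sub>M noise n)"
    by (rule measurable_compose[OF T F])
  have energy_meas: "(\<lambda>x. ennreal (?E x)) \<in> borel_measurable ?D"
  proof -
    have c: "(\<lambda>x. x i) \<in> measurable ?D P" if "i < n" for i using that by simp
    have c': "(\<lambda>x. x i) \<in> borel_measurable ?D" if "i < n" for i
      using measurable_compose[OF c[OF that] ident] .
    have w: "(\<lambda>x. ?w x i j) \<in> borel_measurable ?D" if "i < n" "j < n" for i j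
      unfolding graph_weight_def
      by (rule measurable_compose[OF borel_measurable_diff[OF c'[OF that(1)] c'[OF that(2)]] Km])
    show ?thesis unfolding dirichlet_energy_def
      using measurable_compose[OF c f0]
      by (intro measurable_compose[OF _ measurable_ennreal] borel_measurable_sum borel_measurable_times borel_measurable_power borel_measurable_diff w) auto
  qed
  let ?R = "?D \<Otimes>\<^sub>M noise n"
  \<comment> \<open>Failure is split into a bad design, of probability at most \<open>q\<close>, and
    a large error on a good design, left to Markov.\<close>
  let ?B1 = "{p \<in> space ?R. \<not> G (fst p)}" and ?B2 = "{p \<in> space ?R. G (fst p) \<and> t < F (observe n f0 p)}"
  have m1: "?B1 \<in> sets ?R" by measurable
  have m2: "?B2 \<in> sets ?R" using FT by measurable
  have sp: "x \<in> space ?D \<Longrightarrow> e \<in> space (noise n) \<Longrightarrow> (x, e) \<in> space ?R" for x e by (simp add: space_pair_measure)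
  have "emeasure ?R ?B1 = (\<integral>\<^sup>+x. \<integral>\<^sup>+e. indicator ?B1 (x, e) \<partial>noise n \<partial>?D)"
    using m1 by (subst N.nn_integral_fst) auto
  also have "\<dots> = (\<integral>\<^sup>+x. \<integral>\<^sup>+e. indicator {x \<in> space ?D. \<not> G x} x \<partial>noise n \<partial>?D)"
    by (intro nn_integral_cong) (auto simp: indicator_def space_pair_measure)
  also have "\<dots> = emeasure ?D {x \<in> space ?D. \<not> G x}"
    by (simp add: N.emeasure_space_1)
  finally have b1: "measure ?R ?B1 \<le> q"
    using q by (simp add: measure_def)
  have "emeasure ?R ?B2 = (\<integral>\<^sup>+x. \<integral>\<^sup>+e. indicator ?B2 (x, e) \<partial>noise n \<partial>?D)"
    using m2 by (subst N.nn_integral_fst) auto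
  also have "\<dots> \<le> (\<integral>\<^sup>+x. ennreal (1 / (real n * t)) * (ennreal \<rho> * ennreal (?E x) + ennreal (2 * \<tau>)) \<partial>?D)"
  proof (rule nn_integral_mono)
    fix x assume x: "x \<in> space ?D"
    show "(\<integral>\<^sup>+e. indicator ?B2 (x, e) \<partial>noise n) \<le> ennreal (1 / (real n * t)) * (ennreal \<rho> * ennreal (?E x) + ennreal (2 * \<tau>))"
    proof (cases "G x")
      case True
      have E0: "0 \<le> ?E x" by (rule smoothing_operator.energy_nonneg[OF op])
      have "(\<integral>\<^sup>+e. indicator ?B2 (x, e) \<partial>noise n) \<le> (\<integral>\<^sup>+e. ennreal (1 / (real n * t)) * (ennreal (\<rho> * ?E x) + ennreal 2 * ennreal (ip n (?S x e) (?S x e))) \<partial>noise n)"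
      proof (rule nn_integral_mono)
        fix e assume e: "e \<in> space (noise n)"
        show "indicator ?B2 (x, e) \<le> ennreal (1 / (real n * t)) * (ennreal (\<rho> * ?E x) + ennreal 2 * ennreal (ip n (?S x e) (?S x e)))"
        proof (cases "t < F (observe n f0 (x, e))")
          case True
          have "t < (\<rho> * ?E x + 2 * ip n (?S x e) (?S x e)) / real n" using True F_le[of x e] by linarith
          \<comment> \<open>Markov's inequality as a pointwise bound on the indicator, to be
            integrated first over the noise and then over the design.\<close>
          then have "1 \<le> 1 / (real n * t) * (\<rho> * ?E x + 2 * ip n (?S x e) (?S x e))"
            using n t by (simp add: field_simps)
          then have "ennreal 1 \<le> ennreal (1 / (real n * t) * (\<rho> * ?E x + 2 * ip n (?S x e) (?S x e)))" by (rule ennreal_leI)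
          also have "\<dots> = ennreal (1 / (real n * t)) * (ennreal (\<rho> * ?E x) + ennreal 2 * ennreal (ip n (?S x e) (?S x e)))"
            using n t \<rho> E0 ip_nonneg[of n "?S x e"] by (simp add: ennreal_mult[symmetric] del: ennreal_numeral flip: ennreal_plus)
          finally show ?thesis by (auto simp: indicator_def)
        qed simp
      qed
      also have "\<dots> = ennreal (1 / (real n * t)) * (ennreal (\<rho> * ?E x) + ennreal 2 * ennreal (\<Sum>j<n. ip n (?S x (unit_vec j)) (?S x (unit_vec j))))"
        using S_meas[of x] by (simp add: nn_integral_cmult nn_integral_add N.emeasure_space_1 noise_int del: ennreal_numeral)
      also have "\<dots> \<le> ennreal (1 / (real n * t)) * (ennreal (\<rho> * ?E x) + ennreal 2 * ennreal \<tau>)"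
        using trace[OF x True] by (intro mult_left_mono add_left_mono ennreal_leI) auto
      also have "\<dots> = ennreal (1 / (real n * t)) * (ennreal \<rho> * ennreal (?E x) + ennreal (2 * \<tau>))"
        using \<rho> \<tau> E0 by (simp add: ennreal_mult)
      finally show ?thesis .
    qed simp
  qed
  also have "\<dots> = ennreal (1 / (real n * t)) * (ennreal \<rho> * (\<integral>\<^sup>+x. ennreal (?E x) \<partial>?D) + ennreal (2 * \<tau>))"
    using energy_meas by (simp add: nn_integral_cmult nn_integral_add D.emeasure_space_1)
  also have "\<dots> \<le> ennreal (1 / (real n * t)) * (ennreal \<rho> * ennreal \<beta> + ennreal (2 * \<tau>))"
    by (intro mult_left_mono add_right_mono energy) auto
  also have "\<dots> = ennreal ((\<rho> * \<beta> + 2 * \<tau>) / (real n * t))"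
    using n t \<rho> \<tau> \<beta> by (simp add: ennreal_mult[symmetric] flip: ennreal_plus)
  finally have b2: "measure ?R ?B2 \<le> (\<rho> * \<beta> + 2 * \<tau>) / (real n * t)"
    using n t \<rho> \<tau> \<beta> by (simp add: DN.emeasure_eq_measure)
  let ?A = "{p \<in> space ?R. F (observe n f0 p) \<le> t}"
  have mA: "?A \<in> sets ?R" using FT by measurable
  have "1 = measure ?R (space ?R)" by (simp add: DN.prob_space)
  also have "\<dots> \<le> measure ?R (?A \<union> (?B1 \<union> ?B2))"
    using mA m1 m2 by (intro DN.finite_measure_mono) auto
  also have "\<dots> \<le> measure ?R ?A + measure ?R (?B1 \<union> ?B2)"
    using mA m1 m2 by (intro measure_Un_le) auto
  also have "\<dots> \<le> measure ?R ?A + (measure ?R ?B1 + measure ?R ?B2)"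
    using m1 m2 by (intro add_left_mono measure_Un_le) auto
  finally have "1 - q - (\<rho> * \<beta> + 2 * \<tau>) / (real n * t) \<le> measure ?R ?A" using b1 b2 by linarith
  also have "measure ?R ?A = measure (distr ?R ?Q (observe n f0)) {z \<in> space (distr ?R ?Q (observe n f0)). F z \<le> t}"
  proof -
    have "observe n f0 -` {z \<in> space ?Q. F z \<le> t} \<inter> space ?R = ?A"
      using measurable_space[OF T] by auto
    then show ?thesis using T by (subst measure_distr) auto
  qed
  finally show ?thesis unfolding regression_sample_eq[OF P f0] F_def .
qed

section \<open>The trace of the squared smoother\<close>

text \<open>Up to the factor 6, a term is the increment of the bounded increasing function t / (1 +
  t) when t doubles. The sum telescopes, which avoids splitting it at the critical level.\<close>

lemma sum_dyadic_min_le: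
  assumes \<theta>: "0 < \<theta>"
  shows "(\<Sum>l<J. min (2 ^ l / \<theta>) (\<theta> / 2 ^ l)) \<le> (6 :: real)"
proof -
  define F where "F t = t / (1 + t)" for t :: real
  have F: "min t (1 / t) \<le> 6 * (F (2 * t) - F t)" if t: "0 < t" for t
  proof -
    have eq: "F (2 * t) - F t = t / ((1 + 2 * t) * (1 + t))"
      using t by (simp add: F_def field_simps)
    show ?thesis
    proof (cases "t \<le> 1")
      case True
      have "(1 + 2 * t) * (1 + t) \<le> 3 * 2" using True t by (intro mult_mono) auto
      then have "t / 6 \<le> t / ((1 + 2 * t) * (1 + t))" using t by (intro divide_left_mono mult_pos_pos) auto
      then have "t \<le> 6 * (F (2 * t) - F t)" unfolding eq by linarith
      then show ?thesis by (rule min.coboundedI1)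
    next
      case False
      have "(1 + 2 * t) * (1 + t) \<le> (3 * t) * (2 * t)" using False by (intro mult_mono) auto
      then have "t / ((3 * t) * (2 * t)) \<le> t / ((1 + 2 * t) * (1 + t))" using t by (intro divide_left_mono mult_pos_pos) auto
      moreover have "t / ((3 * t) * (2 * t)) = 1 / (6 * t)" using t by (simp add: field_simps)
      ultimately have "1 / t \<le> 6 * (F (2 * t) - F t)" unfolding eq by simp
      then show ?thesis by (rule min.coboundedI2)
    qed
  qed
  have "(\<Sum>l<J. min (2 ^ l / \<theta>) (\<theta> / 2 ^ l)) \<le> (\<Sum>l<J. 6 * (F (2 ^ Suc l / \<theta>) - F (2 ^ l / \<theta>)))"
    using F[of "2 ^ _ / \<theta>"] \<theta> by (intro sum_mono) simp
  also have "\<dots> = 6 * (F (2 ^ J / \<theta>) - F (1 / \<theta>))"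
    unfolding sum_distrib_left[symmetric] using sum_lessThan_telescope[of "\<lambda>l. F (2 ^ l / \<theta>)" J] by simp
  also have "\<dots> \<le> 6 * (1 - 0)"
  proof (intro mult_left_mono diff_mono)
    have "0 \<le> F t \<and> F t \<le> 1" if "0 < t" for t using that by (simp add: F_def field_simps)
    then show "F (2 ^ J / \<theta>) \<le> 1" "0 \<le> F (1 / \<theta>)" using \<theta> by auto
  qed simp
  finally show ?thesis by simp
qed

text \<open>With t = 2^l / \<theta> the claim compares t^m / (1 + c1 t^2)^2 with min t (1/t). For t
  \<le> 1 it rests on m \<ge> 1, for larger t on t^m \<le> t^3; so m < 4 is what makes the terms
  beyond the critical level decay.\<close>

lemma dyadic_term_le:
  fixes \<theta> c1 :: real
  assumes \<theta>: "0 < \<theta>" and m: "1 \<le> m" "m < 4" and c1: "0 < c1" "c1 \<le> 1" and \<mu>: "c1 / \<theta>\<^sup>2 \<le> \<mu>"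
  shows "2 ^ (l * m) / (1 + \<mu> * 4 ^ l)\<^sup>2 \<le> \<theta> ^ m / c1\<^sup>2 * min (2 ^ l / \<theta>) (\<theta> / 2 ^ l)"
proof -
  define t where "t = 2 ^ l / \<theta>"
  have t: "0 < t" using \<theta> by (simp add: t_def)
  have 2: "2 ^ (l * m) = \<theta> ^ m * t ^ m" using \<theta> by (simp add: t_def power_divide power_mult)
  have "c1 * t\<^sup>2 \<le> \<mu> * 4 ^ l"
  proof -
    have "(4::real) ^ l = (2 ^ l)\<^sup>2" by (simp add: power2_eq_square power_mult_distrib[symmetric])
    then have "c1 * t\<^sup>2 = c1 / \<theta>\<^sup>2 * 4 ^ l" by (simp add: t_def power_divide)
    then show ?thesis using mult_right_mono[OF \<mu>, of "4 ^ l"] by simp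
  qed
  then have ge: "1 + c1 * t\<^sup>2 \<le> 1 + \<mu> * 4 ^ l" by simp
  have pos: "0 < 1 + c1 * t\<^sup>2" using c1 by (simp add: add_pos_nonneg)
  have "t ^ m / (1 + \<mu> * 4 ^ l)\<^sup>2 \<le> t ^ m / (1 + c1 * t\<^sup>2)\<^sup>2"
    using t ge pos by (intro divide_left_mono power_mono) auto
  also have "\<dots> \<le> 1 / c1\<^sup>2 * min t (1 / t)"
  proof (cases "t \<le> 1")
    case True
    have "t ^ m / (1 + c1 * t\<^sup>2)\<^sup>2 \<le> t ^ m / 1"
      using t c1 pos by (intro divide_left_mono) (auto simp: one_le_power)
    also have "t ^ m \<le> t" using True t m power_decreasing[of 1 m t] by simp
    finally have "t ^ m / (1 + c1 * t\<^sup>2)\<^sup>2 \<le> t" by simp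
    also have "t \<le> 1 / c1\<^sup>2 * t" using c1 t power_le_one[of c1 2] by (simp add: field_simps)
    finally have "t ^ m / (1 + c1 * t\<^sup>2)\<^sup>2 \<le> 1 / c1\<^sup>2 * t" .
    moreover have "1 \<le> 1 / t" using True t by simp
    then have "min t (1 / t) = t" using True by simp
    ultimately show ?thesis by (simp only:)
  next
    case False
    have "t ^ m / (1 + c1 * t\<^sup>2)\<^sup>2 \<le> t ^ m / (c1 * t\<^sup>2)\<^sup>2"
      using t c1 pos by (intro divide_left_mono power_mono mult_pos_pos zero_less_power) auto
    also have "\<dots> = 1 / c1\<^sup>2 * (t ^ m / t ^ 4)" using t c1 by (simp add: power_mult_distrib power_mult[symmetric])
    also have "\<dots> \<le> 1 / c1\<^sup>2 * (1 / t)"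
    proof (rule mult_left_mono)
      have "t ^ m / t ^ 4 \<le> t ^ 3 / t ^ 4"
        using False m t by (intro divide_right_mono power_increasing) auto
      also have "t ^ 3 / t ^ 4 = 1 / t" using t by (simp add: field_simps eval_nat_numeral)
      finally show "t ^ m / t ^ 4 \<le> 1 / t" .
    qed simp
    finally have "t ^ m / (1 + c1 * t\<^sup>2)\<^sup>2 \<le> 1 / c1\<^sup>2 * (1 / t)" .
    moreover have "1 / t \<le> 1" using False t by simp
    then have "min t (1 / t) = 1 / t" using False by linarith
    ultimately show ?thesis by (simp only:)
  qed
  finally have "\<theta> ^ m * (t ^ m / (1 + \<mu> * 4 ^ l)\<^sup>2) \<le> \<theta> ^ m * (1 / c1\<^sup>2 * min t (1 / t))"
    using \<theta> by (intro mult_left_mono) auto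
  then show ?thesis using \<theta> by (simp add: 2 t_def)
qed

text \<open>Level l imposes one condition for each chart \<open>a\<close> and each of the
  \<open>2 ^ l\<close> to the power m blocks, so the gap may grow like \<open>4 ^ l\<close>. Charts
  may overlap: their blocks only have to cover the vertices, and each chart is charged the full
  energy, which costs the factor \<open>A\<close>.\<close>

lemma trace_le_dyadic:
  fixes Q :: "'a \<Rightarrow> ('m::finite \<Rightarrow> nat) \<Rightarrow> nat set"
  assumes op: "smoothing_operator w \<rho>"
    and T: "finite T"
    and sub: "\<And>a q. a \<in> T \<Longrightarrow> q \<in> grid (2 ^ J) UNIV \<Longrightarrow> Q a q \<subseteq> {..<n}"
    and disj: "\<And>a q q'. a \<in> T \<Longrightarrow> q \<in> grid (2 ^ J) UNIV \<Longrightarrow> q' \<in> grid (2 ^ J) UNIV \<Longrightarrow> q \<noteq> q' \<Longrightarrow> Q a q \<inter> Q a q' = {}"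
    and cover: "\<And>i. i < n \<Longrightarrow> \<exists>a\<in>T. \<exists>q\<in>grid (2 ^ J) UNIV. i \<in> Q a q"
    and lo: "0 < lo" "\<And>a q. a \<in> T \<Longrightarrow> q \<in> grid (2 ^ J) UNIV \<Longrightarrow> lo \<le> real (card (Q a q))"
    and hi: "\<And>a q. a \<in> T \<Longrightarrow> q \<in> grid (2 ^ J) UNIV \<Longrightarrow> real (card (Q a q)) \<le> \<kappa> * lo" and \<kappa>: "0 \<le> \<kappa>"
    and w0: "0 < w0" "\<And>a q q' i j. a \<in> T \<Longrightarrow> q \<in> grid (2 ^ J) UNIV \<Longrightarrow> q' \<in> grid (2 ^ J) UNIV \<Longrightarrow> adjacent q q' \<Longrightarrow>
        i \<in> Q a q \<Longrightarrow> j \<in> Q a q' \<Longrightarrow> w0 \<le> w i j"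
    and A: "real (card T) \<le> A" "0 < A"
    and m: "CARD('m) < 4" and \<theta>: "1 \<le> \<theta>" and c1: "0 < c1" "c1 \<le> 1"
    and \<mu>: "c1 / \<theta>\<^sup>2 \<le> \<rho> * (lo * w0 / (4 ^ J * (4 * A * (1 + \<kappa> * 2 ^ CARD('m)))))"
    and last: "real n * \<theta> ^ 4 \<le> b * (\<theta> ^ CARD('m) * 16 ^ J)"
  shows "(\<Sum>j<n. ip n (smoothing_operator.smoother n w \<rho> (unit_vec j)) (smoothing_operator.smoother n w \<rho> (unit_vec j))) \<le>
    (A + 6 * 2 ^ CARD('m) * A / c1\<^sup>2 + b / c1\<^sup>2) * \<theta> ^ CARD('m)"
proof -
  interpret smoothing_operator n w \<rho> by (rule op)
  let ?m = "CARD('m)" and ?D = "dirichlet_energy n w"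
  \<comment> \<open>Reciprocal of the constant of \<open>block_poincare\<close> for
    \<open>b = 2 ^ J\<close>, simplified to
    \<open>2 * (1 + \<kappa> * 2 ^ ?m) * b\<^sup>2 / (lo * w0)\<close>, times \<open>A\<close> for
    the charts and 2 for the half in front of the energy.\<close>
  define g0 where "g0 = lo * w0 / (4 ^ J * (4 * A * (1 + \<kappa> * 2 ^ ?m)))"
  define \<nu> where "\<nu> = \<rho> * g0"
  define g where "g l = g0 * 4 ^ l" for l :: nat
  define B where "B l = (\<lambda>(a, s). cell_functional (Q a) (2 ^ (J - l)) s) ` (T \<times> grid (2 ^ l) (UNIV :: 'm set))" for l
  define k where "k l = card T * (2 ^ l) ^ ?m" for l :: nat
  have pos: "0 < 1 + \<kappa> * 2 ^ ?m" using \<kappa> by (simp add: add_pos_nonneg)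
  have g0: "0 < g0" unfolding g0_def using lo w0 A pos by simp
  have fin: "finite (B l)" for l unfolding B_def using T by (intro finite_imageI finite_cartesian_product) (auto simp: finite_grid)
  have card: "card (B l) \<le> k l" for l
  proof -
    have "card (B l) \<le> card (T \<times> grid (2 ^ l) (UNIV :: 'm set))" unfolding B_def using T by (intro card_image_le finite_cartesian_product) (auto simp: finite_grid)
    then show ?thesis by (simp add: k_def card_cartesian_product card_grid)
  qed
  have gap: "g l * ip n f f \<le> ?D f / 2" if l: "l \<le> J" and orth: "\<And>b. b \<in> B l \<Longrightarrow> ip n f b = 0" for l f
  proof -
    let ?b = "2 ^ (J - l) :: nat" and ?c = "2 ^ l :: nat"
    have bc: "?b * ?c = 2 ^ J" using l by (simp flip: power_add)
    have each: "(\<Sum>q\<in>grid (2 ^ J) UNIV. \<Sum>i\<in>Q a q. (f i)\<^sup>2) \<le> (2 * (1 + \<kappa> * 2 ^ ?m) * (real ?b)\<^sup>2 / (lo * w0)) * ?D f" if a: "a \<in> T" for a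
    proof -
      have "(\<Sum>q\<in>grid (?b * ?c) UNIV. \<Sum>i\<in>Q a q. (f i)\<^sup>2) \<le> (2 / (lo * w0) + 2 * (\<kappa> * lo) * 2 ^ ?m * (real ?b)\<^sup>2 / (lo\<^sup>2 * w0)) * ?D f"
      proof (rule block_poincare)
        show "0 \<le> w i j" for i j by (rule w_nonneg)
        show "ip n f (cell_functional (Q a) ?b s) = 0" if "s \<in> grid ?c UNIV" for s
          using that a by (intro orth) (auto simp: B_def)
      qed (use sub[OF a] disj[OF a] lo(1) lo(2)[OF a] hi[OF a] w0(1) w0(2)[OF a] \<kappa> in \<open>simp_all add: bc\<close>)
      also have "\<dots> \<le> (2 * (1 + \<kappa> * 2 ^ ?m) * (real ?b)\<^sup>2 / (lo * w0)) * ?D f"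
      proof (rule mult_right_mono[OF _ energy_nonneg])
        have "1 \<le> (real ?b)\<^sup>2" by (simp add: one_le_power)
        then have "2 / (lo * w0) \<le> 2 * (real ?b)\<^sup>2 / (lo * w0)" using lo(1) w0(1) by (intro divide_right_mono) auto
        moreover have "2 * (\<kappa> * lo) * 2 ^ ?m * (real ?b)\<^sup>2 / (lo\<^sup>2 * w0) = 2 * (\<kappa> * 2 ^ ?m) * (real ?b)\<^sup>2 / (lo * w0)"
          using lo(1) by (simp add: power2_eq_square)
        ultimately show "2 / (lo * w0) + 2 * (\<kappa> * lo) * 2 ^ ?m * (real ?b)\<^sup>2 / (lo\<^sup>2 * w0) \<le> 2 * (1 + \<kappa> * 2 ^ ?m) * (real ?b)\<^sup>2 / (lo * w0)"
          by (simp add: add_divide_distrib distrib_left distrib_right)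
      qed
      finally show ?thesis by (simp add: bc)
    qed
    \<comment> \<open>Every vertex lies in some cell of some chart; multiple coverage only increases
      the right-hand side.\<close>
    have "ip n f f \<le> (\<Sum>a\<in>T. \<Sum>q\<in>grid (2 ^ J) UNIV. \<Sum>i\<in>Q a q. (f i)\<^sup>2)"
    proof -
      have Qf: "finite (Q a q)" if "a \<in> T" "q \<in> grid (2 ^ J) UNIV" for a q
        using sub[OF that] finite_subset by blast
      have "ip n f f = (\<Sum>i<n. (f i)\<^sup>2)" by (simp add: ip_def power2_eq_square)
      also have "\<dots> \<le> (\<Sum>i<n. \<Sum>a\<in>T. \<Sum>q\<in>grid (2 ^ J) UNIV. if i \<in> Q a q then (f i)\<^sup>2 else 0)"
      proof (rule sum_mono)
        fix i assume "i \<in> {..<n}"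
        then obtain a q where aq: "a \<in> T" "q \<in> grid (2 ^ J) UNIV" "i \<in> Q a q" using cover by blast
        have "(f i)\<^sup>2 = (if i \<in> Q a q then (f i)\<^sup>2 else 0)" using aq by simp
        also have "\<dots> \<le> (\<Sum>q\<in>grid (2 ^ J) UNIV. if i \<in> Q a q then (f i)\<^sup>2 else 0)"
          by (rule member_le_sum[OF aq(2)]) (auto simp: finite_grid)
        also have "\<dots> \<le> (\<Sum>a\<in>T. \<Sum>q\<in>grid (2 ^ J) UNIV. if i \<in> Q a q then (f i)\<^sup>2 else 0)"
          by (rule member_le_sum[OF aq(1) _ T, of "\<lambda>a. \<Sum>q\<in>grid (2 ^ J) UNIV. if i \<in> Q a q then (f i)\<^sup>2 else 0"]) (auto intro: sum_nonneg)
        finally show "(f i)\<^sup>2 \<le> (\<Sum>a\<in>T. \<Sum>q\<in>grid (2 ^ J) UNIV. if i \<in> Q a q then (f i)\<^sup>2 else 0)" .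
      qed
      also have "\<dots> = (\<Sum>a\<in>T. \<Sum>q\<in>grid (2 ^ J) UNIV. \<Sum>i<n. if i \<in> Q a q then (f i)\<^sup>2 else 0)"
        by (subst sum.swap, intro sum.cong refl, rule sum.swap)
      also have "\<dots> = (\<Sum>a\<in>T. \<Sum>q\<in>grid (2 ^ J) UNIV. \<Sum>i\<in>Q a q. (f i)\<^sup>2)"
      proof (rule sum.cong[OF refl], rule sum.cong[OF refl])
        fix a q assume "a \<in> T" "q \<in> grid (2 ^ J) (UNIV :: 'm set)"
        from sub[OF this] have "{i \<in> {..<n}. i \<in> Q a q} = Q a q" by auto
        then show "(\<Sum>i<n. if i \<in> Q a q then (f i)\<^sup>2 else 0) = (\<Sum>i\<in>Q a q. (f i)\<^sup>2)"
          by (simp add: sum.inter_filter[symmetric])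
      qed
      finally show ?thesis .
    qed
    also have "\<dots> \<le> (\<Sum>a\<in>T. (2 * (1 + \<kappa> * 2 ^ ?m) * (real ?b)\<^sup>2 / (lo * w0)) * ?D f)"
      by (intro sum_mono each)
    also have "\<dots> = real (card T) * ((2 * (1 + \<kappa> * 2 ^ ?m) * (real ?b)\<^sup>2 / (lo * w0)) * ?D f)" by simp
    also have "\<dots> \<le> A * ((2 * (1 + \<kappa> * 2 ^ ?m) * (real ?b)\<^sup>2 / (lo * w0)) * ?D f)"
      using A(1) lo(1) w0(1) pos energy_nonneg by (intro mult_right_mono) auto
    finally have le: "ip n f f \<le> A * ((2 * (1 + \<kappa> * 2 ^ ?m) * (real ?b)\<^sup>2 / (lo * w0)) * ?D f)" .
    have b4: "(real ?b)\<^sup>2 * 4 ^ l = 4 ^ J"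
    proof -
      have "(real ?b)\<^sup>2 = 4 ^ (J - l)" by (simp add: power2_eq_square power_mult_distrib[symmetric])
      then show ?thesis using l by (simp flip: power_add)
    qed
    have "g l * (A * ((2 * (1 + \<kappa> * 2 ^ ?m) * (real ?b)\<^sup>2 / (lo * w0)) * ?D f)) = (((real ?b)\<^sup>2 * 4 ^ l) / 4 ^ J) * (?D f / 2)"
    proof -
      have alg: "lo * w0 / (v * (4 * A * s)) * u * (A * ((2 * s * x / (lo * w0)) * y)) = x * u / v * (y / 2)"
        if "0 < s" "0 < v" for s u v x y :: real
        using that lo(1) w0(1) A(2) by (simp add: mult_ac)
      show ?thesis unfolding g_def g0_def by (rule alg[OF pos]) simp
    qed
    also have "\<dots> = ?D f / 2" unfolding b4 by simp
    finally have eq: "g l * (A * ((2 * (1 + \<kappa> * 2 ^ ?m) * (real ?b)\<^sup>2 / (lo * w0)) * ?D f)) = ?D f / 2" .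
    have "0 \<le> g l" using g0 by (simp add: g_def)
    from mult_left_mono[OF le this] show ?thesis unfolding eq .
  qed
  have tr: "(\<Sum>j<n. ip n (smoother (unit_vec j)) (smoother (unit_vec j))) \<le>
    real (k 0) + (\<Sum>l<J. real (k (Suc l)) / (1 + \<rho> * g l)\<^sup>2) + real n / (1 + \<rho> * g J)\<^sup>2"
    by (rule trace_smoother_le[OF fin card _ gap]) (use g0 in \<open>auto simp: g_def\<close>)
  have \<nu>: "c1 / \<theta>\<^sup>2 \<le> \<nu>" using \<mu> by (simp add: \<nu>_def g0_def)
  have \<rho>g: "\<rho> * g l = \<nu> * 4 ^ l" for l by (simp add: g_def \<nu>_def)
  have m1: "1 \<le> ?m" by (simp add: Suc_leI)
  have \<theta>m: "1 \<le> \<theta> ^ ?m" using \<theta> by (rule one_le_power)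
  have t1: "real (k 0) \<le> A * \<theta> ^ ?m"
    using order_trans[OF A(1), of "A * \<theta> ^ ?m"] mult_left_mono[OF \<theta>m, of A] A(2) by (simp add: k_def)
  have t2: "(\<Sum>l<J. real (k (Suc l)) / (1 + \<rho> * g l)\<^sup>2) \<le> 6 * 2 ^ ?m * A / c1\<^sup>2 * \<theta> ^ ?m"
  proof -
    \<comment> \<open>The blocks of level l + 1 are paired with the gap of level l, which is the
      source of the factor \<open>2 ^ ?m\<close>.\<close>
    have "(\<Sum>l<J. real (k (Suc l)) / (1 + \<rho> * g l)\<^sup>2) \<le> (\<Sum>l<J. A * 2 ^ ?m * (\<theta> ^ ?m / c1\<^sup>2 * min (2 ^ l / \<theta>) (\<theta> / 2 ^ l)))"
    proof (rule sum_mono)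
      fix l
      have "real (k (Suc l)) / (1 + \<rho> * g l)\<^sup>2 = real (card T) * 2 ^ ?m * (2 ^ (l * ?m) / (1 + \<nu> * 4 ^ l)\<^sup>2)"
        by (simp add: k_def \<rho>g power_mult_distrib power_mult)
      also have "\<dots> \<le> A * 2 ^ ?m * (2 ^ (l * ?m) / (1 + \<nu> * 4 ^ l)\<^sup>2)"
        using A(1) by (intro mult_right_mono) auto
      also have "\<dots> \<le> A * 2 ^ ?m * (\<theta> ^ ?m / c1\<^sup>2 * min (2 ^ l / \<theta>) (\<theta> / 2 ^ l))"
        using \<theta> A(2) by (intro mult_left_mono dyadic_term_le m m1 c1 \<nu>) auto
      finally show "real (k (Suc l)) / (1 + \<rho> * g l)\<^sup>2 \<le> A * 2 ^ ?m * (\<theta> ^ ?m / c1\<^sup>2 * min (2 ^ l / \<theta>) (\<theta> / 2 ^ l))" .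
    qed
    also have "\<dots> = A * 2 ^ ?m * (\<theta> ^ ?m / c1\<^sup>2) * (\<Sum>l<J. min (2 ^ l / \<theta>) (\<theta> / 2 ^ l))"
      by (simp add: sum_distrib_left mult.assoc)
    also have "\<dots> \<le> A * 2 ^ ?m * (\<theta> ^ ?m / c1\<^sup>2) * 6"
      using \<theta> A(2) by (intro mult_left_mono sum_dyadic_min_le) auto
    finally show ?thesis by (simp add: mult_ac)
  qed
  \<comment> \<open>The up to \<open>n\<close> directions beyond the finest level. With the gap at
    level J their share is \<open>n * \<theta> ^ 4 / 16 ^ J\<close> up to \<open>c1\<close>, which
    \<open>last\<close> bounds by the target order.\<close>
  have t3: "real n / (1 + \<rho> * g J)\<^sup>2 \<le> b / c1\<^sup>2 * \<theta> ^ ?m"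
  proof -
    have p: "0 < c1 / \<theta>\<^sup>2 * 4 ^ J" using c1 \<theta> by simp
    have "c1 / \<theta>\<^sup>2 * 4 ^ J \<le> 1 + \<rho> * g J"
      using \<nu> unfolding \<rho>g by (intro order_trans[OF mult_right_mono[OF \<nu>]]) auto
    moreover from this p have "0 < 1 + \<rho> * g J" by linarith
    ultimately have "real n / (1 + \<rho> * g J)\<^sup>2 \<le> real n / (c1 / \<theta>\<^sup>2 * 4 ^ J)\<^sup>2"
      using less_imp_le[OF p] by (intro divide_left_mono power_mono mult_pos_pos[OF zero_less_power zero_less_power[OF p]]) simp_all
    also have "\<dots> = real n * \<theta> ^ 4 / (c1\<^sup>2 * 16 ^ J)"
    proof -
      have "((4::real) ^ J)\<^sup>2 = 16 ^ J" by (simp add: power2_eq_square power_mult_distrib[symmetric])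
      then have "(c1 / \<theta>\<^sup>2 * 4 ^ J)\<^sup>2 = c1\<^sup>2 * 16 ^ J / \<theta> ^ 4" by (simp add: power_mult_distrib power_divide power_mult[symmetric])
      then show ?thesis by simp
    qed
    also have "\<dots> \<le> b * (\<theta> ^ ?m * 16 ^ J) / (c1\<^sup>2 * 16 ^ J)"
      using c1 by (intro divide_right_mono last) auto
    also have "\<dots> = b / c1\<^sup>2 * \<theta> ^ ?m" by simp
    finally show ?thesis .
  qed
  show ?thesis using tr t1 t2 t3 by (simp add: algebra_simps)
qed

section \<open>Cells and the expected energy\<close>

text \<open>Half-open, so that the cells are disjoint; the missing upper faces of the cube do not
  matter because patches are images of open cubes.\<close>

definition cell :: "real^'m \<Rightarrow> real \<Rightarrow> nat \<Rightarrow> ('m \<Rightarrow> nat) \<Rightarrow> (real^'m) set" where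
  "cell u0 s J q = {u. \<forall>i. u0 $ i - s + 2 * s / 2 ^ J * real (q i) \<le> u $ i \<and>
     u $ i < u0 $ i - s + 2 * s / 2 ^ J * (real (q i) + 1)}"

lemma cell_borel: "cell u0 s J q \<in> sets borel"
  unfolding cell_def by measurable

lemma cell_subset_cube:
  assumes s: "0 < s" and q: "q \<in> grid (2 ^ J) UNIV"
  shows "cell u0 s J q \<subseteq> cube u0 s"
proof
  fix u assume u: "u \<in> cell u0 s J q"
  have "\<bar>u $ i - u0 $ i\<bar> \<le> s" for i
  proof -
    let ?h = "2 * s / 2 ^ J"
    have h: "0 < ?h" using s by simp
    have "q i < 2 ^ J" using q by (simp add: grid_UNIV)
    then have "real (Suc (q i)) \<le> real (2 ^ J)" unfolding of_nat_le_iff by simp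
    then have "real (q i) + 1 \<le> 2 ^ J" by simp
    then have "?h * (real (q i) + 1) \<le> ?h * 2 ^ J" using h by (intro mult_left_mono) auto
    then have "?h * (real (q i) + 1) \<le> 2 * s" by simp
    moreover have "0 \<le> ?h * real (q i)" using h by (intro mult_nonneg_nonneg) auto
    moreover have "u0 $ i - s + ?h * real (q i) \<le> u $ i" "u $ i < u0 $ i - s + ?h * (real (q i) + 1)"
      using u by (auto simp: cell_def)
    ultimately show ?thesis by linarith
  qed
  then show "u \<in> cube u0 s" by (simp add: mem_cube)
qed

lemma cell_disjoint:
  assumes s: "0 < s" and "q \<noteq> q'"
  shows "cell u0 s J q \<inter> cell u0 s J q' = {}"
proof -
  have "q = q'" if u: "u \<in> cell u0 s J q" "u \<in> cell u0 s J q'" for u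
  proof
    fix i
    let ?h = "2 * s / 2 ^ J"
    have h: "0 < ?h" using s by simp
    have "?h * real (q i) < ?h * (real (q' i) + 1)" "?h * real (q' i) < ?h * (real (q i) + 1)"
      using u unfolding cell_def by (smt (verit) mem_Collect_eq)+
    then have "real (q i) < real (q' i) + 1" "real (q' i) < real (q i) + 1"
      using h by (simp_all only: mult_less_cancel_left_pos)
    then show "q i = q' i" by linarith
  qed
  with assms(2) show ?thesis by blast
qed

lemma open_cube_covered:
  assumes u: "u \<in> open_cube u0 s"
  shows "\<exists>q\<in>grid (2 ^ J) UNIV. u \<in> cell u0 s J q"
proof -
  have b: "\<bar>u $ i - u0 $ i\<bar> < s" for i using u by (simp add: mem_open_cube)
  have s: "0 < s" using b[of undefined] by linarith
  let ?h = "2 * s / 2 ^ J"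
  have h: "0 < ?h" using s by simp
  define y where "y i = (u $ i - u0 $ i + s) / ?h" for i
  have y0: "0 \<le> y i" for i using b[of i] h unfolding y_def by (intro divide_nonneg_nonneg) auto
  have y1: "y i < 2 ^ J" for i
  proof -
    have "u $ i - u0 $ i + s < 2 * s" using b[of i] by linarith
    moreover have "2 ^ J * ?h = 2 * s" by simp
    ultimately show ?thesis unfolding y_def pos_divide_less_eq[OF h] by linarith
  qed
  define q where "q i = nat \<lfloor>y i\<rfloor>" for i
  have q: "real (q i) \<le> y i" "y i < real (q i) + 1" for i using y0[of i] by (simp_all add: q_def)
  have yh: "?h * y i = u $ i - u0 $ i + s" for i using s by (simp add: y_def)
  have "q \<in> grid (2 ^ J) UNIV"
  proof -
    have "real (q i) < real (2 ^ J)" for i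
      unfolding of_nat_power of_nat_numeral using q(1)[of i] y1[of i] by linarith
    then show ?thesis unfolding grid_UNIV of_nat_less_iff by blast
  qed
  moreover have "u \<in> cell u0 s J q"
  proof -
    have "?h * real (q i) \<le> ?h * y i" "?h * y i < ?h * (real (q i) + 1)" for i
      by (rule mult_left_mono[OF q(1) less_imp_le[OF h]], rule mult_strict_left_mono[OF q(2) h])
    then show ?thesis unfolding cell_def yh by (auto simp: algebra_simps)
  qed
  ultimately show ?thesis by blast
qed

lemma emeasure_cell:
  assumes s: "0 < s"
  shows "emeasure lborel (cell u0 s J q :: (real^'m) set) = ennreal ((2 * s / 2 ^ J) ^ CARD('m))"
proof -
  let ?h = "2 * s / 2 ^ J"
  define a where "a = (\<chi> i. u0 $ i - s + ?h * real (q i))"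
  have h: "0 < ?h" using s by simp
  have sub: "box a (a + ?h *\<^sub>R 1) \<subseteq> cell u0 s J q" "cell u0 s J q \<subseteq> cbox a (a + ?h *\<^sub>R 1)"
  proof -
    have "a $ i = u0 $ i - s + ?h * real (q i)" "(a + ?h *\<^sub>R 1) $ i = u0 $ i - s + ?h * (real (q i) + 1)" for i
      by (simp_all add: a_def distrib_left add_divide_distrib)
    then show "box a (a + ?h *\<^sub>R 1) \<subseteq> cell u0 s J q" "cell u0 s J q \<subseteq> cbox a (a + ?h *\<^sub>R 1)"
      unfolding cell_def subset_eq Ball_def mem_box_cart mem_Collect_eq by (metis less_imp_le)+
  qed
  have one: "(1 :: real^'m) \<bullet> b = 1" if "b \<in> Basis" for b
    using that by (auto simp: Basis_vec_def inner_axis)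
  have le: "a \<bullet> b \<le> (a + ?h *\<^sub>R 1) \<bullet> b" if "b \<in> Basis" for b
    using h one[OF that] by (simp add: inner_add_left)
  have vol: "(\<Prod>b\<in>Basis. (a + ?h *\<^sub>R 1 - a) \<bullet> b) = ?h ^ CARD('m)"
  proof -
    have "(\<Prod>b\<in>Basis. (a + ?h *\<^sub>R 1 - a) \<bullet> b) = (\<Prod>b\<in>(Basis :: (real^'m) set). ?h)"
      by (intro prod.cong refl) (simp add: one)
    then show ?thesis by simp
  qed
  have "emeasure lborel (cell u0 s J q) \<le> emeasure lborel (cbox a (a + ?h *\<^sub>R 1))"
    using sub by (intro emeasure_mono) auto
  also have "\<dots> = ennreal (?h ^ CARD('m))" using le vol by (subst emeasure_lborel_cbox) auto
  finally have 1: "emeasure lborel (cell u0 s J q) \<le> ennreal (?h ^ CARD('m))" .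
  have "ennreal (?h ^ CARD('m)) = emeasure lborel (box a (a + ?h *\<^sub>R 1))" using le vol by (subst emeasure_lborel_box) auto
  also have "\<dots> \<le> emeasure lborel (cell u0 s J q)" using sub cell_borel by (intro emeasure_mono) auto
  finally show ?thesis using 1 by (intro antisym)
qed

text \<open>In each coordinate two points of adjacent cells differ by at most two cell sides; the
  sum of the coordinates bounds the norm.\<close>

lemma adjacent_cells_dist_le:
  assumes s: "0 < s" and adj: "adjacent q q'" and u: "u \<in> cell u0 s J q" and v: "v \<in> cell u0 s J (q' :: 'm \<Rightarrow> nat)"
  shows "norm (u - v :: real^'m) \<le> real CARD('m) * (4 * s / 2 ^ J)"
proof -
  let ?h = "2 * s / 2 ^ J"
  have h: "0 < ?h" using s by simp
  have c: "\<bar>(u - v) $ i\<bar> \<le> 2 * ?h" for i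
  proof -
    have "real (q i) \<le> real (Suc (q' i))" "real (q' i) \<le> real (Suc (q i))"
      using adj unfolding adjacent_def of_nat_le_iff by blast+
    then have le: "real (q i) \<le> real (q' i) + 1" "real (q' i) \<le> real (q i) + 1" by simp_all
    note mult_left_mono[OF le(1) less_imp_le[OF h]] mult_left_mono[OF le(2) less_imp_le[OF h]]
    moreover have "u0 $ i - s + ?h * real (q i) \<le> u $ i" "u $ i < u0 $ i - s + ?h * (real (q i) + 1)"
      "u0 $ i - s + ?h * real (q' i) \<le> v $ i" "v $ i < u0 $ i - s + ?h * (real (q' i) + 1)"
      using u v by (auto simp: cell_def)
    ultimately show ?thesis
      unfolding vector_minus_component distrib_left abs_le_iff mult_1_right by linarith
  qed
  have "norm (u - v) \<le> (\<Sum>i\<in>UNIV. \<bar>(u - v) $ i\<bar>)" by (rule norm_le_l1_cart)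
  also have "\<dots> \<le> (\<Sum>i\<in>(UNIV :: 'm set). 2 * ?h)" by (intro sum_mono c)
  also have "\<dots> = real CARD('m) * (4 * s / 2 ^ J)" by simp
  finally show ?thesis .
qed

text \<open>The density and the volume density are both bounded above and below, so the mass is
  comparable to the Lebesgue measure of the cell. The bounds 1/k \<le> s \<le> k then remove the
  side length of the individual chart.\<close>

lemma measure_chart_cell_bounds:
  fixes X :: "(real^'d) set" and U :: "(real^'m::finite) set"
  assumes vol: "riemannian_volume TYPE('m) X vol" and X: "compact X"
    and gc: "good_chart k X U \<phi> u0 s" and k: "0 < k" and q: "q \<in> grid (2 ^ J) UNIV"
    and P: "prob_space P" "P = density vol (\<lambda>x. ennreal (p x))" and p[measurable]: "p \<in> borel_measurable vol"
    and pb: "0 < p_min" "\<And>x. x \<in> X \<Longrightarrow> p_min \<le> p x \<and> p x \<le> p_max"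
  shows "p_min / k * (2 / k) ^ CARD('m) / (2 ^ J) ^ CARD('m) \<le> measure P (\<phi> ` cell u0 s J q)"
    and "measure P (\<phi> ` cell u0 s J q) \<le> p_max * k * (2 * k) ^ CARD('m) / (2 ^ J) ^ CARD('m)"
    and "\<phi> ` cell u0 s J q \<in> sets P"
proof -
  interpret P: prob_space P by fact
  let ?m = "CARD('m)" and ?C = "cell u0 s J q" and ?h = "2 * s / 2 ^ J"
  have sk: "1 / k \<le> s" "s \<le> k" using gc by (auto simp: good_chart_def)
  have "0 < 1 / k" using k by simp
  then have s: "0 < s" using sk by linarith
  have lp: "local_param X U \<phi>" and cU: "cube u0 s \<subseteq> U" using gc by (auto simp: good_chart_def)
  have C: "?C \<subseteq> cube u0 s" by (rule cell_subset_cube[OF s q])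
  have CU: "?C \<subseteq> U" using C cU by blast
  have B: "\<phi> ` ?C \<in> sets vol" by (rule chart_image_measurable[OF vol X lp cell_borel CU])
  show BP: "\<phi> ` ?C \<in> sets P" using B by (simp add: P(2))
  have "openin (top_of_set X) (\<phi> ` U)" using lp by (simp add: local_param_def)
  then have sub: "\<phi> ` ?C \<subseteq> X" using openin_imp_subset CU by blast
  have vd: "1 / k \<le> volume_density \<phi> u \<and> volume_density \<phi> u \<le> k" if "u \<in> ?C" for u
    using gc C that unfolding good_chart_def by blast
  have x0: "\<exists>x. x \<in> X" using P.not_empty by (simp add: P(2) space_sets_volume(1)[OF vol X] ex_in_conv)
  then obtain x where "x \<in> X" by blast
  with pb have pmax: "0 < p_max" by force
  have pb': "p_min \<le> p (\<phi> u) \<and> p (\<phi> u) \<le> p_max" if "u \<in> ?C" for u using pb(2) sub that by blast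
  have "emeasure P (\<phi> ` ?C) = (\<integral>\<^sup>+x. ennreal (p x) * indicator (\<phi> ` ?C) x \<partial>vol)"
    unfolding P(2) using B by (subst emeasure_density) auto
  also have "\<dots> = (\<integral>\<^sup>+x. indicator (\<phi> ` ?C) x * ennreal (p x) \<partial>vol)" by (simp add: mult.commute)
  also have "\<dots> = (\<integral>\<^sup>+u. indicator ?C u * (ennreal (p (\<phi> u)) * ennreal (volume_density \<phi> u)) \<partial>lborel)"
    by (rule nn_integral_chart[OF vol X lp cell_borel CU]) measurable
  finally have eq: "emeasure P (\<phi> ` ?C) = (\<integral>\<^sup>+u. indicator ?C u * (ennreal (p (\<phi> u)) * ennreal (volume_density \<phi> u)) \<partial>lborel)" .
  have const: "(\<integral>\<^sup>+u. ennreal c * indicator ?C u \<partial>lborel) = ennreal (c * ?h ^ ?m)" if "0 \<le> c" for c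
    using that s by (simp add: nn_integral_cmult_indicator cell_borel emeasure_cell[OF s] ennreal_mult)
  have "ennreal (p_min / k * ?h ^ ?m) \<le> emeasure P (\<phi> ` ?C)"
    unfolding eq using pb(1) k
  proof (subst const[symmetric], simp, intro nn_integral_mono)
    fix u
    show "ennreal (p_min / k) * indicator ?C u \<le> indicator ?C u * (ennreal (p (\<phi> u)) * ennreal (volume_density \<phi> u))"
    proof (cases "u \<in> ?C")
      case True
      have "p_min * (1 / k) \<le> p (\<phi> u) * volume_density \<phi> u"
        using pb' vd True pb(1) k by (intro mult_mono) (auto intro: order_trans[of 0 p_min])
      then have "ennreal (p_min / k) \<le> ennreal (p (\<phi> u) * volume_density \<phi> u)" by (intro ennreal_leI) simp
      also have "\<dots> = ennreal (p (\<phi> u)) * ennreal (volume_density \<phi> u)"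
        using pb'[OF True] vd[OF True] pb(1) k by (intro ennreal_mult) (auto intro: order_trans[of 0 "1 / k"])
      finally show ?thesis using True by simp
    qed simp
  qed
  then have lower: "p_min / k * ?h ^ ?m \<le> measure P (\<phi> ` ?C)" by (simp add: P.emeasure_eq_measure)
  have "emeasure P (\<phi> ` ?C) \<le> ennreal (p_max * k * ?h ^ ?m)"
    unfolding eq using pmax k
  proof (subst const[symmetric], simp, intro nn_integral_mono)
    fix u
    show "indicator ?C u * (ennreal (p (\<phi> u)) * ennreal (volume_density \<phi> u)) \<le> ennreal (p_max * k) * indicator ?C u"
    proof (cases "u \<in> ?C")
      case True
      have "ennreal (p (\<phi> u)) * ennreal (volume_density \<phi> u) \<le> ennreal p_max * ennreal k"
        using pb'[OF True] vd[OF True] by (intro mult_mono ennreal_leI) auto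
      then show ?thesis using True pmax k by (simp add: ennreal_mult)
    qed simp
  qed
  then have upper: "measure P (\<phi> ` ?C) \<le> p_max * k * ?h ^ ?m"
    using pmax k s by (simp add: P.emeasure_eq_measure)
  have hm: "?h ^ ?m = (2 * s) ^ ?m / (2 ^ J) ^ ?m" by (simp add: power_divide)
  have "(2 / k) ^ ?m \<le> (2 * s) ^ ?m" using sk k by (intro power_mono) (auto simp: field_simps)
  then have "(2 / k) ^ ?m / (2 ^ J) ^ ?m \<le> ?h ^ ?m" unfolding hm by (intro divide_right_mono) auto
  from mult_left_mono[OF this, of "p_min / k"] lower
  show "p_min / k * (2 / k) ^ ?m / (2 ^ J) ^ ?m \<le> measure P (\<phi> ` ?C)" using pb(1) k by simp
  have "(2 * s) ^ ?m \<le> (2 * k) ^ ?m" using sk s by (intro power_mono) auto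
  then have "?h ^ ?m \<le> (2 * k) ^ ?m / (2 ^ J) ^ ?m" unfolding hm by (intro divide_right_mono) auto
  from mult_left_mono[OF this, of "p_max * k"] upper
  show "measure P (\<phi> ` ?C) \<le> p_max * k * (2 * k) ^ ?m / (2 ^ J) ^ ?m" using pmax k by simp
qed

text \<open>The coordinates i and j are integrated out first; the remaining ones form a probability
  space and contribute 1.\<close>

lemma nn_integral_PiM_pair:
  fixes h :: "'a \<Rightarrow> 'a \<Rightarrow> ennreal"
  assumes P: "prob_space P" and ij: "i < n" "j < n" "i \<noteq> j"
    and h[measurable]: "(\<lambda>(x, y). h x y) \<in> borel_measurable (P \<Otimes>\<^sub>M P)"
  shows "(\<integral>\<^sup>+x. h (x i) (x j) \<partial>design_law n P) = (\<integral>\<^sup>+y. \<integral>\<^sup>+x. h x y \<partial>P \<partial>P)"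
proof -
  interpret P: prob_space P by fact
  interpret PX: product_sigma_finite "\<lambda>_ :: nat. P" by unfold_locales
  interpret PP: pair_prob_space P P by unfold_locales
  let ?J = "{..<n} - {i, j}"
  interpret R: prob_space "PiM ?J (\<lambda>_. P)" by (rule prob_space_PiM) (rule P)
  have set: "{..<n} = insert i (insert j ?J)" using ij by auto
  have m1: "(\<lambda>x. h (x i) (x j)) \<in> borel_measurable (PiM (insert i (insert j ?J)) (\<lambda>_. P))"
    by measurable
  have H: "(\<lambda>y. \<integral>\<^sup>+x. h x y \<partial>P) \<in> borel_measurable P" by measurable
  have "(\<integral>\<^sup>+x. h (x i) (x j) \<partial>design_law n P) = (\<integral>\<^sup>+x. h (x i) (x j) \<partial>PiM (insert i (insert j ?J)) (\<lambda>_. P))"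
    by (simp only: set[symmetric])
  also have "\<dots> = (\<integral>\<^sup>+x. (\<integral>\<^sup>+y. h ((x(i := y)) i) ((x(i := y)) j) \<partial>P) \<partial>PiM (insert j ?J) (\<lambda>_. P))"
    by (rule PX.product_nn_integral_insert[OF _ _ m1]) (use ij in auto)
  also have "\<dots> = (\<integral>\<^sup>+x. (\<integral>\<^sup>+y. h y (x j) \<partial>P) \<partial>PiM (insert j ?J) (\<lambda>_. P))" using ij by simp
  also have "\<dots> = (\<integral>\<^sup>+x. (\<integral>\<^sup>+z. (\<integral>\<^sup>+y. h y ((x(j := z)) j) \<partial>P) \<partial>P) \<partial>PiM ?J (\<lambda>_. P))"
    by (rule PX.product_nn_integral_insert) (auto intro!: measurable_compose[OF _ H])
  also have "\<dots> = (\<integral>\<^sup>+y. \<integral>\<^sup>+x. h x y \<partial>P \<partial>P)" by (simp add: R.emeasure_space_1)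
  finally show ?thesis .
qed

text \<open>Diagonal terms vanish. For i different from j the kernel is at most \<open>K0\<close>
  times the indicator of distance at most \<open>r\<close>, and changing from \<open>P\<close> to
  \<open>vol\<close> in both variables costs \<open>p_max\<close> twice.\<close>

lemma expected_energy_le:
  fixes P vol :: "(real^'d) measure" and p :: "real^'d \<Rightarrow> real"
  assumes P: "prob_space P" "P = density vol (\<lambda>x. ennreal (p x))" and p[measurable]: "p \<in> borel_measurable vol"
    and fin: "finite_measure vol"
    and pb: "0 \<le> p_max" "\<And>x. x \<in> space vol \<Longrightarrow> p x \<le> p_max"
    and ident[measurable]: "(\<lambda>x. x) \<in> borel_measurable vol" and f0[measurable]: "f0 \<in> borel_measurable vol"
    and Km[measurable]: "(\<lambda>z :: real^'d. K (norm z / r)) \<in> borel_measurable borel"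
    and K: "\<And>t. 0 \<le> t \<Longrightarrow> 0 \<le> K t \<and> K t \<le> K0" "\<And>t. 1 < t \<Longrightarrow> K t = 0" and r: "0 < r" and E: "0 \<le> E"
    and local_energy: "(\<integral>\<^sup>+x. \<integral>\<^sup>+y. indicator {z. norm z \<le> r} (x - y) * ennreal ((f0 x - f0 y)\<^sup>2) \<partial>vol \<partial>vol) \<le> ennreal E"
  shows "(\<integral>\<^sup>+x. ennreal (dirichlet_energy n (graph_weight K r x) (\<lambda>i. f0 (x i))) \<partial>design_law n P) \<le>
    ennreal ((real n)\<^sup>2 * (p_max\<^sup>2 * K0 * E))"
proof -
  interpret V: finite_measure vol by fact
  interpret P: prob_space P by fact
  have sets[measurable_cong]: "sets P = sets vol" by (simp add: P(2))
  have K0: "0 \<le> K0" using K(1)[of 0] by linarith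
  define h where "h x y = ennreal (K (norm (x - y) / r) * (f0 x - f0 y)\<^sup>2)" for x y
  define g where "g x y = indicator {z. norm z \<le> r} (x - y) * ennreal ((f0 x - f0 y)\<^sup>2)" for x y :: "real^'d"
  have Kd: "(\<lambda>(x, y). K (norm (x - y) / r)) \<in> borel_measurable (vol \<Otimes>\<^sub>M vol)"
    unfolding split_beta' by (rule measurable_compose[OF _ Km]) measurable
  have hm: "(\<lambda>(x, y). h x y) \<in> borel_measurable (vol \<Otimes>\<^sub>M vol)"
    using Kd unfolding h_def split_beta' by measurable
  have hmP: "(\<lambda>(x, y). h x y) \<in> borel_measurable (P \<Otimes>\<^sub>M P)" using hm by measurable
  have gm[measurable]: "(\<lambda>(x, y). g x y) \<in> borel_measurable (vol \<Otimes>\<^sub>M vol)" unfolding g_def by measurable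
  have hg: "h x y \<le> ennreal K0 * g x y" for x y
  proof (cases "norm (x - y) \<le> r")
    case True
    have "h x y \<le> ennreal (K0 * (f0 x - f0 y)\<^sup>2)"
      unfolding h_def using K(1)[of "norm (x - y) / r"] r by (intro ennreal_leI mult_right_mono) auto
    then show ?thesis using True K0 by (simp add: g_def ennreal_mult)
  next
    case False
    then have "1 < norm (x - y) / r" using r by simp
    then show ?thesis by (simp add: h_def K(2))
  qed
  have dens: "(\<integral>\<^sup>+x. F x \<partial>P) \<le> ennreal p_max * (\<integral>\<^sup>+x. F x \<partial>vol)" if "F \<in> borel_measurable vol" for F
  proof -
    have "(\<integral>\<^sup>+x. F x \<partial>P) = (\<integral>\<^sup>+x. ennreal (p x) * F x \<partial>vol)"
      unfolding P(2) using that by (subst nn_integral_density) auto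
    also have "\<dots> \<le> (\<integral>\<^sup>+x. ennreal p_max * F x \<partial>vol)"
      using pb by (intro nn_integral_mono mult_right_mono ennreal_leI) auto
    also have "\<dots> = ennreal p_max * (\<integral>\<^sup>+x. F x \<partial>vol)" by (rule nn_integral_cmult[OF that])
    finally show ?thesis .
  qed
  have gy: "(\<lambda>x. g x y) \<in> borel_measurable vol" if "y \<in> space vol" for y
    using measurable_compose[OF measurable_Pair2'[OF that] gm] by simp
  have pair: "(\<integral>\<^sup>+y. \<integral>\<^sup>+x. h x y \<partial>P \<partial>P) \<le> ennreal (p_max\<^sup>2 * K0 * E)"
  proof -
    have sym: "g x y = g y x" for x y by (simp add: g_def norm_minus_commute power2_commute indicator_def)
    have "(\<integral>\<^sup>+y. \<integral>\<^sup>+x. h x y \<partial>P \<partial>P) \<le> (\<integral>\<^sup>+y. \<integral>\<^sup>+x. ennreal K0 * g x y \<partial>P \<partial>P)"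
      by (intro nn_integral_mono hg)
    also have "\<dots> \<le> (\<integral>\<^sup>+y. ennreal p_max * (ennreal K0 * \<integral>\<^sup>+x. g x y \<partial>vol) \<partial>P)"
    proof (rule nn_integral_mono)
      fix y assume "y \<in> space P"
      then have y: "y \<in> space vol" by (simp add: P(2))
      have "(\<integral>\<^sup>+x. ennreal K0 * g x y \<partial>P) \<le> ennreal p_max * (\<integral>\<^sup>+x. ennreal K0 * g x y \<partial>vol)"
        by (intro dens borel_measurable_times_ennreal borel_measurable_const gy y)
      also have "(\<integral>\<^sup>+x. ennreal K0 * g x y \<partial>vol) = ennreal K0 * \<integral>\<^sup>+x. g x y \<partial>vol"
        by (rule nn_integral_cmult[OF gy[OF y]])
      finally show "(\<integral>\<^sup>+x. ennreal K0 * g x y \<partial>P) \<le> ennreal p_max * (ennreal K0 * \<integral>\<^sup>+x. g x y \<partial>vol)" .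
    qed
    also have "\<dots> \<le> ennreal p_max * (\<integral>\<^sup>+y. ennreal p_max * (ennreal K0 * \<integral>\<^sup>+x. g x y \<partial>vol) \<partial>vol)"
      by (rule dens) measurable
    also have "\<dots> = ennreal p_max * (ennreal p_max * (ennreal K0 * (\<integral>\<^sup>+y. \<integral>\<^sup>+x. g x y \<partial>vol \<partial>vol)))"
      by (subst nn_integral_cmult, measurable, subst nn_integral_cmult, measurable)
    also have "\<dots> \<le> ennreal p_max * (ennreal p_max * (ennreal K0 * ennreal E))"
      using local_energy sym by (intro mult_left_mono) (simp_all add: g_def)
    also have "\<dots> = ennreal (p_max\<^sup>2 * K0 * E)"
      using pb(1) K0 E by (simp add: ennreal_mult[symmetric] power2_eq_square mult.assoc)
    finally show ?thesis .
  qed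
  have c: "(\<lambda>x. h (x i) (x j)) \<in> borel_measurable (design_law n P)" if "i < n" "j < n" for i j
  proof -
    have "(\<lambda>x. x i) \<in> measurable (design_law n P) P" "(\<lambda>x. x j) \<in> measurable (design_law n P) P"
      using that by simp_all
    from measurable_compose[OF measurable_Pair[OF this] hmP] show ?thesis by simp
  qed
  have nn: "0 \<le> K (norm (x - y) / r) * (f0 x - f0 y)\<^sup>2" for x y using K(1)[of "norm (x - y) / r"] r by simp
  have "(\<integral>\<^sup>+x. ennreal (dirichlet_energy n (graph_weight K r x) (\<lambda>i. f0 (x i))) \<partial>design_law n P) = (\<integral>\<^sup>+x. (\<Sum>i<n. \<Sum>j<n. h (x i) (x j)) \<partial>design_law n P)"
    unfolding dirichlet_energy_def graph_weight_def h_def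
    by (intro nn_integral_cong) (simp add: sum_ennreal sum_nonneg nn)
  also have "\<dots> = (\<Sum>i<n. \<integral>\<^sup>+x. (\<Sum>j<n. h (x i) (x j)) \<partial>design_law n P)"
    by (rule nn_integral_sum) (use c in \<open>auto intro!: borel_measurable_sum\<close>)
  also have "\<dots> = (\<Sum>i<n. \<Sum>j<n. \<integral>\<^sup>+x. h (x i) (x j) \<partial>design_law n P)"
    by (intro sum.cong refl nn_integral_sum) (use c in auto)
  also have "\<dots> \<le> (\<Sum>i<n. \<Sum>j<n. ennreal (p_max\<^sup>2 * K0 * E))"
  proof (intro sum_mono)
    fix i j assume "i \<in> {..<n}" "j \<in> {..<n}"
    then have ij: "i < n" "j < n" by auto
    show "(\<integral>\<^sup>+x. h (x i) (x j) \<partial>design_law n P) \<le> ennreal (p_max\<^sup>2 * K0 * E)"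
    proof (cases "i = j")
      case True then show ?thesis by (simp add: h_def)
    next
      case False
      then show ?thesis using pair nn_integral_PiM_pair[OF P(1) ij False hmP] by simp
    qed
  qed
  also have "\<dots> = ennreal ((real n)\<^sup>2 * (p_max\<^sup>2 * K0 * E))"
    using K0 E pb(1) by (simp add: ennreal_mult[symmetric] ennreal_of_nat_eq_real_of_nat power2_eq_square mult.assoc)
  finally show ?thesis .
qed

section \<open>The rate of convergence\<close>

text \<open>Geometry is translated into the combinatorial hypotheses of
  \<open>trace_le_dyadic\<close>. The assumption on J says that points of adjacent cells have
  distance at most \<open>r\<close>: the charts are k-Lipschitz and cells have side 2s / 2^J with s
  \<le> k. Hence all their weights are at least \<open>K 1\<close>.\<close>

lemma trace_le_good_design:
  fixes X :: "(real^'d) set" and K :: "real \<Rightarrow> real" and x :: "nat \<Rightarrow> real^'d"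
    and T :: "((real^'m::finite) set \<times> (real^'m \<Rightarrow> real^'d) \<times> (real^'m) \<times> real) set"
  assumes T: "finite T" and k: "0 < k"
    and good: "\<And>U \<phi> u0 s. (U, \<phi>, u0, s) \<in> T \<Longrightarrow> good_chart k X U \<phi> u0 s"
    and cover: "\<And>y. y \<in> X \<Longrightarrow> \<exists>(U, \<phi>, u0, s)\<in>T. y \<in> \<phi> ` open_cube u0 s"
    and x: "\<And>i. i < n \<Longrightarrow> x i \<in> X"
    and K: "\<And>t. 0 \<le> t \<Longrightarrow> 0 \<le> K t" "\<And>t. 0 \<le> t \<Longrightarrow> t \<le> 1 \<Longrightarrow> K 1 \<le> K t" "0 < K 1"
    and r: "0 < r" and \<rho>: "0 \<le> \<rho>" and J: "4 * real CARD('m) * k\<^sup>2 \<le> r * 2 ^ J"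
    and lo: "0 < lo" and \<kappa>: "0 \<le> \<kappa>"
    and counts: "\<And>U \<phi> u0 s q. (U, \<phi>, u0, s) \<in> T \<Longrightarrow> q \<in> grid (2 ^ J) UNIV \<Longrightarrow>
      lo \<le> real (count_in n (\<phi> ` cell u0 s J q) x) \<and> real (count_in n (\<phi> ` cell u0 s J q) x) \<le> \<kappa> * lo"
    and A: "real (card T) \<le> A" "0 < A"
    and m: "CARD('m) < 4" and \<theta>: "1 \<le> \<theta>" and c1: "0 < c1" "c1 \<le> 1"
    and \<mu>: "c1 / \<theta>\<^sup>2 \<le> \<rho> * (lo * K 1 / (4 ^ J * (4 * A * (1 + \<kappa> * 2 ^ CARD('m)))))"
    and last: "real n * \<theta> ^ 4 \<le> b * (\<theta> ^ CARD('m) * 16 ^ J)"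
  shows "(\<Sum>j<n. ip n (smoothing_operator.smoother n (graph_weight K r x) \<rho> (unit_vec j)) (smoothing_operator.smoother n (graph_weight K r x) \<rho> (unit_vec j))) \<le>
    (A + 6 * 2 ^ CARD('m) * A / c1\<^sup>2 + b / c1\<^sup>2) * \<theta> ^ CARD('m)"
proof -
  define Q where "Q = (\<lambda>(U :: (real^'m) set, \<phi> :: real^'m \<Rightarrow> real^'d, u0, s) q. {i. i < n \<and> x i \<in> \<phi> ` cell u0 s J q})"
  have s_pos: "0 < s" if "(U, \<phi>, u0, s) \<in> T" for U \<phi> u0 s
  proof -
    have "0 < 1 / k" using k by simp
    also have "1 / k \<le> s" using good[OF that] by (simp add: good_chart_def)
    finally show ?thesis .
  qed
  have inj: "u = v" if t: "(U, \<phi>, u0, s) \<in> T" and "\<phi> u = \<phi> v" "u \<in> cube u0 s" "v \<in> cube u0 s" for U \<phi> u0 s u v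
  proof -
    have "norm (u - v) \<le> k * norm (\<phi> u - \<phi> v)" using good[OF t] that(3,4) unfolding good_chart_def by blast
    then show ?thesis using that(2) by simp
  qed
  show ?thesis
  proof (rule trace_le_dyadic[where Q = Q and T = T and ?w0.0 = "K 1" and J = J and lo = lo and \<kappa> = \<kappa>])
    show "smoothing_operator (graph_weight K r x) \<rho>"
      by (rule smoothing_operator_graph_weight) (use K r \<rho> in auto)
    show "Q a q \<subseteq> {..<n}" for a q by (cases a) (auto simp: Q_def)
    show "Q a q \<inter> Q a q' = {}" if a: "a \<in> T" and q: "q \<in> grid (2 ^ J) UNIV" "q' \<in> grid (2 ^ J) UNIV" "q \<noteq> q'" for a q q'
    proof -
      obtain U \<phi> u0 s where a': "a = (U, \<phi>, u0, s)" by (cases a) auto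
      have t: "(U, \<phi>, u0, s) \<in> T" using a a' by simp
      have "False" if i: "i \<in> Q a q" "i \<in> Q a q'" for i
      proof -
        from i obtain u v where uv: "u \<in> cell u0 s J q" "v \<in> cell u0 s J q'" "x i = \<phi> u" "x i = \<phi> v"
          by (auto simp: Q_def a')
        have "u = v"
          using uv cell_subset_cube[OF s_pos[OF t] q(1)] cell_subset_cube[OF s_pos[OF t] q(2)]
          by (intro inj[OF t]) auto
        then show False using uv cell_disjoint[OF s_pos[OF t] q(3), of u0 J] by blast
      qed
      then show ?thesis by blast
    qed
    show "\<exists>a\<in>T. \<exists>q\<in>grid (2 ^ J) UNIV. i \<in> Q a q" if i: "i < n" for i
    proof -
      obtain a where a: "a \<in> T" "case a of (U, \<phi>, u0, s) \<Rightarrow> x i \<in> \<phi> ` open_cube u0 s" using cover[OF x[OF i]] by blast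
      obtain U \<phi> u0 s where a': "a = (U, \<phi>, u0, s)" by (cases a) auto
      obtain u where u: "u \<in> open_cube u0 s" "x i = \<phi> u" using a a' by auto
      obtain q where q: "q \<in> grid (2 ^ J) UNIV" "u \<in> cell u0 s J q" using open_cube_covered[OF u(1)] by blast
      have "i \<in> Q a q" using i u q by (auto simp: Q_def a')
      with a(1) q(1) show ?thesis by blast
    qed
    show "lo \<le> real (card (Q a q))" "real (card (Q a q)) \<le> \<kappa> * lo" if a: "a \<in> T" and q: "q \<in> grid (2 ^ J) UNIV" for a q
    proof -
      obtain U \<phi> u0 s where a': "a = (U, \<phi>, u0, s)" by (cases a) auto
      show "lo \<le> real (card (Q a q))" "real (card (Q a q)) \<le> \<kappa> * lo"
        using counts[of U \<phi> u0 s q] a q by (auto simp: a' Q_def count_in_def)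
    qed
    show "K 1 \<le> graph_weight K r x i j"
      if a: "a \<in> T" and q: "q \<in> grid (2 ^ J) UNIV" "q' \<in> grid (2 ^ J) UNIV" "adjacent q q'" and ij: "i \<in> Q a q" "j \<in> Q a q'" for a q q' i j
    proof -
      obtain U \<phi> u0 s where a': "a = (U, \<phi>, u0, s)" by (cases a) auto
      have t: "(U, \<phi>, u0, s) \<in> T" using a a' by simp
      note gc = good[OF t]
      have s: "0 < s" "s \<le> k" using s_pos[OF t] gc by (auto simp: good_chart_def)
      from ij obtain u v where uv: "u \<in> cell u0 s J q" "v \<in> cell u0 s J q'" "x i = \<phi> u" "x j = \<phi> v"
        by (auto simp: Q_def a')
      have "u \<in> cube u0 s" "v \<in> cube u0 s"
        using uv cell_subset_cube[OF s(1) q(1)] cell_subset_cube[OF s(1) q(2)] by auto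
      then have "norm (\<phi> u - \<phi> v) \<le> k * norm (u - v)" using gc unfolding good_chart_def by blast
      also have "\<dots> \<le> k * (real CARD('m) * (4 * s / 2 ^ J))"
        using k by (intro mult_left_mono adjacent_cells_dist_le[OF s(1) q(3) uv(1,2)]) simp
      also have "\<dots> \<le> k * (real CARD('m) * (4 * k / 2 ^ J))"
        using k s by (intro mult_left_mono divide_right_mono) auto
      also have "\<dots> = 4 * real CARD('m) * k\<^sup>2 / 2 ^ J" by (simp add: power2_eq_square)
      also have "\<dots> \<le> r" using J by (simp add: field_simps)
      finally have "norm (x i - x j) / r \<le> 1" using r uv by simp
      then show ?thesis using r by (simp add: graph_weight_def K(2))
    qed
  qed (use T lo \<kappa> K A m \<theta> c1 \<mu> last in auto)
qed

text \<open>A union bound over \<open>count_concentration\<close>, whose tail depends on a set only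
  through its mass; the common bound \<open>lo\<close> gives one exponent for all sets.\<close>

lemma good_counts_probability:
  assumes P: "prob_space P" and I: "finite I" and B: "\<And>i. i \<in> I \<Longrightarrow> B i \<in> sets P"
    and lo: "\<And>i. i \<in> I \<Longrightarrow> lo \<le> real n * measure P (B i) / 4" and hi: "\<And>i. i \<in> I \<Longrightarrow> 3 * (real n * measure P (B i)) \<le> hi"
  shows "Measurable.pred (design_law n P) (\<lambda>x. \<forall>i\<in>I. lo \<le> real (count_in n (B i) x) \<and> real (count_in n (B i) x) \<le> hi)" (is ?pred)
    and "measure (design_law n P) {x \<in> space (design_law n P). \<not> (\<forall>i\<in>I. lo \<le> real (count_in n (B i) x) \<and> real (count_in n (B i) x) \<le> hi)} \<le>
      real (card I) * (2 * exp (- lo))"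
proof -
  interpret D: prob_space "design_law n P" by (rule prob_space_PiM) (rule P)
  let ?D = "design_law n P"
  have m[measurable]: "(\<lambda>x. real (count_in n (B i) x)) \<in> borel_measurable ?D" if "i \<in> I" for i
    by (rule count_in_measurable[OF B[OF that]])
  show ?pred
    using I by (intro pred_intros_finite pred_intros_logic) (use m in measurable)
  define E where "E i = {x \<in> space ?D. real n * measure P (B i) / 4 > real (count_in n (B i) x) \<or> real (count_in n (B i) x) > 3 * (real n * measure P (B i))}" for i
  have E: "E i \<in> sets ?D" if "i \<in> I" for i
    unfolding E_def using m[OF that] by measurable
  have "{x \<in> space ?D. \<not> (\<forall>i\<in>I. lo \<le> real (count_in n (B i) x) \<and> real (count_in n (B i) x) \<le> hi)} \<subseteq> (\<Union>i\<in>I. E i)"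
  proof
    fix x assume "x \<in> {x \<in> space ?D. \<not> (\<forall>i\<in>I. lo \<le> real (count_in n (B i) x) \<and> real (count_in n (B i) x) \<le> hi)}"
    then obtain i where "x \<in> space ?D" "i \<in> I" "\<not> (lo \<le> real (count_in n (B i) x) \<and> real (count_in n (B i) x) \<le> hi)" by blast
    moreover from this have "x \<in> E i" using lo[of i] hi[of i] unfolding E_def by auto
    ultimately show "x \<in> (\<Union>i\<in>I. E i)" by blast
  qed
  then have "measure ?D {x \<in> space ?D. \<not> (\<forall>i\<in>I. lo \<le> real (count_in n (B i) x) \<and> real (count_in n (B i) x) \<le> hi)} \<le> measure ?D (\<Union>i\<in>I. E i)"
    using E I by (intro D.finite_measure_mono) auto
  also have "\<dots> \<le> (\<Sum>i\<in>I. measure ?D (E i))" using E I by (intro measure_UNION_le) auto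
  also have "\<dots> \<le> (\<Sum>i\<in>I. 2 * exp (- lo))"
  proof (rule sum_mono)
    fix i assume i: "i \<in> I"
    have "measure ?D (E i) \<le> 2 * exp (- (real n * measure P (B i) / 4))"
      unfolding E_def by (rule count_concentration[OF P B[OF i]])
    also have "\<dots> \<le> 2 * exp (- lo)" using lo[OF i] by simp
    finally show "measure ?D (E i) \<le> 2 * exp (- lo)" .
  qed
  also have "\<dots> = real (card I) * (2 * exp (- lo))" by simp
  finally show "measure ?D {x \<in> space ?D. \<not> (\<forall>i\<in>I. lo \<le> real (count_in n (B i) x) \<and> real (count_in n (B i) x) \<le> hi)} \<le>
      real (card I) * (2 * exp (- lo))" .
qed

lemma exists_power_of_two:
  assumes "1 \<le> y" shows "\<exists>J. y \<le> 2 ^ J \<and> 2 ^ J \<le> 2 * (y :: real)"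
proof -
  obtain n where n: "y < 2 ^ n" using real_arch_pow[of 2 y] by auto
  define J where "J = (LEAST J. y \<le> 2 ^ J)"
  have J: "y \<le> 2 ^ J" unfolding J_def by (rule LeastI[of _ n]) (use n in simp)
  show ?thesis
  proof (cases J)
    case 0 then show ?thesis using J assms by (intro exI[of _ J]) simp
  next
    case (Suc j)
    then have "\<not> y \<le> 2 ^ j" using not_less_Least[of j "\<lambda>J. y \<le> 2 ^ J"] by (simp add: J_def)
    then show ?thesis using J Suc by (intro exI[of _ J]) simp
  qed
qed

lemma admissible_kernelD:
  assumes "admissible_kernel TYPE('d::finite) K"
  shows "0 \<le> t \<Longrightarrow> 0 \<le> K t" and "0 \<le> t \<Longrightarrow> K t \<le> K 0" and "0 \<le> t \<Longrightarrow> t \<le> 1 \<Longrightarrow> K 1 \<le> K t"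
    and "1 < t \<Longrightarrow> K t = 0" and "0 < K 1"
    and "0 < r \<Longrightarrow> (\<lambda>z :: real^'d. K (norm z / r)) \<in> borel_measurable borel"
proof -
  have anti: "K t \<le> K s" if "0 \<le> s" "s \<le> t" for s t
    using assms that unfolding admissible_kernel_def monotone_on_def by auto
  show "0 \<le> t \<Longrightarrow> 0 \<le> K t" "1 < t \<Longrightarrow> K t = 0" "0 < K 1" using assms by (auto simp: admissible_kernel_def)
  show "0 \<le> t \<Longrightarrow> K t \<le> K 0" "0 \<le> t \<Longrightarrow> t \<le> 1 \<Longrightarrow> K 1 \<le> K t" using anti by auto
  \<comment> \<open>Nothing is assumed about \<open>K\<close> on negative arguments. Composition
    with \<open>max 0\<close> gives a monotone function on the whole line, hence a Borel
    one.\<close>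
  have "mono (\<lambda>t. - K (max 0 t))" by (intro monoI) (auto intro!: anti)
  then have [measurable]: "(\<lambda>t. - K (max 0 t)) \<in> borel_measurable borel" by (rule borel_measurable_mono)
  have "(\<lambda>z :: real^'d. - (- K (max 0 (norm z / r)))) \<in> borel_measurable borel" by measurable
  then show "(\<lambda>z :: real^'d. K (norm z / r)) \<in> borel_measurable borel" if "0 < r"
    using that by (simp add: max_def)
qed

text \<open>Every quantity is the exponential of a linear combination of ln M and ln n, so each
  claim is an identity between exponents. In the last one the largest admissible \<open>r\<close>
  gives equality.\<close>

lemma rate_identities:
  fixes M n :: real and m :: nat
  assumes M: "0 < M" and n: "0 < n" and Mn: "1 \<le> M\<^sup>2 * n"
  defines "\<theta> \<equiv> (M\<^sup>2 * n) powr (1 / (2 + real m))"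
  shows "1 \<le> \<theta>"
    and "\<theta> ^ (m + 2) = M\<^sup>2 * n"
    and "M powr (2 * real m / (2 + real m)) * n powr (- 2 / (2 + real m)) = \<theta> ^ m / n"
    and "M powr (- 4 / (2 + real m)) * n powr (- 2 / (2 + real m)) = 1 / \<theta>\<^sup>2"
    and "0 \<le> r \<Longrightarrow> r \<le> M powr ((real m - 4) / (4 + 2 * real m)) * n powr (- 3 / (4 + 2 * real m)) \<Longrightarrow>
      n * \<theta> ^ 4 * r ^ 4 \<le> \<theta> ^ m"
proof -
  show "1 \<le> \<theta>" unfolding \<theta>_def using Mn by (simp add: ge_one_powr_ge_zero)
  let ?a = "ln M" and ?b = "ln n" and ?s = "2 + real m"
  have s: "0 < ?s" by simp
  have lnMn: "ln (M\<^sup>2 * n) = 2 * ?a + ?b" using M n by (simp add: ln_mult ln_realpow)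
  have \<theta>: "\<theta> = exp ((2 * ?a + ?b) / ?s)" unfolding \<theta>_def powr_def lnMn using Mn M n by simp
  have \<theta>j: "\<theta> ^ j = exp (real j * ((2 * ?a + ?b) / ?s))" for j unfolding \<theta> by (simp add: exp_of_nat_mult[symmetric])
  have Mp: "M powr x = exp (x * ?a)" and np: "n powr x = exp (x * ?b)" for x using M n by (simp_all add: powr_def)
  have nexp: "n = exp ?b" using n by simp
  have "\<theta> ^ (m + 2) = exp (2 * ?a + ?b)" unfolding \<theta>j using s by (simp add: field_simps)
  also have "\<dots> = M\<^sup>2 * n" using lnMn M n by (metis exp_ln mult_pos_pos zero_less_power)
  finally show "\<theta> ^ (m + 2) = M\<^sup>2 * n" .
  \<comment> \<open>Naming 1 / (2 + m) makes the exponents polynomial in \<open>v\<close>;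
    \<open>vb\<close> records the only relation between \<open>v\<close> and \<open>m\<close> that
    is used.\<close>
  define v where "v = inverse ?s"
  have "2 * v + real m * v = 1" unfolding v_def using s by (simp add: distrib_right[symmetric])
  then have "?b * (2 * v + real m * v) = ?b" by simp
  then have vb: "2 * (v * ?b) + real m * (v * ?b) = ?b" by (simp add: algebra_simps)
  have "2 * real m / ?s * ?a + - 2 / ?s * ?b = real m * ((2 * ?a + ?b) / ?s) - ?b"
    using vb unfolding divide_inverse v_def[symmetric] by (simp add: algebra_simps)
  then show "M powr (2 * real m / ?s) * n powr (- 2 / ?s) = \<theta> ^ m / n"
    unfolding Mp np \<theta>j by (subst (2) nexp) (simp add: exp_add[symmetric] exp_diff[symmetric])
  have "- 4 / ?s * ?a + - 2 / ?s * ?b = - (2 * ((2 * ?a + ?b) / ?s))"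
    unfolding divide_inverse v_def[symmetric] by (simp add: algebra_simps)
  then show "M powr (- 4 / ?s) * n powr (- 2 / ?s) = 1 / \<theta>\<^sup>2"
    unfolding Mp np \<theta>j by (simp add: exp_add[symmetric] exp_minus[symmetric] inverse_eq_divide[symmetric])
  assume r: "0 \<le> r" "r \<le> M powr ((real m - 4) / (4 + 2 * real m)) * n powr (- 3 / (4 + 2 * real m))"
  have "r ^ 4 \<le> (M powr ((real m - 4) / (4 + 2 * real m)) * n powr (- 3 / (4 + 2 * real m))) ^ 4"
    using r by (intro power_mono) auto
  also have "\<dots> = exp (4 * ((real m - 4) / (4 + 2 * real m) * ?a + - 3 / (4 + 2 * real m) * ?b))"
    unfolding Mp np by (simp add: exp_add[symmetric] exp_of_nat_mult[of 4, symmetric, simplified])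
  finally have "n * \<theta> ^ 4 * r ^ 4 \<le> exp ?b * exp (4 * ((2 * ?a + ?b) / ?s)) * exp (4 * ((real m - 4) / (4 + 2 * real m) * ?a + - 3 / (4 + 2 * real m) * ?b))"
    unfolding \<theta>j nexp[symmetric] of_nat_numeral using n by (intro mult_left_mono) auto
  also have "\<dots> = \<theta> ^ m"
  proof -
    have e4: "4 + 2 * real m = 2 * ?s" by simp
    have "?b + 4 * ((2 * ?a + ?b) / ?s) + 4 * ((real m - 4) / (4 + 2 * real m) * ?a + - 3 / (4 + 2 * real m) * ?b) = real m * ((2 * ?a + ?b) / ?s)"
      using vb unfolding e4 divide_inverse inverse_mult_distrib v_def[symmetric] by (simp add: algebra_simps)
    then show ?thesis unfolding \<theta>j by (simp add: exp_add[symmetric])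
  qed
  finally show "n * \<theta> ^ 4 * r ^ 4 \<le> \<theta> ^ m" .
qed

text \<open>A density bounded below by \<open>p_min\<close> with total mass 1 forces the volume to
  be at most \<open>1 / p_min\<close>.\<close>

lemma finite_volume:
  assumes P: "prob_space P" "P = density vol (\<lambda>x. ennreal (p x))" and p[measurable]: "p \<in> borel_measurable vol"
    and pb: "0 < p_min" "\<And>x. x \<in> space vol \<Longrightarrow> p_min \<le> p x"
  shows "finite_measure vol"
proof
  interpret P: prob_space P by fact
  have "ennreal p_min * emeasure vol (space vol) = (\<integral>\<^sup>+x. ennreal p_min \<partial>vol)" by simp
  also have "\<dots> \<le> (\<integral>\<^sup>+x. ennreal (p x) * indicator (space vol) x \<partial>vol)"
    using pb by (intro nn_integral_mono) (auto intro: ennreal_leI)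
  also have "\<dots> = emeasure P (space vol)" unfolding P(2) by (rule emeasure_density[symmetric]) auto
  also have "\<dots> = 1" using P.emeasure_space_1 by (simp add: P(2))
  finally have le: "ennreal p_min * emeasure vol (space vol) \<le> 1" .
  show "emeasure vol (space vol) \<noteq> \<infinity>"
  proof
    assume "emeasure vol (space vol) = \<infinity>"
    with le pb(1) show False by (simp add: ennreal_mult_top top_unique)
  qed
qed

theorem theorem4:
  fixes X :: "(real^'d::finite) set"
    and vol P :: "(real^'d) measure"
    and p :: "real^'d \<Rightarrow> real"
    and K :: "real \<Rightarrow> real"
    and p_min p_max L_p :: real
    and m :: nat
  assumes dim: "m = CARD('m::finite)" "m < 4" "m \<le> CARD('d)"
    and manifold: "smooth_submanifold TYPE('m) X" "compact X" "connected X" "0 < reach X"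
    and volume: "riemannian_volume TYPE('m) X vol"
    and design: "prob_space P" "p \<in> borel_measurable vol" "P = density vol (\<lambda>x. ennreal (p x))"
    and p_bounds: "0 < p_min" "\<And>x. x \<in> X \<Longrightarrow> p_min \<le> p x \<and> p x \<le> p_max"
    and p_lipschitz: "L_p-lipschitz_on X p"
    and kernel: "admissible_kernel TYPE('d) K"
  shows "\<exists>(C0::real) (c0::real) (N::nat) (C::real) (c::real).
    0 < C0 \<and> 0 < c0 \<and> 0 < N \<and> 0 < C \<and> 0 < c \<and>
    (\<forall>(n::nat) (M::real) (f0 :: real^'d \<Rightarrow> real) (\<delta>::real) (r::real) (\<rho>::real).
       N \<le> n \<longrightarrow>
       real n powr (- 1 / 2) \<le> M \<longrightarrow> M \<le> real n powr (1 / real m) \<longrightarrow>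
       f0 \<in> H1_ball TYPE('m) X vol M \<longrightarrow>
       0 < \<delta> \<longrightarrow> \<delta> < 1 \<longrightarrow>
       C0 * (ln (real n) / real n) powr (1 / real m) \<le> r \<longrightarrow>
       r \<le> min c0 (M powr ((real m - 4) / (4 + 2 * real m)) *
                    real n powr (- 3 / (4 + 2 * real m))) \<longrightarrow>
       \<rho> = M powr (- 4 / (2 + real m)) * inverse (real n * r ^ (m + 2)) *
             real n powr (- 2 / (2 + real m)) \<longrightarrow>
       measure (regression_sample n P f0)
         {z \<in> space (regression_sample n P f0).
            in_sample_error n f0 (\<lambda>i. fst (z i))
              (laplacian_smoothing n K r \<rho> (\<lambda>i. fst (z i)) (\<lambda>i. snd (z i)))
            \<le> C / \<delta> * M powr (2 * real m / (2 + real m)) * real n powr (- 2 / (2 + real m))}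
       \<ge> 1 - \<delta> - C * real n * exp (- c * real n * r ^ m)
           - exp (- c * (M\<^sup>2 * real n) powr (real m / (2 + real m))))"
proof -
  interpret P: prob_space P by fact
  have [measurable]: "p \<in> borel_measurable vol" by (rule design)
  have space_vol: "space vol = X" by (rule space_sets_volume(1)[OF volume manifold(2)])
  have setsP[measurable_cong]: "sets P = sets vol" and spaceP: "space P = X"
    by (simp_all add: design(3) space_vol)
  have identV[measurable]: "(\<lambda>x. x) \<in> borel_measurable vol" by (rule measurable_ident_volume[OF volume manifold(2)])
  have identP: "(\<lambda>x. x) \<in> borel_measurable P" by measurable
  have finV: "finite_measure vol"
    by (rule finite_volume[OF design(1,3,2) p_bounds(1)]) (simp add: space_vol p_bounds(2))
  obtain y0 where "y0 \<in> X" using P.not_empty spaceP by auto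
  then have p_max: "0 < p_max" using p_bounds by force
  have m1: "1 \<le> m" using dim(1) by (simp add: Suc_leI)
  have K: "\<And>t. 0 \<le> t \<Longrightarrow> 0 \<le> K t \<and> K t \<le> K 0" "\<And>t. 0 \<le> t \<Longrightarrow> t \<le> 1 \<Longrightarrow> K 1 \<le> K t" "\<And>t. 1 < t \<Longrightarrow> K t = 0" "0 < K 1"
    and Km: "\<And>r. 0 < r \<Longrightarrow> (\<lambda>z :: real^'d. K (norm z / r)) \<in> borel_measurable borel"
    using admissible_kernelD[OF kernel] by blast+
  have K0: "0 < K 0" using K(2)[of 0] K(4) by linarith
  obtain Ce \<epsilon> where Ce: "0 < Ce" and \<epsilon>: "0 < \<epsilon>" and
    nonlocal: "\<forall>f G r. f \<in> borel_measurable vol \<longrightarrow> has_weak_gradient TYPE('m) X vol f G \<longrightarrow> 0 \<le> r \<longrightarrow> r < \<epsilon> \<longrightarrow>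
      (\<integral>\<^sup>+x. \<integral>\<^sup>+y. indicator {z. norm z \<le> r} (x - y) * ennreal ((f x - f y)\<^sup>2) \<partial>vol \<partial>vol) \<le>
      ennreal (Ce * r ^ (CARD('m) + 2)) * (\<integral>\<^sup>+x. ennreal ((norm (G x))\<^sup>2) \<partial>vol)"
    using manifold_nonlocal_energy_le[OF manifold(1,2) volume finV] by (elim exE conjE) (rule that; assumption)
  obtain k \<epsilon>' and T :: "((real^'m) set \<times> (real^'m \<Rightarrow> real^'d) \<times> (real^'m) \<times> real) set"
    where T: "finite T" and k: "0 < k" and \<epsilon>': "0 < \<epsilon>'"
      and good': "\<forall>(U, \<phi>, u0, s)\<in>T. good_chart k X U \<phi> u0 s"
      and leb: "\<forall>x\<in>X. \<forall>y\<in>X. dist x y < \<epsilon>' \<longrightarrow> (\<exists>(U, \<phi>, u0, s)\<in>T. x \<in> \<phi> ` open_cube u0 s \<and> y \<in> \<phi> ` open_cube u0 s)"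
    using finite_chart_cover[OF manifold(1,2)] by (elim exE conjE) (rule that; assumption)
  have good: "good_chart k X U \<phi> u0 s" if "(U, \<phi>, u0, s) \<in> T" for U \<phi> u0 s
    using bspec[OF good' that] by simp
  have cover: "\<exists>(U, \<phi>, u0, s)\<in>T. y \<in> \<phi> ` open_cube u0 s" if y: "y \<in> X" for y
  proof -
    have "dist y y < \<epsilon>'" using \<epsilon>' by simp
    then obtain t where t: "t \<in> T" "case t of (U, \<phi>, u0, s) \<Rightarrow> y \<in> \<phi> ` open_cube u0 s \<and> y \<in> \<phi> ` open_cube u0 s"
      using leb y by blast
    from t(2) have "case t of (U, \<phi>, u0, s) \<Rightarrow> y \<in> \<phi> ` open_cube u0 s" by (cases t) simp
    with t(1) show ?thesis by blast
  qed
  define A where "A = real (card T) + 1"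
  \<comment> \<open>On the good event a cell contains between \<open>a1\<close> and
    \<open>a2\<close> times \<open>n / (2 ^ J) ^ m\<close> points. The factors 1/4 and 3 are those
    of \<open>count_concentration\<close>.\<close>
  define a1 where "a1 = p_min / k * (2 / k) ^ m / 4"
  define a2 where "a2 = 3 * (p_max * k * (2 * k) ^ m)"
  define \<kappa> where "\<kappa> = a2 / a1"
  \<comment> \<open>J will be chosen with \<open>r * 2 ^ J\<close> between \<Lambda> and 2
    \<Lambda>: the lower end makes points of adjacent cells neighbours in the graph, the upper end
    keeps the cells large enough to be populated.\<close>
  define \<Lambda> where "\<Lambda> = 4 * real m * k\<^sup>2"
  \<comment> \<open>The gap constant without its dependence on n and J. Bounding 1 / 2^J from below
    by r / (2 \<Lambda>) turns \<open>a3\<close> into the second entry of \<open>c1\<close>.\<close>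
  define a3 where "a3 = a1 * K 1 / (4 * A * (1 + \<kappa> * 2 ^ m))"
  define c1 where "c1 = min 1 (a3 / (2 * \<Lambda>) ^ (m + 2))"
  \<comment> \<open>\<open>C2 * \<theta> ^ m\<close> bounds the trace and
    \<open>C3 * \<theta> ^ m\<close> is \<rho> times the bound on the expected energy.
    \<open>C\<close> has to cover the Markov numerator \<open>C3 + 2 * C2\<close> and the prefactor
    in the probability of a bad design.\<close>
  define C2 where "C2 = A + 6 * 2 ^ m * A / c1\<^sup>2 + 1 / \<Lambda> ^ 4 / c1\<^sup>2"
  define C3 where "C3 = p_max\<^sup>2 * K 0 * Ce"
  define C where "C = C3 + 2 * C2 + 2 * A * (2 * \<Lambda>) ^ m"
  define c where "c = a1 / (2 * \<Lambda>) ^ m"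
  \<comment> \<open>\<epsilon>/2 keeps \<open>r\<close> where the nonlocal energy bound holds;
    \<Lambda> ensures \<Lambda>/r \<ge> 1, so that a suitable power of two exists.\<close>
  define c0 where "c0 = min (\<epsilon> / 2) \<Lambda>"
  have A: "0 < A" "real (card T) \<le> A" by (simp_all add: A_def)
  have a1: "0 < a1" using p_bounds(1) k by (simp add: a1_def)
  have a2: "0 < a2" using p_max k by (simp add: a2_def)
  have \<kappa>: "0 < \<kappa>" using a1 a2 by (simp add: \<kappa>_def)
  have \<kappa>': "0 < 1 + \<kappa> * 2 ^ m" using \<kappa> by (simp add: add_pos_pos)
  have \<Lambda>: "0 < \<Lambda>" using m1 k by (simp add: \<Lambda>_def)
  have a3: "0 < a3" unfolding a3_def using a1 K(4) A(1) \<kappa>' by simp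
  have c1: "0 < c1" "c1 \<le> 1" using a3 \<Lambda> by (simp_all add: c1_def)
  have C2: "0 < C2" unfolding C2_def using A(1) c1 \<Lambda> by (intro add_pos_pos) simp_all
  have C3: "0 < C3" using p_max K0 Ce by (simp add: C3_def)
  have C: "0 < C" "C3 + 2 * C2 \<le> C" "2 * A * (2 * \<Lambda>) ^ m \<le> C"
    using C2 C3 A(1) \<Lambda> by (simp_all add: C_def add_pos_pos)
  have c: "0 < c" using a1 \<Lambda> by (simp add: c_def)
  have c0: "0 < c0" using \<epsilon> \<Lambda> by (simp add: c0_def)
  have main: "measure (regression_sample n P f0)
         {z \<in> space (regression_sample n P f0).
            in_sample_error n f0 (\<lambda>i. fst (z i))
              (laplacian_smoothing n K r \<rho> (\<lambda>i. fst (z i)) (\<lambda>i. snd (z i)))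
            \<le> C / \<delta> * M powr (2 * real m / (2 + real m)) * real n powr (- 2 / (2 + real m))}
       \<ge> 1 - \<delta> - C * real n * exp (- c * real n * r ^ m)
           - exp (- c * (M\<^sup>2 * real n) powr (real m / (2 + real m)))"
    if n3: "3 \<le> n" and M: "real n powr (- 1 / 2) \<le> M" and f0: "f0 \<in> H1_ball TYPE('m) X vol M"
      and \<delta>: "0 < \<delta>" and r1: "1 * (ln (real n) / real n) powr (1 / real m) \<le> r"
      and r2: "r \<le> min c0 (M powr ((real m - 4) / (4 + 2 * real m)) * real n powr (- 3 / (4 + 2 * real m)))"
      and \<rho>: "\<rho> = M powr (- 4 / (2 + real m)) * inverse (real n * r ^ (m + 2)) * real n powr (- 2 / (2 + real m))"
    for n M f0 \<delta> r \<rho>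
  proof -
    have n: "0 < n" "1 \<le> real n" using n3 by auto
    \<comment> \<open>The choice N = 3 rests on \<open>exp_le\<close>, the bound of e by 3: it gives
      ln n \<ge> 1, and thereby n r^m \<ge> 1 from the lower bound on \<open>r\<close>.\<close>
    have "1 = ln (exp (1::real))" by simp
    also have "\<dots> \<le> ln (real n)" using n3 exp_le by (subst ln_le_cancel_iff) auto
    finally have ln1: "1 \<le> ln (real n)" .
    have "0 < (ln (real n) / real n) powr (1 / real m)" using ln1 n3 by simp
    with r1 have r: "0 < r" by linarith
    have rm: "1 \<le> r ^ m * real n"
    proof -
      have "1 / real n \<le> ln (real n) / real n" using ln1 n by (intro divide_right_mono) auto
      also have "\<dots> = ((ln (real n) / real n) powr (1 / real m)) ^ m"
      proof -
        have "x = (x powr (1 / real m)) ^ m" if "0 < x" for x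
          using that m1 by (simp add: powr_realpow[symmetric] powr_powr)
        moreover have "0 < ln (real n) / real n" using ln1 n3 by simp
        ultimately show ?thesis by blast
      qed
      also have "\<dots> \<le> r ^ m" using r1 by (intro power_mono) auto
      finally show ?thesis using n by (simp add: field_simps)
    qed
    have "0 < real n powr (- 1 / 2)" using n by simp
    with M have M0: "0 < M" by linarith
    have Mn: "1 \<le> M\<^sup>2 * real n"
    proof -
      have "(real n powr (- 1 / 2))\<^sup>2 \<le> M\<^sup>2" using M by (intro power_mono) auto
      moreover have "(real n powr (- 1 / 2))\<^sup>2 = 1 / real n"
        using n by (simp add: power2_eq_square powr_add[symmetric] powr_minus_divide)
      ultimately have "1 / real n \<le> M\<^sup>2" by simp
      then show ?thesis using n by (simp add: field_simps)
    qed
    define \<theta> where "\<theta> = (M\<^sup>2 * real n) powr (1 / (2 + real m))"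
    have n0: "0 < real n" using n by simp
    note rate = rate_identities[OF M0 n0 Mn, where m = m, folded \<theta>_def]
    have \<theta>: "1 \<le> \<theta>" by (rule rate(1))
    have \<theta>m: "0 < \<theta> ^ m" using \<theta> by simp
    \<comment> \<open>With this normalization \<rho> times the gap at level l is of order (2^l /
      \<theta>)^2, so \<theta> marks the critical scale.\<close>
    have \<rho>_eq: "\<rho> * (real n * r ^ (m + 2)) = 1 / \<theta>\<^sup>2"
    proof -
      have "\<rho> * (real n * r ^ (m + 2)) = (M powr (- 4 / (2 + real m)) * real n powr (- 2 / (2 + real m))) * (inverse (real n * r ^ (m + 2)) * (real n * r ^ (m + 2)))"
        by (simp add: \<rho> mult_ac)
      also have "inverse (real n * r ^ (m + 2)) * (real n * r ^ (m + 2)) = 1" by (rule left_inverse) (use n r in simp)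
      finally show ?thesis using rate(4) by simp
    qed
    have \<rho>0: "0 \<le> \<rho>" using r n by (simp add: \<rho>)
    have r4: "real n * \<theta> ^ 4 * r ^ 4 \<le> \<theta> ^ m" using r2 r by (intro rate(5)) auto
    have "1 \<le> \<Lambda> / r" using r2 r by (simp add: c0_def)
    then obtain J where J: "\<Lambda> / r \<le> 2 ^ J" "2 ^ J \<le> 2 * (\<Lambda> / r)" using exists_power_of_two by blast
    have J1: "\<Lambda> \<le> r * 2 ^ J" using J(1) r by (simp add: field_simps)
    have J2: "r / (2 * \<Lambda>) \<le> 1 / 2 ^ J" using J(2) r \<Lambda> by (simp add: field_simps)
    have J2': "(r / (2 * \<Lambda>)) ^ j \<le> 1 / (2 ^ J) ^ j" for j
      using power_mono[OF J2, of j] r \<Lambda> by (simp add: power_divide)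
    define lo where "lo = real n * a1 / (2 ^ J) ^ m"
    have lo: "0 < lo" using a1 n by (simp add: lo_def)
    have lo_ge: "c * real n * r ^ m \<le> lo"
    proof -
      have "c * real n * r ^ m = real n * a1 * (r / (2 * \<Lambda>)) ^ m" by (simp add: c_def power_divide)
      also have "\<dots> \<le> real n * a1 * (1 / (2 ^ J) ^ m)" using a1 by (intro mult_left_mono J2') auto
      finally show ?thesis by (simp add: lo_def)
    qed
    define I where "I = T \<times> grid (2 ^ J) (UNIV :: 'm set)"
    define B where "B = (\<lambda>((U :: (real^'m) set, \<phi> :: real^'m \<Rightarrow> real^'d, u0, s), q). \<phi> ` cell u0 s J q)"
    have finI: "finite I" unfolding I_def using T by (simp add: finite_grid)
    have B_bounds: "B i \<in> sets P \<and> lo \<le> real n * measure P (B i) / 4 \<and> 3 * (real n * measure P (B i)) \<le> \<kappa> * lo" if "i \<in> I" for i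
    proof -
      obtain U \<phi> u0 s q where i: "i = ((U, \<phi>, u0, s), q)" by (cases i) auto
      have t: "(U, \<phi>, u0, s) \<in> T" and q: "q \<in> grid (2 ^ J) UNIV" using that by (auto simp: i I_def)
      note b = measure_chart_cell_bounds[OF volume manifold(2) good[OF t] k q design(1,3,2) p_bounds, folded dim(1)]
      have "real n * (p_min / k * (2 / k) ^ m / (2 ^ J) ^ m) \<le> real n * measure P (B i)"
        using b(1) by (intro mult_left_mono) (auto simp: B_def i)
      then have "lo \<le> real n * measure P (B i) / 4" by (simp add: lo_def a1_def)
      moreover have "3 * (real n * measure P (B i)) \<le> 3 * (real n * (p_max * k * (2 * k) ^ m / (2 ^ J) ^ m))"
        using b(2) by (intro mult_left_mono) (auto simp: B_def i)
      then have "3 * (real n * measure P (B i)) \<le> \<kappa> * lo"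
        using a1 by (simp add: lo_def \<kappa>_def a2_def mult_ac)
      ultimately show ?thesis using b(3) by (simp add: B_def i)
    qed
    define G where "G x \<longleftrightarrow> (\<forall>i\<in>I. lo \<le> real (count_in n (B i) x) \<and> real (count_in n (B i) x) \<le> \<kappa> * lo)" for x
    have G_meas: "Measurable.pred (design_law n P) G"
      and G_prob: "measure (design_law n P) {x \<in> space (design_law n P). \<not> G x} \<le> real (card I) * (2 * exp (- lo))"
      unfolding G_def using good_counts_probability[OF design(1) finI, of B lo n "\<kappa> * lo"] B_bounds by auto
    \<comment> \<open>There are of order r^-m cells, which \<open>rm\<close> bounds by a constant
      times n.\<close>
    have q_le: "real (card I) * (2 * exp (- lo)) \<le> C * real n * exp (- c * real n * r ^ m)"
    proof -
      have "real (card I) = real (card T) * (2 ^ J) ^ m"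
        by (simp add: I_def card_cartesian_product card_grid dim(1))
      also have "\<dots> \<le> A * (2 * (\<Lambda> / r)) ^ m"
        using A J(2) by (intro mult_mono power_mono) auto
      also have "\<dots> = A * (2 * \<Lambda>) ^ m * (1 / r ^ m)" by (simp add: power_divide power_mult_distrib)
      also have "\<dots> \<le> A * (2 * \<Lambda>) ^ m * real n"
        using A \<Lambda> rm r by (intro mult_left_mono) (auto simp: field_simps)
      finally have "real (card I) * (2 * exp (- lo)) \<le> A * (2 * \<Lambda>) ^ m * real n * (2 * exp (- (c * real n * r ^ m)))"
        using lo_ge by (intro mult_mono) auto
      also have "\<dots> = 2 * A * (2 * \<Lambda>) ^ m * (real n * exp (- c * real n * r ^ m))" by simp
      also have "\<dots> \<le> C * (real n * exp (- c * real n * r ^ m))" using C(3) by (intro mult_right_mono) auto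
      finally show ?thesis by (simp add: mult.assoc)
    qed
    have trace: "(\<Sum>j<n. ip n (smoothing_operator.smoother n (graph_weight K r x) \<rho> (unit_vec j)) (smoothing_operator.smoother n (graph_weight K r x) \<rho> (unit_vec j))) \<le> C2 * \<theta> ^ m"
      if x: "x \<in> space (design_law n P)" and Gx: "G x" for x
    proof -
      have xX: "x i \<in> X" if "i < n" for i using x that by (auto simp: space_PiM spaceP PiE_iff)
      have \<mu>: "c1 / \<theta>\<^sup>2 \<le> \<rho> * (lo * K 1 / (4 ^ J * (4 * A * (1 + \<kappa> * 2 ^ m))))"
      proof -
        have "c1 / \<theta>\<^sup>2 \<le> a3 / (2 * \<Lambda>) ^ (m + 2) / \<theta>\<^sup>2" by (intro divide_right_mono) (auto simp: c1_def)
        also have "\<dots> = a3 / (2 * \<Lambda>) ^ (m + 2) * (\<rho> * (real n * r ^ (m + 2)))" unfolding \<rho>_eq by simp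
        also have "\<dots> = \<rho> * real n * a3 * (r / (2 * \<Lambda>)) ^ (m + 2)" by (simp add: power_divide)
        also have "\<dots> \<le> \<rho> * real n * a3 * (1 / (2 ^ J) ^ (m + 2))"
          using \<rho>0 a3 by (intro mult_left_mono J2') auto
        also have "\<dots> = \<rho> * (lo * K 1 / (4 ^ J * (4 * A * (1 + \<kappa> * 2 ^ m))))"
        proof -
          have eq: "(2 ^ J) ^ (m + 2) = (2 ^ J) ^ m * (4::real) ^ J"
            by (simp add: power_add power2_eq_square power_mult_distrib[symmetric])
          show ?thesis unfolding eq a3_def lo_def by (simp add: mult_ac)
        qed
        finally show ?thesis .
      qed
      \<comment> \<open>The finest scale satisfies 2^J \<ge> \<Lambda>/r, which converts the upper
        bound on \<open>r\<close>, in the form \<open>r4\<close>, into the hypothesis on the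
        leftover directions.\<close>
      have last: "real n * \<theta> ^ 4 \<le> 1 / \<Lambda> ^ 4 * (\<theta> ^ m * 16 ^ J)"
      proof -
        have "\<Lambda> ^ 4 \<le> (r * 2 ^ J) ^ 4" using J1 \<Lambda> by (intro power_mono) auto
        also have "\<dots> = r ^ 4 * 16 ^ J" by (simp add: power_mult_distrib power_mult[symmetric] mult.commute[of J]) (simp add: power_mult)
        finally have "real n * \<theta> ^ 4 * \<Lambda> ^ 4 \<le> real n * \<theta> ^ 4 * (r ^ 4 * 16 ^ J)" using \<theta> by (intro mult_left_mono) auto
        also have "\<dots> = real n * \<theta> ^ 4 * r ^ 4 * 16 ^ J" by simp
        also have "\<dots> \<le> \<theta> ^ m * 16 ^ J" using r4 by (intro mult_right_mono) auto
        finally show ?thesis using \<Lambda> by (simp add: field_simps)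
      qed
      show ?thesis
        unfolding C2_def dim(1)
      proof (rule trace_le_good_design[where T = T and k = k and X = X and lo = lo and \<kappa> = \<kappa> and J = J])
        show "lo \<le> real (count_in n (\<phi> ` cell u0 s J q) x) \<and> real (count_in n (\<phi> ` cell u0 s J q) x) \<le> \<kappa> * lo"
          if "(U, \<phi>, u0, s) \<in> T" "q \<in> grid (2 ^ J) UNIV" for U \<phi> u0 s q
        proof -
          have "((U, \<phi>, u0, s), q) \<in> I" using that by (simp add: I_def)
          from bspec[OF Gx[unfolded G_def] this] show ?thesis by (simp add: B_def)
        qed
        show "4 * real CARD('m) * k\<^sup>2 \<le> r * 2 ^ J" using J1 by (simp add: \<Lambda>_def dim(1))
        show "0 \<le> K t" if "0 \<le> t" for t using K(1)[OF that] by blast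
      qed (use T k good cover xX K(2,4) r \<rho>0 lo \<kappa> A dim(2) \<theta> c1 \<mu> last in \<open>simp_all add: dim(1)\<close>)
    qed
    obtain Gr where f0m: "f0 \<in> borel_measurable vol" and Gr: "has_weak_gradient TYPE('m) X vol f0 Gr"
      and GrM: "(\<integral>\<^sup>+x. ennreal ((norm (Gr x))\<^sup>2) \<partial>vol) \<le> ennreal (M\<^sup>2)"
      using H1_ball_gradient[OF f0] by blast
    have f0P: "f0 \<in> borel_measurable P" using f0m by (simp add: measurable_cong_sets[OF setsP refl])
    define E where "E = Ce * r ^ (m + 2) * M\<^sup>2"
    have E: "0 \<le> E" using Ce r by (simp add: E_def)
    have local_energy: "(\<integral>\<^sup>+x. \<integral>\<^sup>+y. indicator {z. norm z \<le> r} (x - y) * ennreal ((f0 x - f0 y)\<^sup>2) \<partial>vol \<partial>vol) \<le> ennreal E"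
    proof -
      have "r < \<epsilon>" using r2 \<epsilon> by (simp add: c0_def)
      then have "(\<integral>\<^sup>+x. \<integral>\<^sup>+y. indicator {z. norm z \<le> r} (x - y) * ennreal ((f0 x - f0 y)\<^sup>2) \<partial>vol \<partial>vol) \<le> ennreal (Ce * r ^ (m + 2)) * (\<integral>\<^sup>+x. ennreal ((norm (Gr x))\<^sup>2) \<partial>vol)"
        using nonlocal[rule_format, OF f0m Gr less_imp_le[OF r]] by (simp add: dim(1))
      also have "\<dots> \<le> ennreal (Ce * r ^ (m + 2)) * ennreal (M\<^sup>2)" by (intro mult_left_mono GrM) simp
      also have "\<dots> = ennreal E" using Ce r by (simp add: E_def ennreal_mult)
      finally show ?thesis .
    qed
    define \<beta> where "\<beta> = (real n)\<^sup>2 * (p_max\<^sup>2 * K 0 * E)"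
    have \<beta>: "0 \<le> \<beta>" using K0 E by (simp add: \<beta>_def)
    have energy: "(\<integral>\<^sup>+x. ennreal (dirichlet_energy n (graph_weight K r x) (\<lambda>i. f0 (x i))) \<partial>design_law n P) \<le> ennreal \<beta>"
      unfolding \<beta>_def
      by (rule expected_energy_le[OF design(1,3,2) finV _ _ identV f0m Km[OF r] K(1) K(3) r E local_energy])
        (use p_max p_bounds(2) space_vol in auto)
    \<comment> \<open>Since M^2 n = \<theta>^(m+2), the bias bound has the same order \<theta>^m as
      the trace: the prescribed \<rho> balances the two.\<close>
    have \<rho>\<beta>: "\<rho> * \<beta> = C3 * \<theta> ^ m"
    proof -
      have "\<rho> * \<beta> = (\<rho> * (real n * r ^ (m + 2))) * C3 * (M\<^sup>2 * real n)"
        by (simp add: \<beta>_def E_def C3_def power2_eq_square mult_ac)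
      also have "\<dots> = 1 / \<theta>\<^sup>2 * C3 * \<theta> ^ (m + 2)" unfolding \<rho>_eq rate(2) ..
      also have "\<dots> = C3 * \<theta> ^ m" using \<theta> by (simp add: power2_eq_square)
      finally show ?thesis .
    qed
    define t where "t = C / \<delta> * (\<theta> ^ m / real n)"
    have t: "0 < t" using C(1) \<delta> \<theta>m n by (simp add: t_def)
    have t_eq: "C / \<delta> * M powr (2 * real m / (2 + real m)) * real n powr (- 2 / (2 + real m)) = t"
      unfolding t_def rate(3)[symmetric] by (simp add: mult.assoc)
    have "1 - real (card I) * (2 * exp (- lo)) - (\<rho> * \<beta> + 2 * (C2 * \<theta> ^ m)) / (real n * t) \<le> measure (regression_sample n P f0)
       {z \<in> space (regression_sample n P f0).
          in_sample_error n f0 (\<lambda>i. fst (z i))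
            (laplacian_smoothing n K r \<rho> (\<lambda>i. fst (z i)) (\<lambda>i. snd (z i))) \<le> t}"
    proof (rule smoothing_probability_ge[OF design(1) f0P identP _ Km[OF r] less_imp_le[OF r] \<rho>0 n(1) t _ \<beta> G_meas trace energy G_prob])
      show "0 \<le> K s" if "0 \<le> s" for s using K(1)[OF that] by blast
      show "0 \<le> C2 * \<theta> ^ m" using C2 \<theta>m by simp
    qed
    \<comment> \<open>The powers of \<theta> cancel, and Markov's ratio is \<delta> times (C3 + 2
      C2) / C.\<close>
    moreover have "(\<rho> * \<beta> + 2 * (C2 * \<theta> ^ m)) / (real n * t) \<le> \<delta>"
    proof -
      have num: "\<rho> * \<beta> + 2 * (C2 * \<theta> ^ m) = (C3 + 2 * C2) * \<theta> ^ m" unfolding \<rho>\<beta> by (simp add: algebra_simps)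
      have den: "real n * t = C / \<delta> * \<theta> ^ m" using n by (simp add: t_def)
      have "(\<rho> * \<beta> + 2 * (C2 * \<theta> ^ m)) / (real n * t) = (C3 + 2 * C2) / C * \<delta>"
        unfolding num den using \<theta> by simp
      also have "\<dots> \<le> 1 * \<delta>" using C \<delta> by (intro mult_right_mono) simp_all
      finally show ?thesis by simp
    qed
    moreover have "0 \<le> exp (- c * (M\<^sup>2 * real n) powr (real m / (2 + real m)))" by simp
    ultimately show ?thesis unfolding t_eq using q_le by linarith
  qed
  show ?thesis
    \<comment> \<open>C0 = 1 and N = 3; the geometry, the design density and the kernel enter
      through \<open>c0\<close>, \<open>C\<close> and \<open>c\<close> alone.\<close>
    by (rule exI[of _ 1], rule exI[of _ c0], rule exI[of _ 3], rule exI[of _ C], rule exI[of _ c])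
      (intro conjI allI impI main; (rule c0 C(1) c | assumption | simp))
qed


end
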